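(* Let $n$ be a positive integer and $(W,S)=(W_n,S_n)$, the Coxeter system of type $A_{n-1}$. Let $w\in W$ and $J\subseteq S$. Then $\{x\in W\mid w_J\leqslant_{\mathsf L}x\leqslant_{\mathsf L}ww_J\}$ is a nonempty union of Kazhdan–Lusztig left cells of $W$ if and only if there is a skew partition $\lambda/\mu\vdash n$ with $w=\mathrm{perm}(\tau^{\lambda/\mu})$ and $J=J_{\lambda/\mu}$. Moreover, in this case, an element $x\in W$ satisfies $w_J\leqslant_{\mathsf L}x\leqslant_{\mathsf L}ww_J$ if and only if $xw_J\tau_{\lambda/\mu}\in\mathrm{Std}(\lambda/\mu)$.
   Context: $W_n=\mathrm{Sym}(\{1,\dots,n\})$, acting on the left, with $S_n=\{s_i\mid1\leqslant i<n\}$, $s_i=(i,i+1)$, and length function $l$. The left weak order is $y\leqslant_{\mathsf L}x$ iff $l(xy^{-1})=l(x)-l(y)$. For $J\subseteq S_n$, $w_J$ is the longest element of the subgroup $W_J$ generated by $J$. Kazhdan–Lusztig left cells are the usual ones: the equivalence classes of the preorder on $W$ generated by $x\leqslant y$ whenever $C_x$ occurs with nonzero coefficient in $T_sC_y$ for some $s\in S$ ($C$ the Kazhdan–Lusztig basis of the Hecke algebra). For a partition $\lambda$ put $\lambda_i=0$ for $i$ beyond the number of parts; $[\lambda]=\{(i,j)\mid 1\leqslant j\leqslant\lambda_i\}$ ($i$ = row, $j$ = column). A skew partition $\lambda/\mu\vdash n$ is a pair of partitions $\lambda$ of $m+n$ and $\mu$ of $m$ (some $m\geqslant0$) with $\mu_i\leqslant\lambda_i$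 for all $i$; $[\lambda/\mu]=[\lambda]\setminus[\mu]$. A $(\lambda/\mu)$-tableau is a bijection $t\colon[\lambda/\mu]\to\{1,\dots,n\}$; it is standard if entries increase along rows (left to right) and down columns; $\mathrm{Std}(\lambda/\mu)$ is the set of standard ones. $\tau^{\lambda/\mu}$ is the tableau in which $1,\dots,n$ fill the rows in order from top row to bottom row, left to right in each row; $\tau_{\lambda/\mu}$ is the one in which $1,\dots,n$ fill the columns in order from left to right, top to bottom in each column. $W_n$ acts on tableaux by $(wt)(i,j)=w(t(i,j))$; $\mathrm{perm}(t)$ is the unique $w\in W_n$ with $w\tau_{\lambda/\mu}=t$. $J_{\lambda/\mu}=\{s_i\in S_n\mid i,i+1\text{ lie in the same column of }\tau_{\lambda/\mu}\}$. *)

theory Defs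
  imports
    "HOL-Combinatorics.Permutations"
    "HOL-Library.FuncSet"
    "HOL-Library.Poly_Mapping"
begin

section \<open>The Coxeter system of type \<open>A\<^sub>n\<^sub>-\<^sub>1\<close>\<close>

text \<open>Permutations are functions on \<^typ>\<open>nat\<close> fixing everything outside \<open>{1..n}\<close>; they act on
  the left, so the product \<open>x y\<close> is \<^term>\<open>x \<circ> y\<close>.\<close>

definition W :: "nat \<Rightarrow> (nat \<Rightarrow> nat) set" where
  "W n = {p. p permutes {1..n}}"

definition simple :: "nat \<Rightarrow> nat \<Rightarrow> nat" where
  "simple i = transpose i (i + 1)"

definition S :: "nat \<Rightarrow> (nat \<Rightarrow> nat) set" where
  "S n = simple ` {i. 1 \<le> i \<and> i < n}"

definition word_prod :: "(nat \<Rightarrow> nat) list \<Rightarrow> nat \<Rightarrow> nat" where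
  "word_prod ss = foldr (\<circ>) ss id"

definition len :: "nat \<Rightarrow> (nat \<Rightarrow> nat) \<Rightarrow> nat" where
  "len n w = (LEAST k. \<exists>ss. set ss \<subseteq> S n \<and> word_prod ss = w \<and> length ss = k)"

definition left_weak_le :: "nat \<Rightarrow> (nat \<Rightarrow> nat) \<Rightarrow> (nat \<Rightarrow> nat) \<Rightarrow> bool" where
  "left_weak_le n y x \<longleftrightarrow> int (len n (x \<circ> inv y)) = int (len n x) - int (len n y)"

text \<open>Simple reflections are involutions, so the products of words in \<open>J\<close> form a subgroup.\<close>

definition parabolic :: "(nat \<Rightarrow> nat) set \<Rightarrow> (nat \<Rightarrow> nat) set" where
  "parabolic J = {word_prod ss | ss. set ss \<subseteq> J}"

definition longest :: "nat \<Rightarrow> (nat \<Rightarrow> nat) set \<Rightarrow> nat \<Rightarrow> nat" where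
  "longest n J = (THE w. w \<in> parabolic J \<and> (\<forall>v\<in>parabolic J. len n v \<le> len n w))"

definition reflections :: "nat \<Rightarrow> (nat \<Rightarrow> nat) set" where
  "reflections n = {x \<circ> s \<circ> inv x | x s. x \<in> W n \<and> s \<in> S n}"

definition bruhat_less :: "nat \<Rightarrow> (nat \<Rightarrow> nat) \<Rightarrow> (nat \<Rightarrow> nat) \<Rightarrow> bool" where
  "bruhat_less n =
    (\<lambda>y x. x \<in> W n \<and> (\<exists>t\<in>reflections n. y = t \<circ> x \<and> len n y < len n x))\<^sup>+\<^sup>+"

section \<open>The Hecke algebra and its Kazhdan--Lusztig basis\<close>

text \<open>The ring \<open>\<int>[q, q\<^sup>-\<^sup>1]\<close> of Laurent polynomials is the group ring of \<open>(\<int>, +)\<close>: the product of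
  \<^typ>\<open>int \<Rightarrow>\<^sub>0 int\<close> is convolution, and the coefficient of \<open>q\<^sup>k\<close> in \<open>a\<close> is
  \<^term>\<open>Poly_Mapping.lookup a k\<close>.\<close>

type_synonym laurent = "int \<Rightarrow>\<^sub>0 int"

definition q :: laurent where "q = Poly_Mapping.single 1 1"
definition q_inv :: laurent where "q_inv = Poly_Mapping.single (-1) 1"

definition laurent_bar :: "laurent \<Rightarrow> laurent" where
  "laurent_bar a = Poly_Mapping.map_key uminus a"

text \<open>The Hecke algebra is the free \<open>\<int>[q, q\<^sup>-\<^sup>1]\<close>-module on the symbols \<open>T\<^sub>w\<close>, \<open>w \<in> W n\<close>; an element
  is identified with its family of coefficients. The normalisation is
  \<open>T\<^sub>s\<^sup>2 = 1 + (q - q\<^sup>-\<^sup>1) T\<^sub>s\<close>, where \<open>q\<close> stands for the \<open>q\<^sup>1\<^sup>/\<^sup>2\<close> of Kazhdan and Lusztig, and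
  \<open>T\<^sub>s\<close> for their \<open>q\<^sup>-\<^sup>1\<^sup>/\<^sup>2 T\<^sub>s\<close>. This changes each \<open>T\<^sub>w\<close> by a unit only.\<close>

type_synonym hecke = "(nat \<Rightarrow> nat) \<Rightarrow> laurent"

definition hecke_carrier :: "nat \<Rightarrow> hecke set" where
  "hecke_carrier n = {h. \<forall>w. w \<notin> W n \<longrightarrow> h w = 0}"

definition T :: "(nat \<Rightarrow> nat) \<Rightarrow> hecke" where
  "T w = (\<lambda>v. if v = w then 1 else 0)"

text \<open>\<open>T\<^sub>s h\<close>, where \<open>T\<^sub>s T\<^sub>w\<close> is \<open>T\<^sub>s\<^sub>w\<close> if \<open>l(sw) > l(w)\<close>, and \<open>T\<^sub>s\<^sub>w + (q - q\<^sup>-\<^sup>1) T\<^sub>w\<close> if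
  \<open>l(sw) < l(w)\<close>.\<close>

definition hecke_gen_mult :: "nat \<Rightarrow> (nat \<Rightarrow> nat) \<Rightarrow> hecke \<Rightarrow> hecke" where
  "hecke_gen_mult n s h = (\<lambda>w. if w \<in> W n
     then h (s \<circ> w) + (if len n (s \<circ> w) < len n w then (q - q_inv) * h w else 0) else 0)"

definition reduced_word :: "nat \<Rightarrow> (nat \<Rightarrow> nat) \<Rightarrow> (nat \<Rightarrow> nat) list" where
  "reduced_word n w =
    (SOME ss. set ss \<subseteq> S n \<and> word_prod ss = w \<and> length ss = len n w)"

text \<open>For reduced \<open>y = s\<^sub>1 \<dots> s\<^sub>k\<close> we have \<open>T\<^sub>y = T\<^sub>s\<^sub>1 \<dots> T\<^sub>s\<^sub>k\<close>, whichever reduced word is chosen.\<close>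

definition hecke_mult :: "nat \<Rightarrow> hecke \<Rightarrow> hecke \<Rightarrow> hecke" where
  "hecke_mult n h k =
    (\<lambda>v. \<Sum>y\<in>W n. h y * foldr (hecke_gen_mult n) (reduced_word n y) k v)"

definition hecke_inverse :: "nat \<Rightarrow> hecke \<Rightarrow> hecke" where
  "hecke_inverse n h =
    (THE g. g \<in> hecke_carrier n \<and> hecke_mult n g h = T id \<and> hecke_mult n h g = T id)"

definition hecke_bar :: "nat \<Rightarrow> hecke \<Rightarrow> hecke" where
  "hecke_bar n h = (\<lambda>v. \<Sum>y\<in>W n. laurent_bar (h y) * hecke_inverse n (T (inv y)) v)"

text \<open>\<open>C\<^sub>w\<close> is the unique bar-invariant element of \<open>T\<^sub>w + (\<Sum>y<w. q \<int>[q] T\<^sub>y)\<close>, for example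
  \<open>C\<^sub>s = T\<^sub>s - q\<close>.\<close>

definition kl_basis :: "nat \<Rightarrow> (nat \<Rightarrow> nat) \<Rightarrow> hecke" where
  "kl_basis n w = (THE c. c \<in> hecke_carrier n \<and> hecke_bar n c = c \<and> c w = 1 \<and>
     (\<forall>y. y \<noteq> w \<and> c y \<noteq> 0 \<longrightarrow>
        bruhat_less n y w \<and> (\<forall>k. Poly_Mapping.lookup (c y) k \<noteq> 0 \<longrightarrow> k > 0)))"

section \<open>Left cells\<close>

text \<open>\<open>C\<^sub>x\<close> occurs with nonzero coefficient in \<open>h\<close>; the coefficients \<open>a\<close> are unique on \<^term>\<open>W n\<close>.\<close>

definition kl_occurs :: "nat \<Rightarrow> (nat \<Rightarrow> nat) \<Rightarrow> hecke \<Rightarrow> bool" where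
  "kl_occurs n x h \<longleftrightarrow>
    (\<exists>a :: hecke. h = (\<lambda>v. \<Sum>z\<in>W n. a z * kl_basis n z v) \<and> a x \<noteq> 0)"

definition left_cell_le :: "nat \<Rightarrow> (nat \<Rightarrow> nat) \<Rightarrow> (nat \<Rightarrow> nat) \<Rightarrow> bool" where
  "left_cell_le n =
    (\<lambda>x y. x \<in> W n \<and> y \<in> W n \<and> (\<exists>s\<in>S n. kl_occurs n x (hecke_mult n (T s) (kl_basis n y))))\<^sup>*\<^sup>*"

definition left_cells :: "nat \<Rightarrow> (nat \<Rightarrow> nat) set set" where
  "left_cells n =
    W n // {(x, y). x \<in> W n \<and> y \<in> W n \<and> left_cell_le n x y \<and> left_cell_le n y x}"

section \<open>Skew partitions and tableaux\<close>

definition is_partition :: "nat list \<Rightarrow> bool" where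
  "is_partition la \<longleftrightarrow> sorted_wrt (\<ge>) la \<and> 0 \<notin> set la"

text \<open>Parts are numbered from \<open>1\<close>.\<close>

definition part :: "nat list \<Rightarrow> nat \<Rightarrow> nat" where
  "part la i = (if 1 \<le> i \<and> i \<le> length la then la ! (i - 1) else 0)"

definition diagram :: "nat list \<Rightarrow> (nat \<times> nat) set" where
  "diagram la = {(i, j). 1 \<le> i \<and> 1 \<le> j \<and> j \<le> part la i}"

definition skew_partition :: "nat \<Rightarrow> nat list \<Rightarrow> nat list \<Rightarrow> bool" where
  "skew_partition n la mu \<longleftrightarrow> is_partition la \<and> is_partition mu \<and>
     sum_list la = sum_list mu + n \<and> (\<forall>i\<ge>1. part mu i \<le> part la i)"

definition skew_diagram :: "nat list \<Rightarrow> nat list \<Rightarrow> (nat \<times> nat) set" where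
  "skew_diagram la mu = diagram la - diagram mu"

text \<open>Tableaux are made \<^const>\<open>undefined\<close> outside the diagram, so that equality of tableaux is
  equality of functions. Accordingly the action of \<open>w\<close> on \<open>t\<close> is
  \<^term>\<open>compose (skew_diagram la mu) w t\<close>.\<close>

definition tableaux :: "nat \<Rightarrow> nat list \<Rightarrow> nat list \<Rightarrow> (nat \<times> nat \<Rightarrow> nat) set" where
  "tableaux n la mu = {t \<in> extensional (skew_diagram la mu).
     bij_betw t (skew_diagram la mu) {1..n}}"

definition std :: "nat \<Rightarrow> nat list \<Rightarrow> nat list \<Rightarrow> (nat \<times> nat \<Rightarrow> nat) set" where
  "std n la mu = {t \<in> tableaux n la mu.
     (\<forall>i j j'. (i, j) \<in> skew_diagram la mu \<and> (i, j') \<in> skew_diagram la mu \<and> j < j'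
        \<longrightarrow> t (i, j) < t (i, j')) \<and>
     (\<forall>i i' j. (i, j) \<in> skew_diagram la mu \<and> (i', j) \<in> skew_diagram la mu \<and> i < i'
        \<longrightarrow> t (i, j) < t (i', j))}"

text \<open>The entry of a cell is its position in the reading order of the cells.\<close>

definition tau_row :: "nat list \<Rightarrow> nat list \<Rightarrow> nat \<times> nat \<Rightarrow> nat" where
  "tau_row la mu = (\<lambda>(i, j)\<in>skew_diagram la mu.
     card {(i', j') \<in> skew_diagram la mu. i' < i \<or> i' = i \<and> j' \<le> j})"

definition tau_col :: "nat list \<Rightarrow> nat list \<Rightarrow> nat \<times> nat \<Rightarrow> nat" where
  "tau_col la mu = (\<lambda>(i, j)\<in>skew_diagram la mu.
     card {(i', j') \<in> skew_diagram la mu. j' < j \<or> j' = j \<and> i' \<le> i})"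

definition tab_act :: "nat list \<Rightarrow> nat list \<Rightarrow> (nat \<Rightarrow> nat) \<Rightarrow> (nat \<times> nat \<Rightarrow> nat) \<Rightarrow>
    nat \<times> nat \<Rightarrow> nat" where
  "tab_act la mu w t = compose (skew_diagram la mu) w t"

definition perm :: "nat \<Rightarrow> nat list \<Rightarrow> nat list \<Rightarrow> (nat \<times> nat \<Rightarrow> nat) \<Rightarrow> nat \<Rightarrow> nat" where
  "perm n la mu t = (THE w. w \<in> W n \<and> tab_act la mu w (tau_col la mu) = t)"

definition J_skew :: "nat \<Rightarrow> nat list \<Rightarrow> nat list \<Rightarrow> (nat \<Rightarrow> nat) set" where
  "J_skew n la mu = {simple i | i. 1 \<le> i \<and> i < n \<and>
     (\<exists>a b j. (a, j) \<in> skew_diagram la mu \<and> (b, j) \<in> skew_diagram la mu \<and>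
        tau_col la mu (a, j) = i \<and> tau_col la mu (b, j) = i + 1)}"

end

theory Submission
  imports Defs
begin

text \<open>Write \<open>x \<in> W\<close> as the word \<open>x(1) \<dots> x(n)\<close>. The length counts inversions, and \<open>y \<le>\<^sub>L x\<close> is inclusion of
  inversion sets, so that \<open>x\<close> lies in \<open>[w\<^sub>J, w w\<^sub>J]\<close> iff \<open>x w\<^sub>J\<close> is a linear extension of the poset
  \<open>a < b, w(a) < w(b)\<close>. For a skew shape this poset is the product order on the cells.

  Two facts about left cells are needed. First, exchanging the values \<open>k\<close> and \<open>k + 1\<close> stays in the left cell
  if \<open>k - 1\<close> or \<open>k + 2\<close> stands between them (dual Knuth moves): both Kazhdan--Lusztig edges are present.
  Second, left cells have constant right descent sets, and the right star operations (Knuth moves) map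
  left cells to left cells. The second part holds because, for adjacent \<open>s, t\<close>, right multiplication by \<open>T\<^sub>t - q\<close>
  is a homomorphism of left modules which, modulo the span of the \<open>C\<^sub>z\<close> with both descents, sends \<open>C\<^sub>w\<close>
  to the basis element of the star of \<open>w\<close>.

  If the shape is skew, a violated row condition between two neighbouring columns can be turned into a
  violated descent condition by star operations, so the standard tableaux are closed under left
  cells. Conversely, if a nonempty interval is closed under dual Knuth moves, then no linear extension has two
  comparable consecutive values with such a third value between them. This restricts the covering
  relation so strongly that the poset must be the product order on a skew diagram with the blocks of
  \<open>J\<close> as columns; the poset then determines \<open>w\<close>.\<close>

section \<open>Length and inversions\<close>

text \<open>The statement uses objects given by \<open>THE\<close> or \<open>SOME\<close>
  (\<open>longest\<close>, \<open>reduced_word\<close>, \<open>hecke_inverse\<close>,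
  \<open>kl_basis\<close>, \<open>perm\<close>); each has to be shown well defined, so the
  Kazhdan-Lusztig theory is built up here. What replaces associativity and the braid relations is
  that left and right multiplications by generators commute: an operator commuting with all right
  multiplications is determined by its value at \<open>T id\<close>. Formulas on the right come from
  those on the left by inverting the indices. The numbers \<open>kl_mu n z w\<close> are evaluated
  only where a descent of \<open>w\<close> that is not one of \<open>z\<close> forces them to be 0
  or -1. On the combinatorial side, the two cells of a row condition stand far apart in the word,
  and descents see neighbouring positions only; this is why the star operations have to shrink a
  whole window row by row. In the other direction, closure speaks of consecutive values only, so it
  can be applied to three elements only if some linear extension makes them consecutive. Convexity
  of the triple ensures this, and the study of the covering relation is a search for convex
  triples.\<close>

definition inversions :: "nat \<Rightarrow> (nat \<Rightarrow> nat) \<Rightarrow> (nat \<times> nat) set" where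
  "inversions n w = {(i, j). 1 \<le> i \<and> i < j \<and> j \<le> n \<and> w j < w i}"

lemma finite_inversions [simp]: "finite (inversions n w)"
proof -
  have "inversions n w \<subseteq> {1..n} \<times> {1..n}" by (auto simp: inversions_def)
  then show ?thesis by (rule finite_subset) simp
qed

lemma W_permutes: "w \<in> W n \<Longrightarrow> w permutes {1..n}"
  by (simp add: W_def)

lemma finite_W [simp]: "finite (W n)"
  by (simp add: W_def finite_permutations)

lemma W_id [simp]: "id \<in> W n"
  by (simp add: W_def permutes_id)

lemma W_comp: "x \<in> W n \<Longrightarrow> y \<in> W n \<Longrightarrow> x \<circ> y \<in> W n"
  by (simp add: W_def permutes_compose)

lemma W_inv: "x \<in> W n \<Longrightarrow> inv x \<in> W n"
  by (simp add: W_def permutes_inv)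

lemma W_inv_inv [simp]: "x \<in> W n \<Longrightarrow> inv (inv x) = x"
  by (simp add: W_def permutes_inv_inv)

lemma W_bij: "x \<in> W n \<Longrightarrow> bij x"
  by (simp add: W_def permutes_bij)

lemma W_inj: "x \<in> W n \<Longrightarrow> x a = x b \<longleftrightarrow> a = b"
  using W_bij[of x n] by (simp add: bij_def inj_eq)

lemma W_inv_f: "x \<in> W n \<Longrightarrow> inv x (x a) = a"
  by (metis W_permutes permutes_inverses(2))

lemma W_f_inv: "x \<in> W n \<Longrightarrow> x (inv x a) = a"
  by (metis W_permutes permutes_inverses(1))

lemma W_inv_comp [simp]: "x \<in> W n \<Longrightarrow> inv x \<circ> x = id"
  by (simp add: W_def permutes_inv_o)

lemma W_comp_inv [simp]: "x \<in> W n \<Longrightarrow> x \<circ> inv x = id"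
  by (simp add: W_def permutes_inv_o)

lemma W_inv_o: "x \<in> W n \<Longrightarrow> y \<in> W n \<Longrightarrow> inv (x \<circ> y) = inv y \<circ> inv x"
  by (simp add: W_bij o_inv_distrib)

lemma W_in: "x \<in> W n \<Longrightarrow> x a \<in> {1..n} \<longleftrightarrow> a \<in> {1..n}"
  using W_permutes permutes_in_image by metis

lemma W_in': "x \<in> W n \<Longrightarrow> 1 \<le> a \<Longrightarrow> a \<le> n \<Longrightarrow> 1 \<le> x a \<and> x a \<le> n"
  using W_in[of x n a] by simp

lemma W_eqI:
  assumes "x \<in> W n" "y \<in> W n" "\<And>a. 1 \<le> a \<Longrightarrow> a \<le> n \<Longrightarrow> x a = y a"
  shows "x = y"
proof
  fix a show "x a = y a"
    using assms W_permutes permutes_not_in by (metis atLeastAtMost_iff)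
qed

lemma transpose_W: "c \<in> {1..n} \<Longrightarrow> d \<in> {1..n} \<Longrightarrow> transpose c d \<in> W n"
  by (simp add: W_def permutes_swap_id)

lemma simple_W: "1 \<le> k \<Longrightarrow> k < n \<Longrightarrow> simple k \<in> W n"
  unfolding simple_def by (rule transpose_W) auto

lemma S_W: "s \<in> S n \<Longrightarrow> s \<in> W n"
  by (auto simp: S_def simple_W)

lemma simple_simple [simp]: "simple k (simple k a) = a"
  by (simp add: simple_def)

lemma simple_comp_simple [simp]: "simple k \<circ> simple k = id"
  by (simp add: simple_def)

lemma simple_comp_cancel [simp]: "simple k \<circ> (simple k \<circ> x) = x" "x \<circ> simple k \<circ> simple k = x"
  by (simp_all add: comp_assoc flip: comp_assoc[of "simple k" "simple k"])

lemma inv_simple [simp]: "inv (simple k) = simple k"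
  by (simp add: simple_def)

lemma S_cancel [simp]: "s \<in> S n \<Longrightarrow> s \<circ> (s \<circ> x) = x" "s \<in> S n \<Longrightarrow> x \<circ> s \<circ> s = x"
  by (auto simp: S_def)

lemma inv_S [simp]: "s \<in> S n \<Longrightarrow> inv s = s"
  by (auto simp: S_def)

lemma simple_apply: "simple k a = (if a = k then k + 1 else if a = k + 1 then k else a)"
  by (simp add: simple_def transpose_def)

lemma simple_eq_iff: "simple i = simple j \<longleftrightarrow> i = j"
proof
  assume eq: "simple i = simple j"
  have "simple j i = i + 1" using fun_cong[OF eq, of i] by (simp add: simple_apply)
  then show "i = j" unfolding simple_apply by presburger
qed simp

lemma simple_in_S: "simple k \<in> S n \<longleftrightarrow> 1 \<le> k \<and> k < n"
  by (auto simp: S_def simple_eq_iff)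

lemma simple_less:
  "c < d \<Longrightarrow> \<not> (c = k \<and> d = k + 1) \<Longrightarrow> simple k c < simple k d"
  by (auto simp: simple_apply)

text \<open>Left multiplication by \<open>simple k\<close> exchanges the values \<open>k\<close> and
  \<open>k + 1\<close>, so only the pair of their two positions changes its status.\<close>

lemma inversions_simple_comp:
  assumes w: "w \<in> W n" and k: "1 \<le> k" "k < n" and less: "inv w k < inv w (k + 1)"
  shows "inversions n (simple k \<circ> w) = insert (inv w k, inv w (k + 1)) (inversions n w)"
    and "(inv w k, inv w (k + 1)) \<notin> inversions n w"
proof -
  have iw: "inv w \<in> W n" using w by (rule W_inv)
  have r: "1 \<le> inv w k" "inv w (k+1) \<le> n"
    using W_in'[OF iw, of k] W_in'[OF iw, of "k+1"] k by auto
  show "(inv w k, inv w (k + 1)) \<notin> inversions n w"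
    using W_f_inv[OF w] by (auto simp: inversions_def)
  have key: "simple k (w j) < simple k (w i) \<longleftrightarrow> w j < w i \<or> (i = inv w k \<and> j = inv w (k+1))"
    if "i < j" for i j
  proof (cases "w i = k \<and> w j = k + 1")
    case True
    then have "i = inv w k" "j = inv w (k+1)" using w W_inv_f by (metis)+
    then show ?thesis using True by (simp add: simple_apply)
  next
    case False
    then have nn: "\<not> (i = inv w k \<and> j = inv w (k+1))" using W_f_inv[OF w] by auto
    have n2: "\<not> (w j = k \<and> w i = k + 1)" using that less w W_inv_f by (metis not_less_iff_gr_or_eq)
    have ne: "w i \<noteq> w j" using that W_inj[OF w] by auto
    show ?thesis using nn simple_less[of "w j" "w i" k] simple_less[of "w i" "w j" k] n2 False ne
      by (metis not_less_iff_gr_or_eq)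
  qed
  show "inversions n (simple k \<circ> w) = insert (inv w k, inv w (k + 1)) (inversions n w)"
    using key r less by (auto simp: inversions_def)
qed

lemma inv_simple_comp:
  assumes "w \<in> W n" "1 \<le> k" "k < n"
  shows "inv (simple k \<circ> w) a = inv w (simple k a)"
  using W_inv_o[OF simple_W[OF assms(2,3)] assms(1)] by simp

lemma card_inversions_simple_comp:
  assumes w: "w \<in> W n" and k: "1 \<le> k" "k < n"
  shows "card (inversions n (simple k \<circ> w)) =
    (if inv w k < inv w (k + 1) then card (inversions n w) + 1 else card (inversions n w) - 1)"
    and "inv w (k + 1) < inv w k \<Longrightarrow> card (inversions n w) > 0"
proof -
  let ?x = "simple k \<circ> w"
  have x: "?x \<in> W n" using w k by (simp add: W_comp simple_W)
  have *: "inv ?x k = inv w (k+1)" "inv ?x (k+1) = inv w k"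
    using inv_simple_comp[OF w k] by (simp_all add: simple_apply)
  have ne: "inv w k \<noteq> inv w (k+1)" using W_inj[OF W_inv[OF w]] by simp
  have c2: "card (inversions n w) = Suc (card (inversions n ?x))" if "inv w (k+1) < inv w k"
  proof -
    have "inv ?x k < inv ?x (k+1)" using * that by simp
    from inversions_simple_comp[OF x k this] show ?thesis by simp
  qed
  then show "inv w (k + 1) < inv w k \<Longrightarrow> card (inversions n w) > 0" by simp
  show "card (inversions n (simple k \<circ> w)) =
    (if inv w k < inv w (k + 1) then card (inversions n w) + 1 else card (inversions n w) - 1)"
    using inversions_simple_comp[OF w k] c2 ne by auto
qed

lemma increasing_id:
  assumes w: "w \<in> W n" and inc: "\<And>i j. 1 \<le> i \<Longrightarrow> i < j \<Longrightarrow> j \<le> n \<Longrightarrow> w i < w j"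
  shows "w = id"
proof (rule W_eqI[OF w W_id])
  \<comment> \<open>An increasing self-map of the interval is squeezed: counting from the left gives
    \<open>a \<le> w a\<close>, counting from the right gives \<open>w a \<le> a\<close>.\<close>
  have lo: "a \<le> w a" if "1 \<le> a" "a \<le> n" for a
    using that
  proof (induction a rule: nat_induct_at_least)
    case base then show ?case using W_in'[OF w] by auto
  next
    case (Suc a) then show ?case using inc[of a "Suc a"] by simp
  qed
  have hi: "w (n - d) \<le> n - d" if "d < n" for d
    using that
  proof (induction d)
    case 0 then show ?case using W_in'[OF w, of n] by auto
  next
    case (Suc d)
    have "w (n - Suc d) < w (n - d)" using Suc.prems by (intro inc) auto
    then show ?case using Suc by linarith
  qed
  fix a assume "1 \<le> a" "a \<le> n"
  then show "w a = id a" using lo[of a] hi[of "n - a"] by simp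
qed

lemma step_increasing:
  fixes f :: "nat \<Rightarrow> nat"
  assumes "\<And>k. l \<le> k \<Longrightarrow> k < h \<Longrightarrow> f k < f (k + 1)" "l \<le> i" "i < j" "j \<le> h"
  shows "f i < f j"
  using assms(3,4)
proof (induction j)
  case (Suc j)
  have "f j < f (Suc j)" using assms(1)[of j] assms(2) Suc.prems by simp
  then show ?case using Suc by (cases "i = j") auto
qed simp

lemma step_decreasing:
  fixes f :: "nat \<Rightarrow> nat"
  assumes "\<And>k. l \<le> k \<Longrightarrow> k < h \<Longrightarrow> f (k + 1) < f k" "l \<le> i" "i < j" "j \<le> h"
  shows "f j < f i"
  using assms(3,4)
proof (induction j)
  case (Suc j)
  have "f (Suc j) < f j" using assms(1)[of j] assms(2) Suc.prems by simp
  then show ?case using Suc by (cases "i = j") auto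
qed simp

text \<open>A word in which every \<open>k\<close> stands before \<open>k + 1\<close> is sorted.
  This supplies the step in the inductions on length.\<close>

lemma exists_left_descent:
  assumes w: "w \<in> W n" and ne: "w \<noteq> id"
  obtains k where "1 \<le> k" "k < n" "inv w (k + 1) < inv w k"
proof -
  have iw: "inv w \<in> W n" using w by (rule W_inv)
  have "\<exists>k\<ge>1. k < n \<and> inv w (k + 1) < inv w k"
  proof (rule ccontr)
    assume "\<not> ?thesis"
    then have *: "inv w k < inv w (k+1)" if "1 \<le> k" "k < n" for k
      using that W_inj[OF iw, of k "k+1"] by (metis less_add_one linorder_less_linear nat_neq_iff)
    have "inv w = id"
      by (rule increasing_id[OF iw]) (use step_increasing[of 1 n "inv w"] * in auto)
    then have "w = id" using W_inv_inv[OF w] by simp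
    then show False using ne by simp
  qed
  then show ?thesis using that by blast
qed

lemma word_prod_simps [simp]: "word_prod [] = id" "word_prod (s # ss) = s \<circ> word_prod ss"
  by (simp_all add: word_prod_def)

lemma word_prod_append: "word_prod (ss @ ts) = word_prod ss \<circ> word_prod ts"
  by (induction ss) (simp_all add: comp_assoc)

lemma word_prod_W: "set ss \<subseteq> S n \<Longrightarrow> word_prod ss \<in> W n"
  by (induction ss) (auto simp: S_W W_comp)

lemma word_prod_rev: "set ss \<subseteq> S n \<Longrightarrow> word_prod (rev ss) = inv (word_prod ss)"
proof (induction ss)
  case (Cons s ss)
  then have "inv (s \<circ> word_prod ss) = inv (word_prod ss) \<circ> s"
    using W_inv_o[OF S_W word_prod_W, of s n ss] inv_S[of s n] by simp
  moreover have "word_prod (rev ss) = inv (word_prod ss)" using Cons by simp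
  ultimately show ?case by (simp only: word_prod_append rev.simps word_prod_simps comp_id)
qed (simp only: word_prod_simps rev.simps inv_id)

lemma inversions_id [simp]: "inversions n id = {}"
  by (auto simp: inversions_def)

lemma card_inversions_le_word:
  "set ss \<subseteq> S n \<Longrightarrow> card (inversions n (word_prod ss)) \<le> length ss"
proof (induction ss)
  case Nil
  have "card (inversions n id) = 0" by simp
  then show ?case by (simp only: word_prod_simps)
next
  case (Cons s ss)
  then obtain k where k: "s = simple k" "1 \<le> k" "k < n" by (auto simp: S_def)
  have "card (inversions n (simple k \<circ> word_prod ss)) \<le> card (inversions n (word_prod ss)) + 1"
    using card_inversions_simple_comp(1)[OF word_prod_W k(2,3), of ss] Cons.prems by auto
  moreover have "card (inversions n (word_prod ss)) \<le> length ss" using Cons by simp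
  ultimately show ?case using k(1) by (simp only: word_prod_simps list.size)
qed

lemma exists_word_card_inversions:
  "w \<in> W n \<Longrightarrow> \<exists>ss. set ss \<subseteq> S n \<and> word_prod ss = w \<and> length ss = card (inversions n w)"
proof (induction "card (inversions n w)" arbitrary: w rule: less_induct)
  case less
  show ?case
  proof (cases "w = id")
    case True then show ?thesis by (intro exI[of _ "[]"]) simp
  next
    case False
    then obtain k where k: "1 \<le> k" "k < n" "inv w (k + 1) < inv w k"
      using exists_left_descent less.prems by blast
    let ?x = "simple k \<circ> w"
    have x: "?x \<in> W n" using less.prems k by (simp add: W_comp simple_W)
    have c: "card (inversions n w) = card (inversions n ?x) + 1"
      using card_inversions_simple_comp[OF less.prems k(1,2)] k by simp
    obtain ss where ss: "set ss \<subseteq> S n" "word_prod ss = ?x" "length ss = card (inversions n ?x)"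
      using less.hyps[OF _ x] c by auto
    have "word_prod (simple k # ss) = simple k \<circ> (simple k \<circ> w)"
      by (simp only: word_prod_simps ss)
    also have "\<dots> = w" by (rule simple_comp_cancel)
    finally have "word_prod (simple k # ss) = w" .
    moreover have "set (simple k # ss) \<subseteq> S n" using ss(1) k by (simp add: simple_in_S)
    moreover have "length (simple k # ss) = card (inversions n w)" using ss(3) c by simp
    ultimately show ?thesis by blast
  qed
qed

theorem len_eq_card_inversions:
  assumes "w \<in> W n" shows "len n w = card (inversions n w)"
  unfolding len_def
proof (rule Least_equality)
  show "\<exists>ss. set ss \<subseteq> S n \<and> word_prod ss = w \<and> length ss = card (inversions n w)"
    using exists_word_card_inversions[OF assms] .
qed (use card_inversions_le_word in auto)

section \<open>Reduced words and descents\<close>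

definition reduced :: "nat \<Rightarrow> (nat \<Rightarrow> nat) list \<Rightarrow> bool" where
  "reduced n ss \<longleftrightarrow> set ss \<subseteq> S n \<and> length ss = len n (word_prod ss)"

lemma exists_reduced: "w \<in> W n \<Longrightarrow> \<exists>ss. reduced n ss \<and> word_prod ss = w"
  using exists_word_card_inversions[of w n] len_eq_card_inversions[of w n] by (auto simp: reduced_def)

lemma reduced_word_props:
  assumes "w \<in> W n"
  shows "reduced n (reduced_word n w)" "word_prod (reduced_word n w) = w"
proof -
  have "\<exists>ss. set ss \<subseteq> S n \<and> word_prod ss = w \<and> length ss = len n w"
    using exists_reduced[OF assms] by (auto simp: reduced_def)
  from someI_ex[OF this]
  show "reduced n (reduced_word n w)" "word_prod (reduced_word n w) = w"
    unfolding reduced_word_def reduced_def by auto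
qed

lemma len_word_le: "set ss \<subseteq> S n \<Longrightarrow> len n (word_prod ss) \<le> length ss"
  using card_inversions_le_word len_eq_card_inversions word_prod_W by metis

lemma len_id [simp]: "len n id = 0"
  using len_word_le[of "[]" n] by simp

lemma len_inv: assumes "w \<in> W n" shows "len n (inv w) = len n w"
proof -
  have "len n (inv x) \<le> len n x" if x: "x \<in> W n" for x
  proof -
    from exists_reduced[OF x] obtain ss where ss: "reduced n ss" "word_prod ss = x" by (elim exE conjE)
    then have s: "set ss \<subseteq> S n" "length ss = len n x" by (auto simp: reduced_def)
    then have "word_prod (rev ss) = inv x" using word_prod_rev[OF s(1)] ss(2) by simp
    moreover have "len n (word_prod (rev ss)) \<le> length (rev ss)" using s by (intro len_word_le) simp
    ultimately show ?thesis using s(2) by simp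
  qed
  from this[OF assms] this[OF W_inv[OF assms]] show ?thesis unfolding W_inv_inv[OF assms] by simp
qed

lemma reduced_Nil [simp]: "reduced n []"
  by (simp add: reduced_def)

lemma reduced_rev: "reduced n ss \<Longrightarrow> reduced n (rev ss)"
  unfolding reduced_def using word_prod_rev[of ss n] len_inv[OF word_prod_W, of ss n] by simp

lemma len_simple_comp:
  assumes w: "w \<in> W n" and k: "1 \<le> k" "k < n"
  shows "len n (simple k \<circ> w) =
    (if inv w k < inv w (k + 1) then len n w + 1 else len n w - 1)"
    and "inv w (k + 1) < inv w k \<Longrightarrow> len n w > 0"
  using card_inversions_simple_comp[OF assms] len_eq_card_inversions[OF w]
    len_eq_card_inversions[OF W_comp[OF simple_W[OF k] w]] by simp_all

lemma len_S_comp: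
  assumes "w \<in> W n" "s \<in> S n"
  shows "len n (s \<circ> w) = len n w + 1 \<or> len n w = len n (s \<circ> w) + 1"
proof -
  obtain k where k: "s = simple k" "1 \<le> k" "k < n" using assms(2) by (auto simp: S_def)
  show ?thesis using len_simple_comp[OF assms(1) k(2,3)] k(1)
    W_inj[OF W_inv[OF assms(1)], of k "k+1"] by (auto split: if_splits)
qed

lemma reduced_Cons:
  assumes "reduced n (s # ss)"
  shows "reduced n ss" "s \<in> S n" "len n (s \<circ> word_prod ss) = len n (word_prod ss) + 1"
proof -
  have *: "set ss \<subseteq> S n" "s \<in> S n" "Suc (length ss) = len n (s \<circ> word_prod ss)"
    using assms by (auto simp: reduced_def)
  have "len n (word_prod ss) \<le> length ss" using len_word_le * by blast
  then have "len n (word_prod ss) = length ss" 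
    using len_S_comp[OF word_prod_W[OF *(1)] *(2)] *(3) by auto
  then show "reduced n ss" "s \<in> S n" "len n (s \<circ> word_prod ss) = len n (word_prod ss) + 1"
    using * by (auto simp: reduced_def)
qed

lemma reduced_ConsI:
  "reduced n ss \<Longrightarrow> s \<in> S n \<Longrightarrow> len n (word_prod ss) < len n (s \<circ> word_prod ss) \<Longrightarrow> reduced n (s # ss)"
  using len_S_comp[of "word_prod ss" n s] word_prod_W[of ss n] by (auto simp: reduced_def)

section \<open>Reflections as transpositions of values\<close>

lemma simple_transpose_conj:
  assumes "1 \<le> k" "k < n" "c \<in> {1..n}" "d \<in> {1..n}"
  shows "simple k \<circ> (transpose c d \<circ> x) = transpose (simple k c) (simple k d) \<circ> (simple k \<circ> x)"
proof
  fix a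
  have b: "bij (simple k)" using assms by (intro W_bij[of _ n] simple_W)
  show "(simple k \<circ> (transpose c d \<circ> x)) a = (transpose (simple k c) (simple k d) \<circ> (simple k \<circ> x)) a"
    using b by (auto simp: transpose_def bij_def inj_eq)
qed

text \<open>Strip a left descent \<open>k\<close> of \<open>x\<close>. Either the transposition is
  \<open>simple k\<close> itself, or conjugation by \<open>simple k\<close> gives a transposition
  with the same inverted pair of positions in a shorter element; restoring \<open>simple k\<close>
  then costs at most one.\<close>

lemma len_transpose_less:
  assumes "x \<in> W n" "c \<in> {1..n}" "d \<in> {1..n}" "c < d" "inv x d < inv x c"
  shows "len n (transpose c d \<circ> x) < len n x"
  using assms
proof (induction "len n x" arbitrary: x c d rule: less_induct)
  case less
  show ?case
  proof (cases "x = id")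
    case True then show ?thesis using less.prems by simp
  next
    case False
    then obtain k where k: "1 \<le> k" "k < n" "inv x (k + 1) < inv x k"
      using exists_left_descent less.prems by blast
    let ?y = "simple k \<circ> x"
    have y: "?y \<in> W n" using less.prems k by (simp add: W_comp simple_W)
    have ly: "len n x = len n ?y + 1" using len_simple_comp[OF less.prems(1) k(1,2)] k by simp
    show ?thesis
    proof (cases "c = k \<and> d = k + 1")
      case True then show ?thesis using ly by (simp add: simple_def)
    next
      case f: False
      let ?c = "simple k c" and ?d = "simple k d"
      have cd: "?c < ?d" using f less.prems by (intro simple_less) auto
      have in1: "?c \<in> {1..n}" "?d \<in> {1..n}" using W_in[OF simple_W[OF k(1,2)]] less.prems by auto
      have "inv ?y ?d < inv ?y ?c"
        using inv_simple_comp[OF less.prems(1) k(1,2)] less.prems by simp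
      then have "len n (transpose ?c ?d \<circ> ?y) < len n ?y"
        using less.hyps[of ?y ?c ?d] ly y in1 cd by simp
      moreover have "transpose c d \<circ> x = simple k \<circ> (transpose ?c ?d \<circ> ?y)"
        using simple_transpose_conj[OF k(1,2) less.prems(2,3), of x] by (metis simple_comp_cancel(1))
      moreover have "transpose ?c ?d \<circ> ?y \<in> W n" using y in1 by (simp add: W_comp transpose_W)
      ultimately have "len n (transpose c d \<circ> x) \<le> len n (transpose ?c ?d \<circ> ?y) + 1"
        using len_S_comp[of "transpose ?c ?d \<circ> ?y" n "simple k"] k by (auto simp: simple_in_S)
      then show ?thesis using \<open>len n (transpose ?c ?d \<circ> ?y) < len n ?y\<close> ly by simp
    qed
  qed
qed

lemma inv_transpose_comp:
  assumes "x \<in> W n" "c \<in> {1..n}" "d \<in> {1..n}"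
  shows "inv (transpose c d \<circ> x) a = inv x (transpose c d a)"
  using W_inv_o[OF transpose_W[OF assms(2,3)] assms(1)] by simp

lemma len_transpose_less_iff:
  assumes "x \<in> W n" "c \<in> {1..n}" "d \<in> {1..n}" "c < d"
  shows "len n (transpose c d \<circ> x) < len n x \<longleftrightarrow> inv x d < inv x c"
proof
  assume l: "len n (transpose c d \<circ> x) < len n x"
  show "inv x d < inv x c"
  proof (rule ccontr)
    assume "\<not> inv x d < inv x c"
    then have "inv x c < inv x d" using W_inj[OF W_inv[OF assms(1)], of c d] assms(4) by auto
    then have "inv (transpose c d \<circ> x) d < inv (transpose c d \<circ> x) c"
      using inv_transpose_comp[OF assms(1-3)] by simp
    from len_transpose_less[OF _ assms(2-4) this] assms l
    show False by (simp add: W_comp transpose_W flip: comp_assoc)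
  qed
qed (use assms len_transpose_less in auto)

lemma len_transpose_comp_less_iff:
  assumes "x \<in> W n" "c \<in> {1..n}" "d \<in> {1..n}" "c \<noteq> d"
  shows "len n (transpose c d \<circ> x) < len n x \<longleftrightarrow> (c < d \<longleftrightarrow> inv x d < inv x c)"
proof (cases "c < d")
  case True then show ?thesis using len_transpose_less_iff[OF assms(1-3)] by simp
next
  case False
  then have "d < c" using assms by simp
  then show ?thesis using len_transpose_less_iff[OF assms(1,3,2)] W_inj[OF W_inv[OF assms(1)], of c d]
    by (auto simp: transpose_commute[of d c])
qed

text \<open>Exchanging two neighbouring positions means exchanging the values that stand there.
  Right descents are thereby reduced to transpositions of values.\<close>

lemma comp_simple: 
  assumes "x \<in> W n" "1 \<le> j" "j < n"
  shows "x \<circ> simple j = transpose (x j) (x (j + 1)) \<circ> x"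
  using W_inj[OF assms(1)] by (auto simp: fun_eq_iff simple_def transpose_def)

lemma len_simple_comp_less_iff:
  assumes "x \<in> W n" "1 \<le> k" "k < n"
  shows "len n (simple k \<circ> x) < len n x \<longleftrightarrow> inv x (k + 1) < inv x k"
  using len_transpose_less_iff[of x n k "k+1"] assms by (simp add: simple_def)

lemma len_comp_simple_less_iff:
  assumes "x \<in> W n" "1 \<le> j" "j < n"
  shows "len n (x \<circ> simple j) < len n x \<longleftrightarrow> x (j + 1) < x j"
proof -
  have ne: "x j \<noteq> x (j+1)" using W_inj[OF assms(1)] by simp
  have r: "x j \<in> {1..n}" "x (j+1) \<in> {1..n}"
    using W_in[OF assms(1), of j] W_in[OF assms(1), of "j+1"] assms by auto
  have "len n (transpose (x j) (x (j+1)) \<circ> x) < len n x \<longleftrightarrow> \<not> x j < x (j+1)"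
    using len_transpose_comp_less_iff[OF assms(1) r ne] unfolding W_inv_f[OF assms(1)] by simp
  then show ?thesis unfolding comp_simple[OF assms] using ne by linarith
qed

lemma len_comp_S:
  assumes "w \<in> W n" "s \<in> S n"
  shows "len n (w \<circ> s) = len n w + 1 \<or> len n w = len n (w \<circ> s) + 1"
proof -
  have "inv (w \<circ> s) = s \<circ> inv w" using assms by (simp add: W_inv_o[of _ n] S_W)
  then show ?thesis using len_S_comp[OF W_inv[OF assms(1)] assms(2)]
    by (metis assms S_W W_comp len_inv)
qed

lemma reflections_eq: "reflections n = {transpose c d | c d. c \<in> {1..n} \<and> d \<in> {1..n} \<and> c < d}"
proof (intro equalityI subsetI)
  fix t assume "t \<in> reflections n"
  then obtain x k where x: "x \<in> W n" "1 \<le> k" "k < n" "t = x \<circ> simple k \<circ> inv x"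
    by (auto simp: reflections_def S_def)
  then have "t = transpose (x k) (x (k+1))" using comp_simple[OF x(1-3)]
    by (simp add: comp_assoc)
  moreover have "x k \<in> {1..n}" "x (k+1) \<in> {1..n}" "x k \<noteq> x (k+1)"
    using x W_in[OF x(1)] W_inj[OF x(1)] by auto
  ultimately show "t \<in> {transpose c d | c d. c \<in> {1..n} \<and> d \<in> {1..n} \<and> c < d}"
    by (auto simp: not_less_iff_gr_or_eq) (metis linorder_neqE_nat transpose_commute)
next
  fix t assume "t \<in> {transpose c d | c d. c \<in> {1..n} \<and> d \<in> {1..n} \<and> c < d}"
  then obtain c d where cd: "t = transpose c d" "c \<in> {1..n}" "d \<in> {1..n}" "c < d" by blast
  \<comment> \<open>It fixes \<open>c\<close> and sends \<open>c + 1\<close> to \<open>d\<close>,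
    hence conjugates \<open>simple c\<close> into \<open>transpose c d\<close>; for
    \<open>d = c + 1\<close> it is the identity.\<close>
  let ?x = "transpose (c+1) d"
  have x: "?x \<in> W n" using cd by (intro transpose_W) auto
  have "?x \<circ> simple c \<circ> inv ?x = transpose (?x c) (?x (c+1)) \<circ> ?x \<circ> inv ?x"
    using comp_simple[OF x, of c] cd by auto
  also have "\<dots> = transpose c d" using x cd by (simp add: comp_assoc)
  finally have "t = ?x \<circ> simple c \<circ> inv ?x" using cd by simp
  moreover have "simple c \<in> S n" using cd by (simp add: simple_in_S)
  ultimately show "t \<in> reflections n" unfolding reflections_def using x by blast
qed

section \<open>Weak order and longest elements\<close>

text \<open>The values \<open>y i\<close> and \<open>y j\<close> are inverted by
  \<open>x \<circ> inv y\<close> exactly when \<open>x\<close> and \<open>y\<close> order the pair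
  \<open>i < j\<close> differently. So the length measures the symmetric difference of the two
  inversion sets, and the left weak order becomes inclusion.\<close>

lemma card_inversions_comp_inv:
  assumes x: "x \<in> W n" and y: "y \<in> W n"
  shows "card (inversions n (x \<circ> inv y)) =
    card (inversions n x - inversions n y) + card (inversions n y - inversions n x)"
proof -
  let ?D = "(inversions n x - inversions n y) \<union> (inversions n y - inversions n x)"
  let ?f = "\<lambda>(i, j). (min (y i) (y j), max (y i) (y j))"
  have fin: "finite ?D" by simp
  have "bij_betw ?f ?D (inversions n (x \<circ> inv y))"
  proof (rule bij_betw_imageI)
    show "inj_on ?f ?D"
      by (rule inj_onI)
        (auto simp: inversions_def min_def max_def W_inj[OF y] split: if_splits)
    show "?f ` ?D = inversions n (x \<circ> inv y)"
    proof (intro equalityI subsetI)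
      fix p assume "p \<in> ?f ` ?D"
      then obtain i j where ij: "(i, j) \<in> ?D" "p = (min (y i) (y j), max (y i) (y j))" by auto
      then have r: "1 \<le> i" "i < j" "j \<le> n" by (auto simp: inversions_def)
      have b: "1 \<le> y i" "y i \<le> n" "1 \<le> y j" "y j \<le> n" using W_in'[OF y] r by auto
      have ne: "x i \<noteq> x j" "y i \<noteq> y j" using r W_inj[OF x] W_inj[OF y] by auto
      show "p \<in> inversions n (x \<circ> inv y)"
      proof (cases "y i < y j")
        case True
        then have "x j < x i" using ij(1) by (auto simp: inversions_def)
        then show ?thesis using True ij(2) b by (auto simp: inversions_def min_def max_def W_inv_f[OF y])
      next
        case False
        then have l: "y j < y i" using ne by simp
        then have "x i < x j" using ij(1) ne r by (auto simp: inversions_def)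
        then show ?thesis using l ij(2) b by (auto simp: inversions_def min_def max_def W_inv_f[OF y])
      qed
    next
      fix p assume "p \<in> inversions n (x \<circ> inv y)"
      then obtain a b where ab: "p = (a, b)" "1 \<le> a" "a < b" "b \<le> n" "x (inv y b) < x (inv y a)"
        by (auto simp: inversions_def)
      let ?i = "min (inv y a) (inv y b)" and ?j = "max (inv y a) (inv y b)"
      have ne: "inv y a \<noteq> inv y b" using ab W_inj[OF W_inv[OF y]] by auto
      have r: "1 \<le> ?i" "?i < ?j" "?j \<le> n" using ne W_in'[OF W_inv[OF y]] ab by auto
      have m: "(?i, ?j) \<in> ?D" using r ab
        by (auto simp: inversions_def min_def max_def W_f_inv[OF y] split: if_splits)
      have e: "?f (?i, ?j) = p" using ab by (auto simp: min_def max_def W_f_inv[OF y])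
      show "p \<in> ?f ` ?D" using image_eqI[of p ?f "(?i, ?j)" ?D, OF e[symmetric] m] .
    qed
  qed
  then have "card (inversions n (x \<circ> inv y)) = card ?D" by (simp add: bij_betw_same_card)
  also have "\<dots> = card (inversions n x - inversions n y) + card (inversions n y - inversions n x)"
    by (rule card_Un_disjoint) auto
  finally show ?thesis .
qed

theorem left_weak_le_iff:
  assumes x: "x \<in> W n" and y: "y \<in> W n"
  shows "left_weak_le n y x \<longleftrightarrow> inversions n y \<subseteq> inversions n x"
proof -
  let ?X = "inversions n x" and ?Y = "inversions n y"
  have "card ?X = card (?X - ?Y) + card (?X \<inter> ?Y)"
    by (metis card_Diff_subset_Int card_mono finite_Int finite_inversions inf_le1 le_add_diff_inverse2)
  moreover have "card ?Y = card (?Y - ?X) + card (?X \<inter> ?Y)"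
    by (metis Int_commute card_Diff_subset_Int card_mono finite_Int finite_inversions inf_le1 le_add_diff_inverse2)
  ultimately have "left_weak_le n y x \<longleftrightarrow> card (?Y - ?X) = 0"
    unfolding left_weak_le_def
    using card_inversions_comp_inv[OF x y] len_eq_card_inversions x y W_comp[OF x W_inv[OF y]] by auto
  then show ?thesis by auto
qed

lemma inversions_inject:
  assumes x: "x \<in> W n" and y: "y \<in> W n" and eq: "inversions n x = inversions n y"
  shows "x = y"
proof -
  have "inversions n (x \<circ> inv y) = {}"
    using card_inversions_comp_inv[OF x y] eq by simp
  then have "\<And>i j. 1 \<le> i \<Longrightarrow> i < j \<Longrightarrow> j \<le> n \<Longrightarrow> (x \<circ> inv y) i < (x \<circ> inv y) j"
    using W_inj[OF W_comp[OF x W_inv[OF y]]] unfolding inversions_def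
    by (metis (mono_tags, lifting) case_prodI empty_iff mem_Collect_eq nat_neq_iff)
  then have "x \<circ> inv y = id" using increasing_id[OF W_comp[OF x W_inv[OF y]]] by blast
  then have "x \<circ> (inv y \<circ> y) = y" by (metis comp_assoc id_o)
  then show ?thesis using y by simp
qed

section \<open>Parabolic subgroups as stabilisers of blocks\<close>

definition same_block :: "(nat \<Rightarrow> nat) set \<Rightarrow> nat \<Rightarrow> nat \<Rightarrow> bool" where
  "same_block J a b \<longleftrightarrow> (\<forall>k. min a b \<le> k \<and> k < max a b \<longrightarrow> simple k \<in> J)"

lemma same_block_refl [simp]: "same_block J a a"
  by (auto simp: same_block_def)

lemma same_block_sym: "same_block J a b \<longleftrightarrow> same_block J b a"
  by (simp add: same_block_def min.commute max.commute)

lemma same_block_trans: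
  assumes "same_block J a b" "same_block J b c" shows "same_block J a c"
  unfolding same_block_def
proof (intro allI impI)
  fix k assume "min a c \<le> k \<and> k < max a c"
  then have "min a b \<le> k \<and> k < max a b \<or> min b c \<le> k \<and> k < max b c" by auto
  then show "simple k \<in> J" using assms by (auto simp: same_block_def)
qed

lemma parabolic_W: "J \<subseteq> S n \<Longrightarrow> v \<in> parabolic J \<Longrightarrow> v \<in> W n"
  unfolding parabolic_def using word_prod_W by blast

lemma parabolic_same_block:
  assumes "v \<in> parabolic J" "J \<subseteq> S n" shows "same_block J (v a) a"
proof -
  have "same_block J (word_prod ss a) a" if "set ss \<subseteq> J" for ss
    using that
  proof (induction ss)
    case (Cons s ss)
    then obtain k where k: "s = simple k" using assms by (auto simp: S_def)
    have "same_block J (simple k b) b" for b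
      using Cons.prems k by (auto simp: simple_apply same_block_def le_less_Suc_eq)
    then show ?case using Cons k same_block_trans by (metis comp_apply insert_subset list.simps(15) word_prod_simps(2))
  qed simp
  then show ?thesis using assms by (auto simp: parabolic_def)
qed

lemma parabolic_comp: "u \<in> parabolic J \<Longrightarrow> v \<in> parabolic J \<Longrightarrow> u \<circ> v \<in> parabolic J"
  unfolding parabolic_def by (auto simp flip: word_prod_append) (metis le_sup_iff set_append)

lemma parabolic_inv: assumes "u \<in> parabolic J" "J \<subseteq> S n" shows "inv u \<in> parabolic J"
  using assms word_prod_rev[of _ n] unfolding parabolic_def by (auto) (metis set_rev subset_trans)

lemma parabolic_block_order:
  assumes v: "v \<in> parabolic J" "J \<subseteq> S n" and ab: "a < b" "\<not> same_block J a b"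
  shows "v a < v b"
proof (rule ccontr)
  assume "\<not> v a < v b"
  then have le: "v b \<le> v a" by simp
  have sa: "same_block J (v a) a" and sb: "same_block J (v b) b"
    using parabolic_same_block[OF v] by auto
  have "same_block J a b" unfolding same_block_def
  proof (intro allI impI)
    fix k assume k: "min a b \<le> k \<and> k < max a b"
    then have "k < b" "a \<le> k" using ab by auto
    then show "simple k \<in> J" using sa sb le unfolding same_block_def by (cases "k < v a") auto
  qed
  then show False using ab by simp
qed

definition block_inversions :: "nat \<Rightarrow> (nat \<Rightarrow> nat) set \<Rightarrow> (nat \<times> nat) set" where
  "block_inversions n J = {(i, j). 1 \<le> i \<and> i < j \<and> j \<le> n \<and> same_block J i j}"

lemma parabolic_inversions:
  assumes "v \<in> parabolic J" "J \<subseteq> S n" shows "inversions n v \<subseteq> block_inversions n J"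
  using parabolic_block_order[OF assms] unfolding inversions_def block_inversions_def
  by (auto simp: not_less[symmetric]) (meson less_asym)

text \<open>In an element of maximal length every \<open>simple k\<close> of \<open>J\<close> is a
  right descent, since otherwise multiplying by it would give a longer one. Hence the element
  decreases on each block and its inversion set is the largest possible in
  \<open>parabolic J\<close>. As inversion sets determine permutations, this also gives the
  uniqueness required by \<open>THE\<close>.\<close>

lemma longest_props:
  assumes J: "J \<subseteq> S n"
  shows "longest n J \<in> parabolic J" "inversions n (longest n J) = block_inversions n J"
proof -
  let ?P = "\<lambda>w. w \<in> parabolic J \<and> (\<forall>v\<in>parabolic J. len n v \<le> len n w)"
  have fin: "finite (parabolic J)" by (rule finite_subset[of _ "W n"]) (use parabolic_W J in auto)
  have ne: "parabolic J \<noteq> {}" unfolding parabolic_def by (auto intro!: exI[of _ "[]"])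
  have step: "inversions n w = block_inversions n J" if P: "?P w" for w
  proof -
    have w: "w \<in> W n" using P parabolic_W[OF J] by blast
    have "w (k+1) < w k" if k: "simple k \<in> J" for k
    proof (rule ccontr)
      have kk: "1 \<le> k" "k < n" using k J by (auto simp: simple_in_S subset_iff)
      assume "\<not> w (k+1) < w k"
      then have "\<not> len n (w \<circ> simple k) < len n w" using len_comp_simple_less_iff[OF w kk] by simp
      then have "len n w < len n (w \<circ> simple k)" using len_comp_S[OF w, of "simple k"] kk
        by (auto simp: simple_in_S)
      moreover have "simple k \<in> parabolic J" unfolding parabolic_def
        using k by (intro CollectI exI[of _ "[simple k]"]) auto
      ultimately show False using P parabolic_comp by (meson not_less)
    qed
    then have "w j < w i" if "same_block J i j" "i < j" for i j
      by (rule step_decreasing[of i j]) (use that in \<open>auto simp: same_block_def\<close>)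
    then have "block_inversions n J \<subseteq> inversions n w"
      by (auto simp: block_inversions_def inversions_def)
    then show ?thesis using parabolic_inversions[OF _ J] P by blast
  qed
  have "\<exists>!w. ?P w"
  proof (rule ex_ex1I)
    have fi: "finite (len n ` parabolic J)" "len n ` parabolic J \<noteq> {}" using fin ne by auto
    from Max_in[OF this] obtain w where w: "w \<in> parabolic J" "len n w = Max (len n ` parabolic J)"
      by auto
    then show "\<exists>w. ?P w" using fi by auto
    show "w = w'" if "?P w" "?P w'" for w w'
      using step that inversions_inject[of w n w'] parabolic_W[OF J] by auto
  qed
  from theI'[OF this, folded longest_def] step
  show "longest n J \<in> parabolic J" "inversions n (longest n J) = block_inversions n J" by auto
qed

lemma longest_W: "J \<subseteq> S n \<Longrightarrow> longest n J \<in> W n"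
  by (rule parabolic_W[OF _ longest_props(1)])

lemma inv_longest: assumes J: "J \<subseteq> S n" shows "inv (longest n J) = longest n J"
proof -
  let ?v = "longest n J"
  have v: "?v \<in> parabolic J" using longest_props[OF J] by simp
  have "inversions n (inv ?v) = block_inversions n J"
  proof (rule card_seteq)
    show "finite (block_inversions n J)" using longest_props(2)[OF J] finite_inversions by metis
    show "inversions n (inv ?v) \<subseteq> block_inversions n J"
      using parabolic_inversions[OF parabolic_inv[OF v J] J] .
    have "len n (inv ?v) = len n ?v" using len_inv[OF longest_W[OF J]] .
    then show "card (block_inversions n J) \<le> card (inversions n (inv ?v))"
      using len_eq_card_inversions longest_W[OF J] W_inv[OF longest_W[OF J]] longest_props(2)[OF J] by simp
  qed
  then show ?thesis
    using inversions_inject[OF W_inv[OF longest_W[OF J]] longest_W[OF J]] longest_props(2)[OF J] by simp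
qed

lemma longest_longest [simp]: "J \<subseteq> S n \<Longrightarrow> longest n J (longest n J a) = a"
  using W_inv_f[OF longest_W, of J n a] inv_longest[of J n] by simp

lemma longest_comp_longest: "J \<subseteq> S n \<Longrightarrow> longest n J \<circ> longest n J = id"
  by (simp add: fun_eq_iff)

lemma longest_less_iff:
  assumes J: "J \<subseteq> S n" and ab: "1 \<le> a" "a < b" "b \<le> n"
  shows "longest n J b < longest n J a \<longleftrightarrow> same_block J a b"
proof -
  have "(a, b) \<in> inversions n (longest n J) \<longleftrightarrow> (a, b) \<in> block_inversions n J"
    using longest_props(2)[OF J] by simp
  then show ?thesis using ab by (simp add: inversions_def block_inversions_def)
qed

section \<open>The Hecke algebra\<close>

abbreviation v_diff :: laurent where "v_diff \<equiv> q - q_inv"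

definition linear_op :: "(hecke \<Rightarrow> hecke) \<Rightarrow> bool" where
  "linear_op F \<longleftrightarrow> (\<forall>a h k. F (\<lambda>v. a * h v + k v) = (\<lambda>v. a * F h v + F k v))"

lemma linear_opD: "linear_op F \<Longrightarrow> F (\<lambda>v. a * h v + k v) = (\<lambda>v. a * F h v + F k v)"
  unfolding linear_op_def by blast

lemma linear_op_zero: assumes "linear_op F" shows "F (\<lambda>v. 0) = (\<lambda>v. 0)"
proof
  fix v
  have "F (\<lambda>v. 0) v = F (\<lambda>v. 0) v + F (\<lambda>v. 0) v"
    using fun_cong[OF linear_opD[OF assms, of 1 "\<lambda>v. 0" "\<lambda>v. 0"], of v] by simp
  then show "F (\<lambda>v. 0) v = 0" by simp
qed

lemma linear_op_sum:
  assumes "linear_op F" "finite A"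
  shows "F (\<lambda>v. \<Sum>y\<in>A. a y * h y v) = (\<lambda>v. \<Sum>y\<in>A. a y * F (h y) v)"
  using assms(2)
proof (induction A rule: finite_induct)
  case empty then show ?case using linear_op_zero[OF assms(1)] by simp
next
  case (insert y A)
  then show ?case using linear_opD[OF assms(1), of "a y" "h y" "\<lambda>v. \<Sum>y\<in>A. a y * h y v"] by simp
qed

lemma linear_op_diff:
  "linear_op F \<Longrightarrow> F (\<lambda>v. h v - a * k v) = (\<lambda>v. F h v - a * F k v)"
  using linear_opD[of F "- a" k h] by (simp add: algebra_simps)

definition right_mult :: "nat \<Rightarrow> (nat \<Rightarrow> nat) \<Rightarrow> hecke \<Rightarrow> hecke" where
  "right_mult n s h = (\<lambda>w. if w \<in> W n
     then h (w \<circ> s) + (if len n (w \<circ> s) < len n w then v_diff * h w else 0) else 0)"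

text \<open>By \<open>T_s^2 = 1 + (q - q^-1) T_s\<close> the inverse of \<open>T_s\<close> is
  \<open>T_s - (q - q^-1)\<close>.\<close>

definition left_mult_inv :: "nat \<Rightarrow> (nat \<Rightarrow> nat) \<Rightarrow> hecke \<Rightarrow> hecke" where
  "left_mult_inv n s h = (\<lambda>v. hecke_gen_mult n s h v - v_diff * h v)"

lemma linear_op_left_mult: "linear_op (hecke_gen_mult n s)"
  unfolding linear_op_def by (simp add: hecke_gen_mult_def fun_eq_iff algebra_simps)

lemma linear_op_right_mult: "linear_op (right_mult n s)"
  unfolding linear_op_def by (simp add: right_mult_def fun_eq_iff algebra_simps)

lemma linear_op_left_mult_inv: "linear_op (left_mult_inv n s)"
  unfolding linear_op_def left_mult_inv_def linear_opD[OF linear_op_left_mult]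
  by (simp add: fun_eq_iff algebra_simps)

lemma carrier_outside: "h \<in> hecke_carrier n \<Longrightarrow> v \<notin> W n \<Longrightarrow> h v = 0"
  by (simp add: hecke_carrier_def)

lemma left_mult_carrier [simp]: "hecke_gen_mult n s h \<in> hecke_carrier n"
  by (simp add: hecke_carrier_def hecke_gen_mult_def)

lemma right_mult_carrier [simp]: "right_mult n s h \<in> hecke_carrier n"
  by (simp add: hecke_carrier_def right_mult_def)

lemma left_mult_inv_carrier [simp]: "h \<in> hecke_carrier n \<Longrightarrow> left_mult_inv n s h \<in> hecke_carrier n"
  by (simp add: hecke_carrier_def left_mult_inv_def hecke_gen_mult_def)

lemma T_carrier [simp]: "w \<in> W n \<Longrightarrow> T w \<in> hecke_carrier n"
  by (auto simp: hecke_carrier_def T_def)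

lemma sum_carrier:
  "(\<And>y. y \<in> A \<Longrightarrow> h y \<in> hecke_carrier n) \<Longrightarrow> (\<lambda>v. \<Sum>y\<in>A. a y * h y v) \<in> hecke_carrier n"
  by (simp add: hecke_carrier_def)

lemma S_comp_W: "s \<in> S n \<Longrightarrow> s \<circ> w \<in> W n \<longleftrightarrow> w \<in> W n"
  using W_comp[OF S_W, of s n w] W_comp[OF S_W, of s n "s \<circ> w"] by auto

lemma W_comp_S: "s \<in> S n \<Longrightarrow> w \<circ> s \<in> W n \<longleftrightarrow> w \<in> W n"
  using W_comp[OF _ S_W, of w n s] W_comp[OF _ S_W, of "w \<circ> s" n s] by auto

lemma S_comp_eq_iff:
  fixes v w :: "nat \<Rightarrow> nat"
  assumes "s \<in> S n" shows "s \<circ> v = w \<longleftrightarrow> v = s \<circ> w"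
proof
  assume "s \<circ> v = w" then show "v = s \<circ> w" using S_cancel(1)[OF assms, of v] by (simp only:)
next
  assume "v = s \<circ> w" then show "s \<circ> v = w" using S_cancel(1)[OF assms, of w] by (simp only:)
qed

lemma comp_S_eq_iff:
  fixes v w :: "nat \<Rightarrow> nat"
  assumes "s \<in> S n" shows "v \<circ> s = w \<longleftrightarrow> v = w \<circ> s"
proof
  assume "v \<circ> s = w" then show "v = w \<circ> s" using S_cancel(2)[OF assms, of v] by (simp only:)
next
  assume "v = w \<circ> s" then show "v \<circ> s = w" using S_cancel(2)[OF assms, of w] by (simp only:)
qed

lemma left_mult_T:
  assumes "s \<in> S n" "w \<in> W n"
  shows "hecke_gen_mult n s (T w) =
    (\<lambda>v. T (s \<circ> w) v + (if len n (s \<circ> w) < len n w then v_diff * T w v else 0))"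
proof
  fix v
  have "v \<in> W n" if "v = s \<circ> w" using that S_comp_W[OF assms(1)] assms(2) by simp
  then show "hecke_gen_mult n s (T w) v =
    T (s \<circ> w) v + (if len n (s \<circ> w) < len n w then v_diff * T w v else 0)"
    using assms(2) S_comp_eq_iff[OF assms(1), of v w] unfolding hecke_gen_mult_def T_def by auto
qed

lemma right_mult_T:
  assumes "s \<in> S n" "w \<in> W n"
  shows "right_mult n s (T w) =
    (\<lambda>v. T (w \<circ> s) v + (if len n (w \<circ> s) < len n w then v_diff * T w v else 0))"
proof
  fix v
  have "v \<in> W n" if "v = w \<circ> s" using that W_comp_S[OF assms(1)] assms(2) by simp
  then show "right_mult n s (T w) v =
    T (w \<circ> s) v + (if len n (w \<circ> s) < len n w then v_diff * T w v else 0)"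
    using assms(2) comp_S_eq_iff[OF assms(1), of v w] unfolding right_mult_def T_def by auto
qed

lemma simple_less_iff:
  "c \<noteq> d \<Longrightarrow> \<not> ({c, d} = {k, k + 1}) \<Longrightarrow> simple k c < simple k d \<longleftrightarrow> c < d"
  using simple_less[of c d k] simple_less[of d c k] by (metis insert_commute linorder_less_linear not_less_iff_gr_or_eq)

text \<open>Passing from \<open>w\<close> to \<open>s \<circ> w\<close> exchanges the values
  \<open>k\<close> and \<open>k + 1\<close>. The comparison of the entries at \<open>j\<close> and
  \<open>j + 1\<close> is affected only if these are the two values, that is, only if
  \<open>s \<circ> w = w \<circ> t\<close>.\<close>

lemma descents_change:
  assumes w: "w \<in> W n" and s: "s \<in> S n" and t: "t \<in> S n" and ne: "s \<circ> w \<noteq> w \<circ> t"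
  shows "len n (s \<circ> w \<circ> t) < len n (s \<circ> w) \<longleftrightarrow> len n (w \<circ> t) < len n w"
    and "len n (s \<circ> (w \<circ> t)) < len n (w \<circ> t) \<longleftrightarrow> len n (s \<circ> w) < len n w"
proof -
  obtain k where k: "s = simple k" "1 \<le> k" "k < n" using s by (auto simp: S_def)
  obtain j where j: "t = simple j" "1 \<le> j" "j < n" using t by (auto simp: S_def)
  have sw: "s \<circ> w \<in> W n" and wt: "w \<circ> t \<in> W n" using w s t S_comp_W W_comp_S by auto
  have iw: "inv w \<in> W n" using w by (rule W_inv)
  have nn: "\<not> {w j, w (j + 1)} = {k, k + 1}"
  proof
    assume "{w j, w (j + 1)} = {k, k + 1}"
    then have "transpose (w j) (w (j + 1)) = simple k"
      unfolding simple_def by (auto simp: doubleton_eq_iff transpose_commute)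
    then have "w \<circ> t = s \<circ> w" using comp_simple[OF w j(2,3)] j(1) k(1) by simp
    then show False using ne by simp
  qed
  have nn2: "\<not> {inv w k, inv w (k + 1)} = {j, j + 1}"
  proof
    assume "{inv w k, inv w (k + 1)} = {j, j + 1}"
    then have "w ` {inv w k, inv w (k + 1)} = {w j, w (j + 1)}" by simp
    then have "{k, k + 1} = {w j, w (j + 1)}" by (simp add: W_f_inv[OF w])
    then show False using nn by simp
  qed
  show "len n (s \<circ> w \<circ> t) < len n (s \<circ> w) \<longleftrightarrow> len n (w \<circ> t) < len n w"
    using len_comp_simple_less_iff[OF sw j(2,3)] len_comp_simple_less_iff[OF w j(2,3)] j k
      simple_less_iff[of "w (j+1)" "w j" k] nn W_inj[OF w, of "j+1" j] by (simp add: insert_commute)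
  have "inv (w \<circ> t) = simple j \<circ> inv w" using W_inv_o[OF w S_W[OF t]] j by simp
  then show "len n (s \<circ> (w \<circ> t)) < len n (w \<circ> t) \<longleftrightarrow> len n (s \<circ> w) < len n w"
    using len_simple_comp_less_iff[OF wt k(2,3)] len_simple_comp_less_iff[OF w k(2,3)] j k
      simple_less_iff[of "inv w (k+1)" "inv w k" j] nn2 W_inj[OF iw, of "k+1" k] by (simp add: insert_commute)
qed

text \<open>The left and the right descent test interact only if
  \<open>s \<circ> w = w \<circ> t\<close>, and then they are the same test. In all other cases each
  test is unaffected by the other multiplication, by \<open>descents_change\<close>.\<close>

lemma left_right_mult_commute:
  assumes s: "s \<in> S n" and t: "t \<in> S n"
  shows "hecke_gen_mult n s (right_mult n t h) = right_mult n t (hecke_gen_mult n s h)"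
proof
  fix w
  show "hecke_gen_mult n s (right_mult n t h) w = right_mult n t (hecke_gen_mult n s h) w"
  proof (cases "w \<in> W n")
    case True
    have sw: "s \<circ> w \<in> W n" and wt: "w \<circ> t \<in> W n" using True s t S_comp_W W_comp_S by auto
    show ?thesis
    proof (cases "s \<circ> w = w \<circ> t")
      case eq: True
      have "s \<circ> w \<circ> t = w" unfolding eq using t by simp
      moreover have "s \<circ> (w \<circ> t) = w" unfolding eq[symmetric] using s by simp
      ultimately show ?thesis
        using True sw wt eq len_S_comp[OF True s]
        unfolding hecke_gen_mult_def right_mult_def by (auto simp: algebra_simps)
    next
      case False
      have e: "s \<circ> (w \<circ> t) = s \<circ> w \<circ> t" by (simp add: comp_assoc)
      show ?thesis using True sw wt descents_change[OF True s t False]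
        unfolding hecke_gen_mult_def right_mult_def e by (simp add: algebra_simps)
    qed
  qed (simp add: hecke_gen_mult_def right_mult_def)
qed

section \<open>Operators commuting with right multiplication\<close>

lemma carrier_expand:
  assumes "h \<in> hecke_carrier n" shows "h = (\<lambda>v. \<Sum>y\<in>W n. h y * T y v)"
proof
  fix v
  have "(\<Sum>y\<in>W n. h y * T y v) = (\<Sum>y\<in>W n. if v = y then h y else 0)"
    by (intro sum.cong) (auto simp: T_def)
  also have "\<dots> = h v" using assms by (auto simp: hecke_carrier_def)
  finally show "h v = (\<Sum>y\<in>W n. h y * T y v)" ..
qed

text \<open>Endomorphisms of the algebra as a right module over itself. They stand in for algebra
  elements acting from the left: an identity between two of them is checked at \<open>T id\<close>
  alone.\<close>

definition left_op :: "nat \<Rightarrow> (hecke \<Rightarrow> hecke) \<Rightarrow> bool" where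
  "left_op n F \<longleftrightarrow> linear_op F \<and> (\<forall>h\<in>hecke_carrier n. F h \<in> hecke_carrier n) \<and>
     (\<forall>s\<in>S n. \<forall>h\<in>hecke_carrier n. F (right_mult n s h) = right_mult n s (F h))"

lemma left_opD:
  assumes "left_op n F"
  shows "linear_op F" "h \<in> hecke_carrier n \<Longrightarrow> F h \<in> hecke_carrier n"
    "s \<in> S n \<Longrightarrow> h \<in> hecke_carrier n \<Longrightarrow> F (right_mult n s h) = right_mult n s (F h)"
  using assms unfolding left_op_def by auto

lemma T_inv_word:
  assumes "reduced n (s # ss)"
  shows "T (inv (word_prod (s # ss))) = right_mult n s (T (inv (word_prod ss)))"
proof -
  note r = reduced_Cons[OF assms]
  have p: "word_prod ss \<in> W n" using r(1) word_prod_W by (auto simp: reduced_def)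
  have e: "inv (s \<circ> word_prod ss) = inv (word_prod ss) \<circ> s"
    using W_inv_o[OF S_W[OF r(2)] p] inv_S[OF r(2)] by simp
  have "len n (inv (word_prod ss) \<circ> s) = len n (inv (word_prod ss)) + 1"
    using r(3) len_inv[OF p] len_inv[OF W_comp[OF S_W[OF r(2)] p]] unfolding e by simp
  then show ?thesis using right_mult_T[OF r(2) W_inv[OF p]]
    by (simp only: word_prod_simps e) simp
qed

text \<open>Since right multiplications generate \<open>T\<^sub>w\<close> from \<open>T\<^sub>1\<close>, an operator commuting with them is the left
  multiplication by its value at \<open>T\<^sub>1\<close>.\<close>

lemma left_op_eqI:
  assumes F: "left_op n F" and G: "left_op n G" and eq: "F (T id) = G (T id)"
    and h: "h \<in> hecke_carrier n"
  shows "F h = G h"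
proof -
  have word: "F (T (inv (word_prod ss))) = G (T (inv (word_prod ss)))" if "reduced n ss" for ss
    using that
  proof (induction ss)
    case Nil then show ?case using eq by (simp only: word_prod_simps inv_id)
  next
    case (Cons s ss)
    note r = reduced_Cons[OF Cons.prems]
    have p: "T (inv (word_prod ss)) \<in> hecke_carrier n"
      using r(1) by (intro T_carrier W_inv word_prod_W) (simp add: reduced_def)
    show ?case using left_opD(3)[OF F r(2) p] left_opD(3)[OF G r(2) p] Cons.IH[OF r(1)]
      unfolding T_inv_word[OF Cons.prems] by simp
  qed
  have T: "F (T y) = G (T y)" if y: "y \<in> W n" for y
  proof -
    from exists_reduced[OF W_inv[OF y]] obtain ss where "reduced n ss" "word_prod ss = inv y"
      by (elim exE conjE)
    then show ?thesis using word[of ss] W_inv_inv[OF y] by simp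
  qed
  have "F h = (\<lambda>v. \<Sum>y\<in>W n. h y * F (T y) v)"
    by (subst carrier_expand[OF h]) (rule linear_op_sum[OF left_opD(1)[OF F] finite_W])
  also have "\<dots> = (\<lambda>v. \<Sum>y\<in>W n. h y * G (T y) v)" using T by (simp cong: sum.cong)
  also have "\<dots> = G h"
    by (subst (2) carrier_expand[OF h]) (rule linear_op_sum[OF left_opD(1)[OF G] finite_W, symmetric])
  finally show ?thesis .
qed

lemma left_op_id: "left_op n (\<lambda>h. h)"
  by (simp add: left_op_def linear_op_def)

lemma left_op_comp: "left_op n F \<Longrightarrow> left_op n G \<Longrightarrow> left_op n (\<lambda>h. F (G h))"
  by (simp add: left_op_def linear_op_def)

lemma left_op_left_mult: "s \<in> S n \<Longrightarrow> left_op n (hecke_gen_mult n s)"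
  by (simp add: left_op_def linear_op_left_mult left_right_mult_commute)

lemma left_op_left_mult_inv: "s \<in> S n \<Longrightarrow> left_op n (left_mult_inv n s)"
  by (simp add: left_op_def linear_op_left_mult_inv)
    (simp add: left_mult_inv_def left_right_mult_commute linear_op_diff[OF linear_op_right_mult])

lemma left_op_foldr: "(\<And>s. s \<in> set ss \<Longrightarrow> left_op n (f s)) \<Longrightarrow> left_op n (foldr f ss)"
proof (induction ss)
  case Nil then show ?case using left_op_id by (simp add: id_def)
next
  case (Cons s ss)
  then show ?case using left_op_comp[of n "f s" "foldr f ss"] by (simp add: comp_def)
qed

lemma left_op_sum:
  assumes "finite A" "\<And>y. y \<in> A \<Longrightarrow> left_op n (F y)"
  shows "left_op n (\<lambda>k v. \<Sum>y\<in>A. a y * F y k v)"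
  unfolding left_op_def
proof (intro conjI ballI)
  have "F y (\<lambda>v. b * h v + k v) v = b * F y h v + F y k v" if "y \<in> A" for y b h k v
    using fun_cong[OF linear_opD[OF left_opD(1)[OF assms(2)[OF that]]]] .
  then show "linear_op (\<lambda>k v. \<Sum>y\<in>A. a y * F y k v)" unfolding linear_op_def
    by (simp add: sum_distrib_left sum.distrib algebra_simps cong: sum.cong)
  show "(\<lambda>v. \<Sum>y\<in>A. a y * F y h v) \<in> hecke_carrier n" if "h \<in> hecke_carrier n" for h
    using left_opD(2)[OF assms(2)] that by (intro sum_carrier) auto
  show "(\<lambda>v. \<Sum>y\<in>A. a y * F y (right_mult n s h) v) = right_mult n s (\<lambda>v. \<Sum>y\<in>A. a y * F y h v)"
    if "s \<in> S n" "h \<in> hecke_carrier n" for s h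
    using left_opD(3)[OF assms(2)] that linear_op_sum[OF linear_op_right_mult assms(1)]
    by (simp cong: sum.cong)
qed

lemma word_left_op:
  "set ss \<subseteq> S n \<Longrightarrow> left_op n (foldr (hecke_gen_mult n) ss)"
  "set ss \<subseteq> S n \<Longrightarrow> left_op n (foldr (left_mult_inv n) ss)"
  using left_op_foldr left_op_left_mult left_op_left_mult_inv by (meson subsetD)+

lemma reduced_word_S: "y \<in> W n \<Longrightarrow> set (reduced_word n y) \<subseteq> S n"
  using reduced_word_props(1) by (auto simp: reduced_def)

lemma left_op_hecke_mult: "left_op n (hecke_mult n h)"
  unfolding hecke_mult_def by (intro left_op_sum word_left_op finite_W reduced_word_S)

lemma foldr_left_mult_T:
  "reduced n ss \<Longrightarrow> foldr (hecke_gen_mult n) ss (T id) = T (word_prod ss)"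
proof (induction ss)
  case (Cons s ss)
  note r = reduced_Cons[OF Cons.prems]
  have p: "word_prod ss \<in> W n" using r(1) word_prod_W by (auto simp: reduced_def)
  have "foldr (hecke_gen_mult n) (s # ss) (T id) = hecke_gen_mult n s (T (word_prod ss))"
    using Cons.IH[OF r(1)] by (simp only: foldr_Cons o_apply)
  also have "\<dots> = T (s \<circ> word_prod ss)" using left_mult_T[OF r(2) p] r(3) by simp
  finally show ?case by (simp only: word_prod_simps)
qed (simp only: foldr_Nil id_apply word_prod_simps)

lemma hecke_mult_T_id: "h \<in> hecke_carrier n \<Longrightarrow> hecke_mult n h (T id) = h"
  unfolding hecke_mult_def
  using carrier_expand[of h n] foldr_left_mult_T[OF reduced_word_props(1)] reduced_word_props(2)
  by (simp cong: sum.cong)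

text \<open>\<open>F (T id)\<close> is the element by which \<open>F\<close> multiplies: both sides
  are \<open>left_op\<close> in \<open>k\<close> and agree at \<open>T id\<close>. Through this
  every product in the definitions turns into a composition of generator operators.\<close>

lemma hecke_mult_left_op:
  assumes F: "left_op n F" and k: "k \<in> hecke_carrier n"
  shows "hecke_mult n (F (T id)) k = F k"
  by (rule left_op_eqI[OF left_op_hecke_mult F hecke_mult_T_id k])
    (rule left_opD(2)[OF F T_carrier[OF W_id]])

lemma hecke_mult_T_S:
  assumes s: "s \<in> S n" and k: "k \<in> hecke_carrier n"
  shows "hecke_mult n (T s) k = hecke_gen_mult n s k"
proof -
  have "hecke_gen_mult n s (T id) = T s"
    using left_mult_T[OF s W_id] len_S_comp[OF W_id s] by (simp del: o_apply)
  then show ?thesis using hecke_mult_left_op[OF left_op_left_mult[OF s] k] by simp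
qed

lemma left_mult_left_mult:
  assumes s: "s \<in> S n" and h: "h \<in> hecke_carrier n"
  shows "hecke_gen_mult n s (hecke_gen_mult n s h) = (\<lambda>v. h v + v_diff * hecke_gen_mult n s h v)"
proof
  fix w
  show "hecke_gen_mult n s (hecke_gen_mult n s h) w = h w + v_diff * hecke_gen_mult n s h w"
  proof (cases "w \<in> W n")
    case True
    then have "s \<circ> w \<in> W n" "s \<circ> (s \<circ> w) = w" using s S_comp_W by auto
    moreover have "\<not> len n w < len n (s \<circ> w) \<longleftrightarrow> len n (s \<circ> w) < len n w"
      using len_S_comp[OF True s] by linarith
    ultimately show ?thesis using True unfolding hecke_gen_mult_def
      by (cases "len n (s \<circ> w) < len n w") (simp_all add: algebra_simps)
  next
    case False then show ?thesis using h by (simp add: hecke_carrier_def hecke_gen_mult_def)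
  qed
qed

lemma left_mult_inv_left_mult:
  assumes s: "s \<in> S n" and h: "h \<in> hecke_carrier n"
  shows "left_mult_inv n s (hecke_gen_mult n s h) = h" "hecke_gen_mult n s (left_mult_inv n s h) = h"
  using left_mult_left_mult[OF assms]
    linear_op_diff[OF linear_op_left_mult, of n s "hecke_gen_mult n s h" v_diff h]
  by (simp_all add: left_mult_inv_def)

lemma left_mult_inv_left_mult_inv:
  assumes s: "s \<in> S n" and h: "h \<in> hecke_carrier n"
  shows "left_mult_inv n s (left_mult_inv n s h) = (\<lambda>v. h v - v_diff * left_mult_inv n s h v)"
  using left_mult_inv_left_mult(2)[OF assms] unfolding left_mult_inv_def[of n s "left_mult_inv n s h"] by simp

lemma word_inverse:
  assumes "set ss \<subseteq> S n" "k \<in> hecke_carrier n"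
  shows "foldr (left_mult_inv n) ss (foldr (hecke_gen_mult n) (rev ss) k) = k"
    "foldr (hecke_gen_mult n) (rev ss) (foldr (left_mult_inv n) ss k) = k"
proof -
  show "foldr (left_mult_inv n) ss (foldr (hecke_gen_mult n) (rev ss) k) = k" using assms
    by (induction ss arbitrary: k) (simp_all add: left_mult_inv_left_mult)
  show "foldr (hecke_gen_mult n) (rev ss) (foldr (left_mult_inv n) ss k) = k" using assms
    by (induction ss) (simp_all add: left_mult_inv_left_mult left_opD(2)[OF word_left_op(2)])
qed

abbreviation bar_T :: "nat \<Rightarrow> (nat \<Rightarrow> nat) \<Rightarrow> hecke" where
  "bar_T n y \<equiv> hecke_inverse n (T (inv y))"

text \<open>For reduced \<open>y = s_1 ... s_k\<close> the element \<open>T (inv y)\<close> is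
  \<open>T_{s_k} ... T_{s_1}\<close>, so its inverse is the same word \<open>s_1 ... s_k\<close> in
  the inverse generators. The \<open>THE\<close> is resolved because multiplication by
  \<open>T (inv y)\<close> is an invertible operator, so that every right inverse equals this
  one.\<close>

lemma bar_T_word:
  assumes r: "reduced n ss"
  shows "bar_T n (word_prod ss) = foldr (left_mult_inv n) ss (T id)"
  unfolding hecke_inverse_def
proof (rule the_equality)
  have ss: "set ss \<subseteq> S n" "set (rev ss) \<subseteq> S n" using r by (auto simp: reduced_def)
  let ?g = "foldr (left_mult_inv n) ss (T id)"
  have Ti: "T (inv (word_prod ss)) = foldr (hecke_gen_mult n) (rev ss) (T id)"
    using foldr_left_mult_T[OF reduced_rev[OF r]] word_prod_rev[OF ss(1)] by simp
  have g: "?g \<in> hecke_carrier n" using left_opD(2)[OF word_left_op(2)[OF ss(1)]] by simp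
  have c: "T (inv (word_prod ss)) \<in> hecke_carrier n"
    using ss by (intro T_carrier W_inv word_prod_W)
  have mult_g: "hecke_mult n ?g k = foldr (left_mult_inv n) ss k" if "k \<in> hecke_carrier n" for k
    using hecke_mult_left_op[OF word_left_op(2)[OF ss(1)] that] .
  have mult_T: "hecke_mult n (T (inv (word_prod ss))) k = foldr (hecke_gen_mult n) (rev ss) k"
    if "k \<in> hecke_carrier n" for k
    unfolding Ti using hecke_mult_left_op[OF word_left_op(1)[OF ss(2)] that] .
  show "?g \<in> hecke_carrier n \<and> hecke_mult n ?g (T (inv (word_prod ss))) = T id \<and>
    hecke_mult n (T (inv (word_prod ss))) ?g = T id"
    using g mult_g[OF c] mult_T[OF g] Ti word_inverse[OF ss(1) T_carrier[OF W_id]] by simp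
  fix g' assume g': "g' \<in> hecke_carrier n \<and> hecke_mult n g' (T (inv (word_prod ss))) = T id \<and>
    hecke_mult n (T (inv (word_prod ss))) g' = T id"
  then have "foldr (hecke_gen_mult n) (rev ss) g' = T id" using mult_T[of g'] by simp
  then show "g' = ?g" using word_inverse(1)[OF ss(1), of g'] g' by simp
qed

lemma bar_T_carrier [simp]: assumes "y \<in> W n" shows "bar_T n y \<in> hecke_carrier n"
proof -
  from exists_reduced[OF assms] obtain ss where ss: "reduced n ss" "word_prod ss = y" by (elim exE conjE)
  then show ?thesis using bar_T_word[OF ss(1)] left_opD(2)[OF word_left_op(2)[of ss n]]
    by (simp add: reduced_def)
qed

lemma bar_T_id: "bar_T n id = T id"
  using bar_T_word[OF reduced_Nil] by (simp only: word_prod_simps foldr_Nil id_apply)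

lemma bar_T_up:
  assumes s: "s \<in> S n" and y: "y \<in> W n" and l: "len n y < len n (s \<circ> y)"
  shows "bar_T n (s \<circ> y) = left_mult_inv n s (bar_T n y)"
proof -
  from exists_reduced[OF y] obtain ss where ss: "reduced n ss" "word_prod ss = y" by (elim exE conjE)
  have r: "reduced n (s # ss)" using reduced_ConsI[OF ss(1) s] ss(2) l by simp
  show ?thesis using bar_T_word[OF r] bar_T_word[OF ss(1)]
    unfolding word_prod_simps ss(2) by simp
qed

lemma bar_T_step:
  assumes s: "s \<in> S n" and y: "y \<in> W n"
  shows "left_mult_inv n s (bar_T n y) =
    (\<lambda>v. bar_T n (s \<circ> y) v - (if len n (s \<circ> y) < len n y then v_diff * bar_T n y v else 0))"
proof (cases "len n (s \<circ> y) < len n y")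
  case True
  have sy: "s \<circ> y \<in> W n" using S_comp_W[OF s] y by simp
  have up: "bar_T n y = left_mult_inv n s (bar_T n (s \<circ> y))"
    using bar_T_up[OF s sy] True S_cancel(1)[OF s, of y] by simp
  show ?thesis using left_mult_inv_left_mult_inv[OF s bar_T_carrier[OF sy]] True
    unfolding up[symmetric] by simp
next
  case False
  then have "len n y < len n (s \<circ> y)" using len_S_comp[OF y s] by auto
  then show ?thesis using bar_T_up[OF s y] False by simp
qed

section \<open>Laurent polynomials and the bar involution\<close>

lemma lookup_laurent_bar [simp]: "Poly_Mapping.lookup (laurent_bar a) k = Poly_Mapping.lookup a (- k)"
  unfolding laurent_bar_def by (simp add: Poly_Mapping.map_key.rep_eq)

lemma sum_monomials: "a = (\<Sum>k\<in>Poly_Mapping.keys a. Poly_Mapping.single k (Poly_Mapping.lookup a k))"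
  by (rule poly_mapping_eqI) (auto simp: lookup_sum lookup_single when_def not_in_keys_iff_lookup_eq_zero)

lemma lookup_single_mult:
  fixes a :: laurent
  shows "Poly_Mapping.lookup (Poly_Mapping.single i x * a) k = x * Poly_Mapping.lookup a (k - i)"
proof -
  have "Poly_Mapping.lookup (Poly_Mapping.single i x * a) k =
    Poly_Mapping.lookup (\<Sum>j\<in>Poly_Mapping.keys a. Poly_Mapping.single (i + j) (x * Poly_Mapping.lookup a j)) k"
    by (subst sum_monomials[of a]) (simp add: sum_distrib_left mult_single)
  also have "\<dots> = (\<Sum>j\<in>Poly_Mapping.keys a. if j = k - i then x * Poly_Mapping.lookup a j else 0)"
    unfolding lookup_sum by (rule sum.cong) (auto simp: lookup_single when_def)
  also have "\<dots> = x * Poly_Mapping.lookup a (k - i)"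
    by (simp add: not_in_keys_iff_lookup_eq_zero)
  finally show ?thesis .
qed

lemma lookup_q_mult [simp]: "Poly_Mapping.lookup (q * a) k = Poly_Mapping.lookup a (k - 1)"
  unfolding q_def lookup_single_mult by simp

lemma lookup_q_inv_mult [simp]: "Poly_Mapping.lookup (q_inv * a) k = Poly_Mapping.lookup a (k + 1)"
  unfolding q_inv_def lookup_single_mult by simp

lemma q_q_inv [simp]: "q * q_inv = 1" "q_inv * q = 1"
  by (simp_all add: q_def q_inv_def mult_single)

lemma laurent_bar_add: "laurent_bar (a + b) = laurent_bar a + laurent_bar b"
  by (rule poly_mapping_eqI) (simp add: lookup_add)

lemma laurent_bar_diff: "laurent_bar (a - b) = laurent_bar a - laurent_bar b"
  by (rule poly_mapping_eqI) (simp add: lookup_minus)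

lemma laurent_bar_zero [simp]: "laurent_bar 0 = 0"
  by (rule poly_mapping_eqI) simp

lemma laurent_bar_sum: "laurent_bar (\<Sum>x\<in>A. f x) = (\<Sum>x\<in>A. laurent_bar (f x))"
  by (rule poly_mapping_eqI) (simp add: lookup_sum)

lemma laurent_bar_single: "laurent_bar (Poly_Mapping.single i x) = Poly_Mapping.single (- i) x"
  by (rule poly_mapping_eqI) (auto simp: lookup_single when_def)

lemma laurent_bar_mult: "laurent_bar (a * b) = laurent_bar a * laurent_bar b"
proof -
  have "laurent_bar (Poly_Mapping.single i x * b) = laurent_bar (Poly_Mapping.single i x) * laurent_bar b" for i x
    by (rule poly_mapping_eqI) (simp add: laurent_bar_single lookup_single_mult)
  then show ?thesis
    by (subst (1 2) sum_monomials[of a]) (simp add: sum_distrib_right laurent_bar_sum)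
qed

lemma laurent_bar_simps [simp]:
  "laurent_bar q = q_inv" "laurent_bar q_inv = q" "laurent_bar 1 = 1"
  by (simp_all add: q_def q_inv_def laurent_bar_single flip: single_one)

lemma hecke_bar_carrier [simp]: "hecke_bar n h \<in> hecke_carrier n"
  unfolding hecke_bar_def by (intro sum_carrier bar_T_carrier)

lemma hecke_bar_linear:
  "hecke_bar n (\<lambda>v. a * h v + k v) = (\<lambda>v. laurent_bar a * hecke_bar n h v + hecke_bar n k v)"
  unfolding hecke_bar_def
  by (simp add: laurent_bar_add laurent_bar_mult sum.distrib sum_distrib_left algebra_simps)

lemma hecke_bar_zero: "hecke_bar n (\<lambda>v. 0) = (\<lambda>v. 0)"
  by (simp add: hecke_bar_def)

lemma hecke_bar_sum:
  assumes "finite A"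
  shows "hecke_bar n (\<lambda>v. \<Sum>y\<in>A. a y * h y v) = (\<lambda>v. \<Sum>y\<in>A. laurent_bar (a y) * hecke_bar n (h y) v)"
  using assms
proof (induction A rule: finite_induct)
  case empty then show ?case by (simp add: hecke_bar_zero)
next
  case (insert y A)
  then show ?case using hecke_bar_linear[of n "a y" "h y" "\<lambda>v. \<Sum>y\<in>A. a y * h y v"] by simp
qed

lemma hecke_bar_diff:
  "hecke_bar n (\<lambda>v. h v - a * k v) = (\<lambda>v. hecke_bar n h v - laurent_bar a * hecke_bar n k v)"
  using hecke_bar_linear[of n "- a" k h] laurent_bar_diff[of 0 a] by (simp add: algebra_simps)

lemma hecke_bar_T_id: "hecke_bar n (T id) = T id"
proof
  fix v
  have "hecke_bar n (T id) v = (\<Sum>y\<in>W n. if y = id then bar_T n y v else 0)"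
    unfolding hecke_bar_def by (intro sum.cong) (auto simp: T_def)
  also have "\<dots> = T id v" using bar_T_id by simp
  finally show "hecke_bar n (T id) v = T id v" .
qed

lemma bij_betw_S_comp: "s \<in> S n \<Longrightarrow> bij_betw (\<lambda>w. s \<circ> w) (W n) (W n)"
  by (rule bij_betwI[where g = "\<lambda>w. s \<circ> w"]) (simp_all add: S_comp_W)

text \<open>Multiplicativity of the bar involution against a generator. One of the two sums is
  reindexed by \<open>w \<mapsto> s \<circ> w\<close>; afterwards each summand is an instance of
  \<open>bar_T_step\<close>.\<close>

lemma hecke_bar_left_mult:
  assumes s: "s \<in> S n" and h: "h \<in> hecke_carrier n"
  shows "hecke_bar n (hecke_gen_mult n s h) = left_mult_inv n s (hecke_bar n h)"
proof
  fix v
  let ?d = "\<lambda>w. len n (s \<circ> w) < len n w"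
  have "hecke_bar n (hecke_gen_mult n s h) v =
    (\<Sum>w\<in>W n. laurent_bar (h (s \<circ> w)) * bar_T n w v) +
    (\<Sum>w\<in>W n. if ?d w then - v_diff * (laurent_bar (h w) * bar_T n w v) else 0)"
    unfolding hecke_bar_def hecke_gen_mult_def sum.distrib[symmetric]
    by (intro sum.cong) (simp_all add: laurent_bar_add laurent_bar_mult laurent_bar_diff algebra_simps)
  also have "(\<Sum>w\<in>W n. laurent_bar (h (s \<circ> w)) * bar_T n w v) =
    (\<Sum>w\<in>W n. laurent_bar (h w) * bar_T n (s \<circ> w) v)"
    by (rule sum.reindex_bij_betw[OF bij_betw_S_comp[OF s], symmetric, THEN trans])
      (simp_all add: S_cancel(1)[OF s])
  finally have "hecke_bar n (hecke_gen_mult n s h) v =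
    (\<Sum>w\<in>W n. laurent_bar (h w) * (bar_T n (s \<circ> w) v - (if ?d w then v_diff * bar_T n w v else 0)))"
    unfolding sum.distrib[symmetric] by (auto simp: algebra_simps intro!: sum.cong)
  also have "\<dots> = (\<Sum>w\<in>W n. laurent_bar (h w) * left_mult_inv n s (bar_T n w) v)"
    using bar_T_step[OF s] by (intro sum.cong) simp_all
  also have "\<dots> = left_mult_inv n s (hecke_bar n h) v"
    unfolding hecke_bar_def using fun_cong[OF linear_op_sum[OF linear_op_left_mult_inv finite_W]] by simp
  finally show "hecke_bar n (hecke_gen_mult n s h) v = left_mult_inv n s (hecke_bar n h) v" .
qed

text \<open>Reflecting through \<open>w \<mapsto> w\<^sup>-\<^sup>1\<close> is an anti-automorphism; it exchanges left and right
  multiplication and commutes with the bar involution. The case distinction is needed because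
  \<^term>\<open>inv v\<close> may lie in \<^term>\<open>W n\<close> for \<open>v\<close> that is not a permutation.\<close>

definition flat :: "nat \<Rightarrow> hecke \<Rightarrow> hecke" where
  "flat n h = (\<lambda>v. if v \<in> W n then h (inv v) else 0)"

lemma flat_carrier [simp]: "flat n h \<in> hecke_carrier n"
  by (simp add: flat_def hecke_carrier_def)

lemma flat_flat: "h \<in> hecke_carrier n \<Longrightarrow> flat n (flat n h) = h"
  by (auto simp: flat_def hecke_carrier_def W_inv fun_eq_iff)

lemma linear_op_flat: "linear_op (flat n)"
  by (simp add: linear_op_def flat_def fun_eq_iff)

lemma S_comp_inv: "s \<in> S n \<Longrightarrow> w \<in> W n \<Longrightarrow> s \<circ> inv w = inv (w \<circ> s)"
  using W_inv_o[OF _ S_W, of w n s] inv_S[of s n] by simp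

lemma right_mult_flat:
  assumes s: "s \<in> S n" shows "right_mult n s h = flat n (hecke_gen_mult n s (flat n h))"
proof
  fix w
  show "right_mult n s h w = flat n (hecke_gen_mult n s (flat n h)) w"
  proof (cases "w \<in> W n")
    case True
    have ws: "w \<circ> s \<in> W n" using W_comp_S[OF s] True by simp
    have e: "s \<circ> inv w = inv (w \<circ> s)" using S_comp_inv[OF s True] .
    show ?thesis using True W_inv[OF True] W_inv[OF ws] W_inv_inv[OF True] W_inv_inv[OF ws]
      len_inv[OF True] len_inv[OF ws]
      unfolding right_mult_def flat_def hecke_gen_mult_def e by simp
  qed (simp add: right_mult_def flat_def)
qed

text \<open>At \<open>T id\<close> the operator \<open>left_mult_inv n s\<close> is also the
  multiplication by \<open>T_s^-1\<close> from the right, and the operator of the remaining word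
  commutes with right multiplication. So a letter appended at the end acts from the right.\<close>

lemma bar_T_right_up:
  assumes s: "s \<in> S n" and y: "y \<in> W n" and l: "len n y < len n (y \<circ> s)"
  shows "bar_T n (y \<circ> s) = (\<lambda>v. right_mult n s (bar_T n y) v - v_diff * bar_T n y v)"
proof -
  from exists_reduced[OF y] obtain ss where ss: "reduced n ss" "word_prod ss = y" by (elim exE conjE)
  have sS: "set ss \<subseteq> S n" using ss by (simp add: reduced_def)
  have w: "word_prod (ss @ [s]) = y \<circ> s" unfolding word_prod_append word_prod_simps ss(2) by simp
  have r: "reduced n (ss @ [s])" using ss s l len_comp_S[OF y s] w by (auto simp: reduced_def)
  let ?F = "foldr (left_mult_inv n) ss"
  have F: "left_op n ?F" using word_left_op(2)[OF sS] .
  have "left_mult_inv n s (T id) = (\<lambda>v. right_mult n s (T id) v - v_diff * T id v)"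
    unfolding left_mult_inv_def left_mult_T[OF s W_id] right_mult_T[OF s W_id] id_comp comp_id ..
  then have "?F (left_mult_inv n s (T id)) =
    (\<lambda>v. right_mult n s (?F (T id)) v - v_diff * ?F (T id) v)"
    using linear_op_diff[OF left_opD(1)[OF F]] left_opD(3)[OF F s T_carrier[OF W_id]] by simp
  moreover have "bar_T n (y \<circ> s) = ?F (left_mult_inv n s (T id))"
    using bar_T_word[OF r] unfolding w by simp
  ultimately show ?thesis using bar_T_word[OF ss(1)] ss(2) by simp
qed

lemma bar_T_inv:
  assumes y: "y \<in> W n" shows "bar_T n (inv y) = flat n (bar_T n y)"
proof -
  have "bar_T n (inv (word_prod ss)) = flat n (bar_T n (word_prod ss))" if "reduced n ss" for ss
    using that
  proof (induction ss)
    case Nil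
    have "inv v = id \<longleftrightarrow> v = id" if "v \<in> W n" for v using W_inv_inv[OF that] inv_id by metis
    then have "flat n (T id) v = T id v" for v
      unfolding flat_def T_def using W_id[of n] by (cases "v \<in> W n") auto
    then have "flat n (T id) = T id" by blast
    then show ?case using bar_T_id by (simp only: word_prod_simps inv_id)
  next
    case (Cons s ss)
    note r = reduced_Cons[OF Cons.prems]
    let ?p = "word_prod ss"
    have p: "?p \<in> W n" using r(1) word_prod_W by (auto simp: reduced_def)
    have e: "inv (s \<circ> ?p) = inv ?p \<circ> s" using W_inv_o[OF S_W[OF r(2)] p] inv_S[OF r(2)] by simp
    have l: "len n (inv ?p) < len n (inv ?p \<circ> s)"
      using r(3) len_inv[OF p] len_inv[OF W_comp[OF S_W[OF r(2)] p]] unfolding e by simp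
    let ?b = "bar_T n ?p"
    have b: "?b \<in> hecke_carrier n" using p by simp
    have "bar_T n (inv ?p \<circ> s) = (\<lambda>v. right_mult n s (flat n ?b) v - v_diff * flat n ?b v)"
      using bar_T_right_up[OF r(2) W_inv[OF p] l] Cons.IH[OF r(1)] by simp
    also have "\<dots> = flat n (left_mult_inv n s ?b)"
      unfolding left_mult_inv_def linear_op_diff[OF linear_op_flat] right_mult_flat[OF r(2)] flat_flat[OF b] ..
    also have "left_mult_inv n s ?b = bar_T n (s \<circ> ?p)" using bar_T_up[OF r(2) p] r(3) by simp
    finally show ?case unfolding word_prod_simps e .
  qed
  moreover from exists_reduced[OF y] obtain ss where "reduced n ss" "word_prod ss = y" by (elim exE conjE)
  ultimately show ?thesis by blast
qed

lemma bij_betw_W_inv: "bij_betw inv (W n) (W n)"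
  by (rule bij_betwI[where g = inv]) (auto simp: W_inv)

lemma hecke_bar_flat: "hecke_bar n (flat n h) = flat n (hecke_bar n h)"
proof
  fix v
  show "hecke_bar n (flat n h) v = flat n (hecke_bar n h) v"
  proof (cases "v \<in> W n")
    case True
    have "hecke_bar n (flat n h) v = (\<Sum>y\<in>W n. laurent_bar (h (inv y)) * bar_T n y v)"
      unfolding hecke_bar_def by (intro sum.cong) (simp_all add: flat_def)
    also have "\<dots> = (\<Sum>y\<in>W n. laurent_bar (h (inv (inv y))) * bar_T n (inv y) v)"
      by (rule sum.reindex_bij_betw[OF bij_betw_W_inv, symmetric])
    also have "\<dots> = (\<Sum>y\<in>W n. laurent_bar (h y) * bar_T n y (inv v))"
    proof (rule sum.cong)
      fix y assume y: "y \<in> W n"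
      have "bar_T n (inv y) v = bar_T n y (inv v)"
        unfolding bar_T_inv[OF y] flat_def using True by (simp only: if_True)
      then show "laurent_bar (h (inv (inv y))) * bar_T n (inv y) v = laurent_bar (h y) * bar_T n y (inv v)"
        by (simp only: W_inv_inv[OF y])
    qed simp
    finally show ?thesis using True by (simp add: flat_def hecke_bar_def)
  next
    case False
    then show ?thesis
      using carrier_outside[OF hecke_bar_carrier] carrier_outside[OF flat_carrier] by metis
  qed
qed

section \<open>The Kazhdan--Lusztig basis\<close>

definition nonneg_poly :: "laurent \<Rightarrow> bool" where
  "nonneg_poly a \<longleftrightarrow> (\<forall>k. Poly_Mapping.lookup a k \<noteq> 0 \<longrightarrow> k \<ge> 0)"

definition pos_poly :: "laurent \<Rightarrow> bool" where
  "pos_poly a \<longleftrightarrow> (\<forall>k. Poly_Mapping.lookup a k \<noteq> 0 \<longrightarrow> k > 0)"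

lemma pos_poly_iff: "pos_poly a \<longleftrightarrow> nonneg_poly a \<and> Poly_Mapping.lookup a 0 = 0"
  unfolding pos_poly_def nonneg_poly_def by (metis less_irrefl order_le_less)

lemma nonneg_poly_0 [simp]: "nonneg_poly 0" and nonneg_poly_1 [simp]: "nonneg_poly 1"
  by (auto simp: nonneg_poly_def lookup_one when_def)

lemma pos_poly_0 [simp]: "pos_poly 0"
  by (simp add: pos_poly_def)

lemma nonneg_poly_diff: "nonneg_poly a \<Longrightarrow> nonneg_poly b \<Longrightarrow> nonneg_poly (a - b)"
  unfolding nonneg_poly_def lookup_minus by (metis diff_0_right diff_self)

lemma nonneg_poly_sum: "(\<And>x. x \<in> A \<Longrightarrow> nonneg_poly (f x)) \<Longrightarrow> nonneg_poly (\<Sum>x\<in>A. f x)"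
  unfolding nonneg_poly_def lookup_sum by (metis (no_types, lifting) sum.neutral)

lemma nonneg_poly_const_mult: "nonneg_poly a \<Longrightarrow> nonneg_poly (Poly_Mapping.single 0 c * a)"
  by (auto simp: nonneg_poly_def lookup_single_mult)

lemma nonneg_poly_q_mult: "nonneg_poly a \<Longrightarrow> nonneg_poly (q * a)"
  unfolding nonneg_poly_def lookup_q_mult by force

lemma nonneg_poly_q_inv_mult: "pos_poly a \<Longrightarrow> nonneg_poly (q_inv * a)"
  unfolding nonneg_poly_def pos_poly_def lookup_q_inv_mult by force

lemma exists_longest_support:
  assumes "x \<in> W n" "(h::hecke) x \<noteq> 0"
  shows "\<exists>y\<in>W n. h y \<noteq> 0 \<and> (\<forall>z\<in>W n. h z \<noteq> 0 \<longrightarrow> len n z \<le> len n y)"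
proof -
  let ?A = "{y \<in> W n. h y \<noteq> 0}"
  have A: "finite (len n ` ?A)" "len n ` ?A \<noteq> {}" using assms by auto
  from Max_in[OF this] obtain y where "y \<in> ?A" "len n y = Max (len n ` ?A)" by auto
  then show ?thesis using Max_ge[OF A(1)] by auto
qed

text \<open>Triangularity of the bar involution with respect to length, for arguments by leading
  terms.\<close>

lemma bar_T_support:
  assumes "y \<in> W n"
  shows "bar_T n y y = 1" "bar_T n y v \<noteq> 0 \<Longrightarrow> v = y \<or> len n v < len n y"
proof -
  have "bar_T n (word_prod ss) (word_prod ss) = 1 \<and>
    (\<forall>v. bar_T n (word_prod ss) v \<noteq> 0 \<longrightarrow> v = word_prod ss \<or> len n v < len n (word_prod ss))"
    if "reduced n ss" for ss
    using that
  proof (induction ss)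
    case Nil
    have "T id id = 1" "\<And>v. T id v \<noteq> 0 \<Longrightarrow> v = id" by (simp_all add: T_def split: if_splits)
    then show ?case unfolding word_prod_simps bar_T_id by blast
  next
    case (Cons s ss)
    note r = reduced_Cons[OF Cons.prems]
    let ?p = "word_prod ss"
    have p: "?p \<in> W n" using r(1) word_prod_W by (auto simp: reduced_def)
    have sp: "s \<circ> ?p \<in> W n" "s \<circ> (s \<circ> ?p) = ?p" using p r(2) S_comp_W by auto
    have IH: "bar_T n ?p ?p = 1"
      "\<And>v. bar_T n ?p v \<noteq> 0 \<Longrightarrow> v = ?p \<or> len n v < len n ?p" using Cons.IH[OF r(1)] by auto
    have e: "bar_T n (s \<circ> ?p) v =
      (if v \<in> W n then bar_T n ?p (s \<circ> v) + (if len n (s \<circ> v) < len n v then v_diff * bar_T n ?p v else 0) else 0)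
        - v_diff * bar_T n ?p v" for v
      using bar_T_up[OF r(2) p] r(3) by (simp add: left_mult_inv_def hecke_gen_mult_def)
    have z: "bar_T n ?p (s \<circ> ?p) = 0" using IH(2)[of "s \<circ> ?p"] r(3) by fastforce
    have 1: "bar_T n (s \<circ> ?p) (s \<circ> ?p) = 1" unfolding e sp z IH(1) using sp by simp
    have 2: "v = s \<circ> ?p \<or> len n v < len n (s \<circ> ?p)" if "bar_T n (s \<circ> ?p) v \<noteq> 0" for v
    proof -
      have "bar_T n ?p v \<noteq> 0 \<or> (v \<in> W n \<and> bar_T n ?p (s \<circ> v) \<noteq> 0)"
        using that unfolding e by (auto split: if_splits)
      then show ?thesis
      proof
        assume "bar_T n ?p v \<noteq> 0" then show ?thesis using IH(2)[of v] r(3) by auto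
      next
        assume a: "v \<in> W n \<and> bar_T n ?p (s \<circ> v) \<noteq> 0"
        then have "s \<circ> v = ?p \<or> len n (s \<circ> v) < len n ?p" using IH(2) by blast
        then show ?thesis
        proof
          assume "s \<circ> v = ?p" then show ?thesis using S_comp_eq_iff[OF r(2), of v ?p] by metis
        next
          assume "len n (s \<circ> v) < len n ?p"
          then show ?thesis using len_S_comp[of v n s] a r(2,3) by auto
        qed
      qed
    qed
    show ?case unfolding word_prod_simps using 1 2 by blast
  qed
  moreover from exists_reduced[OF assms] obtain ss where "reduced n ss" "word_prod ss = y" by (elim exE conjE)
  ultimately show "bar_T n y y = 1" "bar_T n y v \<noteq> 0 \<Longrightarrow> v = y \<or> len n v < len n y" by blast+
qed

text \<open>At an element of maximal length in the support, triangularity makes the coefficient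
  itself invariant under \<open>q \<mapsto> q^-1\<close>. A Laurent polynomial with this symmetry
  and only positive exponents is zero.\<close>

lemma bar_invariant_pos_zero:
  assumes h: "h \<in> hecke_carrier n" "hecke_bar n h = h" "\<And>y. pos_poly (h y)"
  shows "h = (\<lambda>v. 0)"
proof (rule ccontr)
  assume "h \<noteq> (\<lambda>v. 0)"
  then obtain x where "h x \<noteq> 0" by auto
  moreover from this have "x \<in> W n" using h(1) by (auto simp: hecke_carrier_def)
  ultimately obtain y where y: "y \<in> W n" "h y \<noteq> 0" "\<And>z. z \<in> W n \<Longrightarrow> h z \<noteq> 0 \<Longrightarrow> len n z \<le> len n y"
    using exists_longest_support[of x n h] by blast
  have "h y = hecke_bar n h y" using h(2) by simp
  also have "\<dots> = (\<Sum>z\<in>W n. if z = y then laurent_bar (h y) else 0)"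
    unfolding hecke_bar_def
  proof (rule sum.cong)
    fix z assume z: "z \<in> W n"
    show "laurent_bar (h z) * bar_T n z y = (if z = y then laurent_bar (h y) else 0)"
    proof (cases "z = y")
      case True then show ?thesis using bar_T_support(1)[OF y(1)] by simp
    next
      case False
      then have "h z = 0 \<or> bar_T n z y = 0" using y(3)[OF z] bar_T_support(2)[OF z, of y] by fastforce
      then show ?thesis using False by auto
    qed
  qed simp
  also have "\<dots> = laurent_bar (h y)" using y(1) by simp
  finally have sym: "Poly_Mapping.lookup (h y) k = Poly_Mapping.lookup (h y) (- k)" for k
    using lookup_laurent_bar by metis
  have "Poly_Mapping.lookup (h y) k = 0" for k
    using h(3)[of y] sym[of k] unfolding pos_poly_def by (metis less_asym neg_0_less_iff_less)
  then have "h y = 0" by (intro poly_mapping_eqI) simp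
  then show False using y(2) by simp
qed

text \<open>Separated from \<open>kl_strong\<close> because uniqueness and the behaviour under
  \<open>flat\<close> are settled at this level; the Bruhat support is added in
  \<open>kl_strong\<close>.\<close>

definition kl_element :: "nat \<Rightarrow> (nat \<Rightarrow> nat) \<Rightarrow> hecke \<Rightarrow> bool" where
  "kl_element n w c \<longleftrightarrow> c \<in> hecke_carrier n \<and> hecke_bar n c = c \<and> c w = 1 \<and> (\<forall>y. y \<noteq> w \<longrightarrow> pos_poly (c y))"

lemma kl_element_unique:
  assumes "kl_element n w c" "kl_element n w c'" shows "c = c'"
proof -
  let ?h = "\<lambda>v. c v - 1 * c' v"
  have "?h = (\<lambda>v. 0)"
  proof (rule bar_invariant_pos_zero)
    show "?h \<in> hecke_carrier n" using assms by (simp add: kl_element_def hecke_carrier_def)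
    show "hecke_bar n ?h = ?h" unfolding hecke_bar_diff using assms by (simp add: kl_element_def)
    show "pos_poly (?h y)" for y
      using assms by (cases "y = w") (auto simp: kl_element_def pos_poly_iff nonneg_poly_diff lookup_minus)
  qed
  then show ?thesis by (simp add: fun_eq_iff)
qed

section \<open>Bruhat order and its lifting property\<close>

lemma bruhat_less_imp:
  assumes "bruhat_less n y x" shows "y \<in> W n" "x \<in> W n" "len n y < len n x"
proof -
  have "y \<in> W n \<and> x \<in> W n \<and> len n y < len n x"
    using assms unfolding bruhat_less_def
  proof (induction rule: tranclp_induct)
    case (base x)
    then show ?case by (auto simp: reflections_eq W_comp transpose_W simp del: o_apply)
  next
    case (step x z) then show ?case by auto
  qed
  then show "y \<in> W n" "x \<in> W n" "len n y < len n x" by auto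
qed

lemma bruhat_less_trans: "bruhat_less n x y \<Longrightarrow> bruhat_less n y z \<Longrightarrow> bruhat_less n x z"
  unfolding bruhat_less_def by (rule tranclp_trans)

lemma bruhat_less_reflection:
  "x \<in> W n \<Longrightarrow> t \<in> reflections n \<Longrightarrow> len n (t \<circ> x) < len n x \<Longrightarrow> bruhat_less n (t \<circ> x) x"
  unfolding bruhat_less_def by (rule tranclp.r_into_trancl) blast

lemma S_reflection: assumes "s \<in> S n" shows "s \<in> reflections n"
proof -
  obtain k where "s = transpose k (k + 1)" "1 \<le> k" "k < n" using assms by (auto simp: S_def simple_def)
  then have "s = transpose k (k + 1) \<and> k \<in> {1..n} \<and> k + 1 \<in> {1..n} \<and> k < k + 1" by simp
  then show ?thesis unfolding reflections_eq by blast
qed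

lemma bruhat_less_S_comp:
  assumes "x \<in> W n" "s \<in> S n" "len n x < len n (s \<circ> x)" shows "bruhat_less n x (s \<circ> x)"
  using bruhat_less_reflection[OF _ S_reflection[OF assms(2)], of "s \<circ> x"] assms S_comp_W[OF assms(2)] by simp

text \<open>\<open>s t x\<close> equals \<open>(s t s) (s x)\<close>, where \<open>s t s\<close>
  transposes the values \<open>s c\<close> and \<open>s d\<close>. These form an inversion of
  \<open>s x\<close> just as \<open>c\<close>, \<open>d\<close> do of \<open>x\<close>, unless
  \<open>t = s\<close>.\<close>

lemma reflection_S_comp:
  assumes x: "x \<in> W n" and t: "t \<in> reflections n" "len n (t \<circ> x) < len n x" and s: "s \<in> S n"
  shows "s \<circ> (t \<circ> x) = x \<or> bruhat_less n (s \<circ> (t \<circ> x)) (s \<circ> x)"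
proof -
  obtain k where k: "s = simple k" "1 \<le> k" "k < n" using s by (auto simp: S_def)
  obtain c d where cd: "t = transpose c d" "c \<in> {1..n}" "d \<in> {1..n}" "c < d"
    using t(1) unfolding reflections_eq by blast
  have less: "inv x d < inv x c" using len_transpose_less_iff[OF x cd(2-4)] t(2) cd(1) by simp
  show ?thesis
  proof (cases "c = k \<and> d = k + 1")
    case True
    then have "t = s" using cd(1) k(1) by (simp add: simple_def)
    then show ?thesis using S_cancel(1)[OF s] by simp
  next
    case False
    let ?c = "s c" and ?d = "s d"
    have l: "?c < ?d" using simple_less[OF cd(4) False] k(1) by simp
    have r: "?c \<in> {1..n}" "?d \<in> {1..n}" using W_in[OF S_W[OF s]] cd by auto
    have sx: "s \<circ> x \<in> W n" using x s S_comp_W by simp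
    have "inv (s \<circ> x) ?d < inv (s \<circ> x) ?c"
      using less inv_simple_comp[OF x k(2,3)] k(1) by simp
    then have "len n (transpose ?c ?d \<circ> (s \<circ> x)) < len n (s \<circ> x)"
      using len_transpose_less[OF sx r l] by simp
    moreover have "transpose ?c ?d \<in> reflections n" unfolding reflections_eq using r l by blast
    moreover have "s \<circ> (t \<circ> x) = transpose ?c ?d \<circ> (s \<circ> x)"
      using simple_transpose_conj[OF k(2,3) cd(2,3), of x] k(1) cd(1) by simp
    ultimately show ?thesis using bruhat_less_reflection[OF sx] by metis
  qed
qed

text \<open>Controls the support of \<open>C_s C_v\<close> for \<open>v < s v\<close>: the shifted
  terms \<open>s y\<close> stay below \<open>s v\<close>.\<close>

lemma bruhat_less_lift:
  assumes "bruhat_less n y x" and s: "s \<in> S n" and "len n x < len n (s \<circ> x)"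
  shows "bruhat_less n (s \<circ> y) (s \<circ> x)"
  using assms(1,3) unfolding bruhat_less_def[of n, THEN fun_cong, THEN fun_cong, of y x]
proof (induction rule: converse_tranclp_induct)
  case (base y)
  then obtain t where t: "x \<in> W n" "t \<in> reflections n" "y = t \<circ> x" "len n (t \<circ> x) < len n x" by blast
  then show ?case using reflection_S_comp[OF t(1,2,4) s] bruhat_less_S_comp[OF t(1) s base.prems] by metis
next
  case (step y z)
  then obtain t where t: "z \<in> W n" "t \<in> reflections n" "y = t \<circ> z" "len n (t \<circ> z) < len n z" by blast
  have zx: "bruhat_less n z x" using step.hyps(2) unfolding bruhat_less_def .
  have IH: "bruhat_less n (s \<circ> z) (s \<circ> x)" using step by blast
  have "bruhat_less n z (s \<circ> x)"
    using bruhat_less_trans[OF zx bruhat_less_S_comp[OF bruhat_less_imp(2)[OF zx] s step.prems]] .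
  then show ?case using reflection_S_comp[OF t(1,2,4) s] t(3) IH bruhat_less_trans by metis
qed

text \<open>Left multiplication by \<open>C\<^sub>s = T\<^sub>s - q\<close>.\<close>

definition kl_mult :: "nat \<Rightarrow> (nat \<Rightarrow> nat) \<Rightarrow> hecke \<Rightarrow> hecke" where
  "kl_mult n s h = (\<lambda>v. hecke_gen_mult n s h v - q * h v)"

lemma kl_mult_carrier [simp]: "h \<in> hecke_carrier n \<Longrightarrow> kl_mult n s h \<in> hecke_carrier n"
  by (simp add: hecke_carrier_def kl_mult_def hecke_gen_mult_def)

lemma hecke_bar_kl_mult:
  assumes "s \<in> S n" "h \<in> hecke_carrier n" "hecke_bar n h = h"
  shows "hecke_bar n (kl_mult n s h) = kl_mult n s h"
  unfolding kl_mult_def hecke_bar_diff hecke_bar_left_mult[OF assms(1,2)] assms(3)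
  by (simp add: left_mult_inv_def algebra_simps)

lemma kl_mult_apply:
  "v \<in> W n \<Longrightarrow> kl_mult n s h v =
    h (s \<circ> v) - (if len n (s \<circ> v) < len n v then q_inv * h v else q * h v)"
  by (simp add: kl_mult_def hecke_gen_mult_def algebra_simps)

definition kl_strong :: "nat \<Rightarrow> (nat \<Rightarrow> nat) \<Rightarrow> hecke \<Rightarrow> bool" where
  "kl_strong n w c \<longleftrightarrow> kl_element n w c \<and> (\<forall>y. y \<noteq> w \<and> c y \<noteq> 0 \<longrightarrow> bruhat_less n y w)"

lemma kl_basis_eq: "kl_basis n w = (THE c. kl_strong n w c)"
  unfolding kl_basis_def kl_strong_def kl_element_def pos_poly_def
  by (rule arg_cong[where f = The]) (auto simp: fun_eq_iff)

lemma kl_basis_eqI: "kl_strong n w c \<Longrightarrow> kl_basis n w = c"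
  unfolding kl_basis_eq by (rule the_equality) (auto simp: kl_strong_def kl_element_unique)

lemma kl_strongD:
  assumes "kl_strong n w c"
  shows "c \<in> hecke_carrier n" "hecke_bar n c = c" "c w = 1" "y \<noteq> w \<Longrightarrow> pos_poly (c y)"
    "y \<noteq> w \<Longrightarrow> c y \<noteq> 0 \<Longrightarrow> bruhat_less n y w" "nonneg_poly (c y)"
    "Poly_Mapping.lookup (c y) 0 = (if y = w then 1 else 0)"
  using assms unfolding kl_strong_def kl_element_def pos_poly_iff
  by (auto simp: lookup_one) (metis nonneg_poly_1)

text \<open>The coefficients of \<open>c\<close> have a constant term only at \<open>v\<close>. So
  the shifted coefficient contributes a constant at \<open>z = s \<circ> v\<close> alone. The factor
  \<open>q_inv\<close> brings the coefficient of \<open>q^1\<close> to degree zero, while the factor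
  \<open>q\<close> would need exponent -1, which does not occur.\<close>

lemma kl_mult_const_coeff:
  assumes c: "kl_strong n v c" and v: "v \<in> W n" and s: "s \<in> S n" and up: "len n v < len n (s \<circ> v)"
    and z: "z \<in> W n"
  shows "nonneg_poly (kl_mult n s c z)"
    "Poly_Mapping.lookup (kl_mult n s c z) 0 =
      (if len n (s \<circ> z) < len n z
       then if z = s \<circ> v then 1 else - Poly_Mapping.lookup (c z) 1 else 0)"
proof -
  note cD = kl_strongD[OF c]
  have zv: "s \<circ> z = v \<longleftrightarrow> z = s \<circ> v" using S_comp_eq_iff[OF s] .
  have ne: "z \<noteq> v" if "len n (s \<circ> z) < len n z" using that up by auto
  show "nonneg_poly (kl_mult n s c z)"
    unfolding kl_mult_apply[OF z] using cD(4)[OF ne] cD(6)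
    by (auto intro: nonneg_poly_diff nonneg_poly_q_inv_mult nonneg_poly_q_mult)
  have "c (s \<circ> v) = 0" using cD(5)[of "s \<circ> v"] up bruhat_less_imp(3)[of n "s \<circ> v" v] by fastforce
  moreover have "Poly_Mapping.lookup (c z) (- 1) = 0" using cD(6)[of z] unfolding nonneg_poly_def by force
  moreover have "z \<noteq> s \<circ> v" if "\<not> len n (s \<circ> z) < len n z" using that up S_cancel(1)[OF s, of v] by auto
  ultimately show "Poly_Mapping.lookup (kl_mult n s c z) 0 =
      (if len n (s \<circ> z) < len n z
       then if z = s \<circ> v then 1 else - Poly_Mapping.lookup (c z) 1 else 0)"
    unfolding kl_mult_apply[OF z] lookup_minus by (auto simp: cD(7) zv)
qed

text \<open>For \<open>w = s v\<close> with \<open>v\<close> shorter, \<open>C_s C_v\<close> is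
  bar-invariant with coefficient 1 at \<open>w\<close>, but may have constant terms elsewhere.
  Subtracting the corresponding integer multiples of shorter \<open>C_u\<close> removes them and
  keeps bar-invariance, because integers are fixed by the bar.\<close>

lemma kl_strong_kl_basis: "w \<in> W n \<Longrightarrow> kl_strong n w (kl_basis n w)"
proof (induction "len n w" arbitrary: w rule: less_induct)
  case less
  show ?case
  proof (cases "w = id")
    case True
    have "kl_strong n id (T id)"
      using hecke_bar_T_id by (simp add: kl_strong_def kl_element_def) (simp add: T_def)
    then show ?thesis using kl_basis_eqI True by metis
  next
    case False
    then obtain k where k: "1 \<le> k" "k < n" "inv w (k + 1) < inv w k"
      using exists_left_descent less.prems by blast
    define s where "s = simple k"
    have s: "s \<in> S n" using k by (simp add: s_def simple_in_S)
    define v where "v = s \<circ> w"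
    have v: "v \<in> W n" using S_comp_W[OF s] less.prems v_def by simp
    have w: "w = s \<circ> v" using v_def S_cancel(1)[OF s] by simp
    have vw: "len n v < len n w" using len_simple_comp_less_iff[OF less.prems k(1,2)] k v_def s_def by simp
    have vw': "len n v < len n (s \<circ> v)" using vw w by simp
    let ?C = "kl_basis n"
    have C: "kl_strong n z (?C z)" if "z \<in> W n" "len n z < len n w" for z
      using less.hyps that by blast
    note Cv = C[OF v vw]
    define d where "d = kl_mult n s (?C v)"
    note dc = kl_mult_const_coeff[OF Cv v s vw', folded d_def w]
    have d0: "d z = 0" if "z \<notin> W n" for z
      using kl_mult_carrier[OF kl_strongD(1)[OF Cv], of s] that by (auto simp: d_def hecke_carrier_def)
    define m where "m z = Poly_Mapping.lookup (d z) 0" for z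
    define U where "U = {u \<in> W n. u \<noteq> w \<and> m u \<noteq> 0}"
    have finU: "finite U" by (simp add: U_def)
    \<comment> \<open>An unwanted constant term at \<open>u\<close> comes from a nonzero
      \<open>q^1\<close>-coefficient of \<open>C_v\<close> at \<open>u\<close>. So \<open>u\<close>
      lies below \<open>v\<close>, and \<open>C_u\<close> is available by induction.\<close>
    have Uv: "bruhat_less n u v" if "u \<in> U" for u
    proof -
      have u: "u \<in> W n" "u \<noteq> w" "m u \<noteq> 0" using that by (auto simp: U_def)
      then have du: "len n (s \<circ> u) < len n u" "Poly_Mapping.lookup (?C v u) 1 \<noteq> 0"
        using dc(2)[OF u(1)] by (auto simp: m_def split: if_splits)
      from du(2) have "?C v u \<noteq> 0" by auto
      moreover from du(1) have "u \<noteq> v" using vw' by auto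
      ultimately show ?thesis using kl_strongD(5)[OF Cv, of u] by blast
    qed
    have UC: "kl_strong n u (?C u)" if "u \<in> U" for u
      using C[of u] Uv[OF that] bruhat_less_imp[of n u v] vw by auto
    have v_w: "bruhat_less n v w" using bruhat_less_S_comp[OF v s vw'] w by simp
    define e where "e = (\<lambda>x. d x - 1 * (\<Sum>u\<in>U. Poly_Mapping.single 0 (m u) * ?C u x))"
    have U_sum: "(\<Sum>u\<in>U. Poly_Mapping.single 0 (m u) * ?C u x) \<noteq> 0 \<Longrightarrow> \<exists>u\<in>U. ?C u x \<noteq> 0" for x
      by (metis (no_types, lifting) mult_zero_right sum.neutral)
    have supp_U: "bruhat_less n x v" if "u \<in> U" "?C u x \<noteq> 0" for u x
      using kl_strongD(5)[OF UC[OF that(1)], of x] that Uv[OF that(1)] bruhat_less_trans by metis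
    have "e \<in> hecke_carrier n" unfolding e_def hecke_carrier_def
      using d0 kl_strongD(1)[OF UC] by (auto simp: hecke_carrier_def)
    moreover have "hecke_bar n e = e"
    proof -
      have "hecke_bar n d = d" unfolding d_def
        by (rule hecke_bar_kl_mult[OF s kl_strongD(1,2)[OF Cv]])
      then show ?thesis unfolding e_def hecke_bar_diff hecke_bar_sum[OF finU]
        by (simp add: laurent_bar_single kl_strongD(2)[OF UC])
    qed
    moreover have "e w = 1"
    proof -
      have "?C u w = 0" if "u \<in> U" for u
        using supp_U[OF that, of w] bruhat_less_imp(3)[of n w v] vw by fastforce
      moreover have "?C v w = 0"
        using kl_strongD(5)[OF Cv, of w] bruhat_less_imp(3)[of n w v] vw by fastforce
      moreover have "s \<circ> w = v" using v_def by simp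
      ultimately show ?thesis
        unfolding e_def d_def kl_mult_apply[OF less.prems] using vw kl_strongD(3)[OF Cv] by simp
    qed
    moreover have "bruhat_less n x w" if x: "x \<noteq> w" "e x \<noteq> 0" for x
    proof -
      have "d x \<noteq> 0 \<or> (\<exists>u\<in>U. ?C u x \<noteq> 0)" using x(2) U_sum[of x] by (auto simp: e_def)
      then show ?thesis
      proof
        assume dx: "d x \<noteq> 0"
        then have xW: "x \<in> W n" using d0 by blast
        then have "?C v (s \<circ> x) \<noteq> 0 \<or> ?C v x \<noteq> 0" using dx unfolding d_def kl_mult_apply[OF xW]
          by (auto split: if_splits)
        then show ?thesis
        proof
          assume a: "?C v (s \<circ> x) \<noteq> 0"
          have "s \<circ> x \<noteq> v" using x(1) w S_comp_eq_iff[OF s, of x v] by metis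
          then have "bruhat_less n (s \<circ> x) v" using kl_strongD(5)[OF Cv, of "s \<circ> x"] a by metis
          from bruhat_less_lift[OF this s vw'] show ?thesis using w S_cancel(1)[OF s, of x] by simp
        next
          assume "?C v x \<noteq> 0"
          then show ?thesis using kl_strongD(5)[OF Cv, of x] v_w bruhat_less_trans by metis
        qed
      next
        assume "\<exists>u\<in>U. ?C u x \<noteq> 0"
        then show ?thesis using supp_U v_w bruhat_less_trans by metis
      qed
    qed
    moreover have "pos_poly (e x)" if x: "x \<noteq> w" for x
    proof (cases "x \<in> W n")
      case True
      have "nonneg_poly (e x)" unfolding e_def mult_1
        by (intro nonneg_poly_diff nonneg_poly_sum nonneg_poly_const_mult dc(1)[OF True] kl_strongD(6)[OF UC])
      moreover have "Poly_Mapping.lookup (e x) 0 = m x - (\<Sum>u\<in>U. if x = u then m u else 0)"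
        unfolding e_def by (simp add: lookup_minus lookup_sum lookup_single_mult m_def kl_strongD(7)[OF UC] if_distrib cong: sum.cong if_cong)
      moreover have "\<dots> = 0" using finU x True by (auto simp: U_def)
      ultimately show ?thesis by (simp add: pos_poly_iff)
    next
      case False then show ?thesis using \<open>e \<in> hecke_carrier n\<close> by (simp add: hecke_carrier_def)
    qed
    ultimately have "kl_strong n w e" by (simp add: kl_strong_def kl_element_def)
    then show ?thesis using kl_basis_eqI by metis
  qed
qed

lemmas kl_basis_props = kl_strongD[OF kl_strong_kl_basis]

lemma kl_basis_len: "w \<in> W n \<Longrightarrow> kl_basis n w z \<noteq> 0 \<Longrightarrow> z = w \<or> len n z < len n w"
  using kl_basis_props(5)[of w n z] bruhat_less_imp(3)[of n z w] by blast

text \<open>Since \<open>C_z\<close> has its only constant term at \<open>z\<close>, subtracting the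
  displayed combination leaves a bar-invariant element with positive exponents only, which
  vanishes.\<close>

lemma bar_invariant_expand:
  assumes h: "h \<in> hecke_carrier n" "hecke_bar n h = h" "\<And>y. y \<in> W n \<Longrightarrow> nonneg_poly (h y)"
  shows "h = (\<lambda>x. \<Sum>z\<in>W n. Poly_Mapping.single 0 (Poly_Mapping.lookup (h z) 0) * kl_basis n z x)"
proof -
  let ?k = "\<lambda>x. h x - 1 * (\<Sum>z\<in>W n. Poly_Mapping.single 0 (Poly_Mapping.lookup (h z) 0) * kl_basis n z x)"
  have c: "?k \<in> hecke_carrier n"
    using h(1) kl_basis_props(1) by (auto simp: hecke_carrier_def)
  have "?k = (\<lambda>v. 0)"
  proof (rule bar_invariant_pos_zero[OF c])
    show "hecke_bar n ?k = ?k" unfolding hecke_bar_diff hecke_bar_sum[OF finite_W]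
      by (simp add: laurent_bar_single kl_basis_props(2) h(2))
    fix x show "pos_poly (?k x)"
    proof (cases "x \<in> W n")
      case True
      have "nonneg_poly (?k x)" unfolding mult_1
        by (intro nonneg_poly_diff nonneg_poly_sum nonneg_poly_const_mult h(3)[OF True] kl_basis_props(6))
      moreover have "Poly_Mapping.lookup (?k x) 0 = 0"
        using True by (simp add: lookup_minus lookup_sum lookup_single_mult kl_basis_props(7) if_distrib cong: sum.cong if_cong)
      ultimately show ?thesis by (simp add: pos_poly_iff)
    next
      case False then show ?thesis using c by (simp add: hecke_carrier_def)
    qed
  qed
  note k0 = this
  show ?thesis
  proof
    fix x
    have "?k x = 0" using fun_cong[OF k0] .
    then show "h x = (\<Sum>z\<in>W n. Poly_Mapping.single 0 (Poly_Mapping.lookup (h z) 0) * kl_basis n z x)"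
      by (simp only: mult_1 right_minus_eq)
  qed
qed

lemma kl_basis_independent:
  assumes "\<And>x. x \<in> W n \<Longrightarrow> (\<Sum>z\<in>W n. a z * kl_basis n z x) = 0" "z \<in> W n"
  shows "a z = 0"
proof (rule ccontr)
  assume "a z \<noteq> 0"
  then obtain y where y: "y \<in> W n" "a y \<noteq> 0" "\<And>z. z \<in> W n \<Longrightarrow> a z \<noteq> 0 \<Longrightarrow> len n z \<le> len n y"
    using exists_longest_support[of z n a] assms(2) by blast
  have "(\<Sum>z\<in>W n. a z * kl_basis n z y) = (\<Sum>z\<in>W n. if z = y then a y else 0)"
  proof (rule sum.cong)
    fix z assume z: "z \<in> W n"
    show "a z * kl_basis n z y = (if z = y then a y else 0)"
    proof (cases "z = y")
      case True then show ?thesis using kl_basis_props(3)[OF y(1)] by simp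
    next
      case False
      then have "a z = 0 \<or> kl_basis n z y = 0" using y(3)[OF z] kl_basis_len[OF z, of y] by fastforce
      then show ?thesis using False by auto
    qed
  qed simp
  then show False using assms(1)[OF y(1)] y(1,2) by simp
qed

lemma kl_basis_coeff_unique:
  assumes "\<And>x. x \<in> W n \<Longrightarrow> (\<Sum>z\<in>W n. a z * kl_basis n z x) = (\<Sum>z\<in>W n. b z * kl_basis n z x)" "z \<in> W n"
  shows "a z = b z"
  using kl_basis_independent[of n "\<lambda>z. a z - b z" z] assms by (simp add: left_diff_distrib sum_subtractf)

section \<open>Multiplication formulas\<close>

text \<open>The linear coefficient with the sign of this normalisation, so that it is -1 where
  Kazhdan and Lusztig have 1 for \<open>w = z s > z\<close>. It is not symmetrised: it vanishes
  unless \<open>z\<close> is below \<open>w\<close>.\<close>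

definition kl_mu :: "nat \<Rightarrow> (nat \<Rightarrow> nat) \<Rightarrow> (nat \<Rightarrow> nat) \<Rightarrow> int" where
  "kl_mu n z w = Poly_Mapping.lookup (kl_basis n w z) 1"

text \<open>The coefficient of \<open>C\<^sub>z\<close> in \<open>T\<^sub>s C\<^sub>w\<close>.\<close>

definition left_coeff :: "nat \<Rightarrow> (nat \<Rightarrow> nat) \<Rightarrow> (nat \<Rightarrow> nat) \<Rightarrow> (nat \<Rightarrow> nat) \<Rightarrow> laurent" where
  "left_coeff n s w z =
    (if len n (s \<circ> w) < len n w then if z = w then - q_inv else 0
     else (if z = w then q else 0) + (if len n (s \<circ> z) < len n z
       then Poly_Mapping.single 0 (if z = s \<circ> w then 1 else - kl_mu n z w) else 0))"

definition right_coeff :: "nat \<Rightarrow> (nat \<Rightarrow> nat) \<Rightarrow> (nat \<Rightarrow> nat) \<Rightarrow> (nat \<Rightarrow> nat) \<Rightarrow> laurent" where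
  "right_coeff n s w z =
    (if len n (w \<circ> s) < len n w then if z = w then - q_inv else 0
     else (if z = w then q else 0) + (if len n (z \<circ> s) < len n z
       then Poly_Mapping.single 0 (if z = w \<circ> s then 1 else - kl_mu n z w) else 0))"

lemma kl_mult_kl_basis:
  assumes s: "s \<in> S n" and w: "w \<in> W n" and up: "len n w < len n (s \<circ> w)"
  shows "kl_mult n s (kl_basis n w) = (\<lambda>x. \<Sum>z\<in>W n. (if len n (s \<circ> z) < len n z
       then Poly_Mapping.single 0 (if z = s \<circ> w then 1 else - kl_mu n z w) else 0) * kl_basis n z x)"
proof -
  let ?d = "kl_mult n s (kl_basis n w)"
  note c = kl_strong_kl_basis[OF w]
  have "?d = (\<lambda>x. \<Sum>z\<in>W n. Poly_Mapping.single 0 (Poly_Mapping.lookup (?d z) 0) * kl_basis n z x)"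
    using kl_mult_const_coeff(1)[OF c w s up] kl_basis_props(1,2)[OF w] hecke_bar_kl_mult[OF s]
    by (intro bar_invariant_expand) auto
  also have "\<dots> = (\<lambda>x. \<Sum>z\<in>W n. (if len n (s \<circ> z) < len n z
       then Poly_Mapping.single 0 (if z = s \<circ> w then 1 else - kl_mu n z w) else 0) * kl_basis n z x)"
    by (intro ext sum.cong) (simp_all add: kl_mult_const_coeff(2)[OF c w s up] kl_mu_def)
  finally show ?thesis .
qed

text \<open>By the quadratic relation \<open>T_s + q^-1\<close> kills the image of
  \<open>T_s - q\<close>, in particular \<open>C_s C_v\<close> for \<open>w = s v\<close>. All other
  basis elements in the expansion of \<open>C_s C_v\<close> have the left descent \<open>s\<close>
  and are shorter than \<open>w\<close>, so they are killed by induction; hence \<open>C_w\<close>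
  is killed too.\<close>

lemma left_mult_kl_basis_down:
  assumes "s \<in> S n" "w \<in> W n" "len n (s \<circ> w) < len n w"
  shows "hecke_gen_mult n s (kl_basis n w) = (\<lambda>x. - q_inv * kl_basis n w x)"
  using assms
proof (induction "len n w" arbitrary: w rule: less_induct)
  case less
  note s = less.prems(1)
  define v where "v = s \<circ> w"
  have v: "v \<in> W n" using S_comp_W[OF s] less.prems v_def by simp
  have w: "w = s \<circ> v" using v_def S_cancel(1)[OF s] by simp
  have up: "len n v < len n (s \<circ> v)"
    using less.prems(3) by (simp only: v_def[symmetric] w[symmetric])
  let ?C = "kl_basis n"
  define m where "m z = (if len n (s \<circ> z) < len n z
       then Poly_Mapping.single 0 (if z = s \<circ> v then 1 else - kl_mu n z v) else (0::laurent))" for z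
  have d: "kl_mult n s (?C v) = (\<lambda>x. \<Sum>z\<in>W n. m z * ?C z x)"
    unfolding m_def by (rule kl_mult_kl_basis[OF s v up])
  define G where "G h = (\<lambda>x. hecke_gen_mult n s h x + q_inv * h x)" for h
  have linG: "linear_op G" unfolding linear_op_def G_def linear_opD[OF linear_op_left_mult]
    by (simp add: algebra_simps)
  have "G (kl_mult n s (?C v)) x = 0" for x
  proof -
    have e: "hecke_gen_mult n s (kl_mult n s (?C v)) x =
      (?C v x + v_diff * hecke_gen_mult n s (?C v) x) - q * hecke_gen_mult n s (?C v) x"
      unfolding kl_mult_def linear_op_diff[OF linear_op_left_mult]
        left_mult_left_mult[OF s kl_basis_props(1)[OF v]] ..
    have "q_inv * (q * ?C v x) = ?C v x" by (simp flip: mult.assoc)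
    then show ?thesis unfolding G_def e unfolding kl_mult_def by (simp add: algebra_simps)
  qed
  then have "(\<Sum>z\<in>W n. m z * G (?C z) x) = 0" for x
    unfolding d linear_op_sum[OF linG finite_W] by simp
  moreover have "(\<Sum>z\<in>W n. m z * G (?C z) x) = (\<Sum>z\<in>W n. if z = w then G (?C w) x else 0)" for x
  proof (rule sum.cong)
    fix z assume z: "z \<in> W n"
    show "m z * G (?C z) x = (if z = w then G (?C w) x else 0)"
    proof (cases "z = w")
      case True
      then show ?thesis using less.prems(3) by (simp add: m_def w[symmetric])
    next
      case False
      show ?thesis
      proof (cases "m z = 0")
        case mz: False
        then have dz: "len n (s \<circ> z) < len n z" and "kl_mu n z v \<noteq> 0"
          using False by (auto simp: m_def w[symmetric] split: if_splits)
        then have "?C v z \<noteq> 0" by (auto simp: kl_mu_def)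
        then have "len n z < len n w" using kl_basis_len[OF v, of z] up unfolding w[symmetric] by auto
        then have "G (?C z) x = 0" unfolding G_def using less.hyps[OF _ s z dz] by simp
        then show ?thesis using False by simp
      qed (use False in simp)
    qed
  qed simp
  ultimately have "G (?C w) x = 0" for x using less.prems(2) by simp
  then have "hecke_gen_mult n s (?C w) x = - q_inv * ?C w x" for x
    unfolding G_def by (simp add: eq_neg_iff_add_eq_0)
  then show ?case by blast
qed

lemma left_mult_kl_basis:
  assumes s: "s \<in> S n" and w: "w \<in> W n"
  shows "hecke_gen_mult n s (kl_basis n w) = (\<lambda>x. \<Sum>z\<in>W n. left_coeff n s w z * kl_basis n z x)"
proof (cases "len n (s \<circ> w) < len n w")
  case True
  have "(\<Sum>z\<in>W n. left_coeff n s w z * kl_basis n z x) = (\<Sum>z\<in>W n. if z = w then - q_inv * kl_basis n w x else 0)" for x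
    using True by (intro sum.cong) (simp_all add: left_coeff_def)
  then show ?thesis using left_mult_kl_basis_down[OF s w True] w by simp
next
  case False
  then have up: "len n w < len n (s \<circ> w)" using len_S_comp[OF w s] by auto
  have "left_coeff n s w z * kl_basis n z x = (if z = w then q * kl_basis n w x else 0) +
      (if len n (s \<circ> z) < len n z
       then Poly_Mapping.single 0 (if z = s \<circ> w then 1 else - kl_mu n z w) else 0) * kl_basis n z x" for z x
    using False by (simp add: left_coeff_def algebra_simps)
  then have "(\<Sum>z\<in>W n. left_coeff n s w z * kl_basis n z x) = q * kl_basis n w x + kl_mult n s (kl_basis n w) x" for x
    unfolding kl_mult_kl_basis[OF s w up] using w by (simp add: sum.distrib)
  then show ?thesis unfolding kl_mult_def by simp
qed

text \<open>\<open>flat\<close> commutes with the bar involution and only permutes coefficients, so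
  it carries the characterisation of \<open>C_w\<close> to that of the inverse. All right-handed
  formulas are derived from the left-handed ones in this way.\<close>

lemma kl_basis_inv:
  assumes w: "w \<in> W n" shows "kl_basis n (inv w) = flat n (kl_basis n w)"
proof (rule kl_element_unique)
  show "kl_element n (inv w) (kl_basis n (inv w))"
    using kl_strong_kl_basis[OF W_inv[OF w]] by (simp add: kl_strong_def)
  have "pos_poly (flat n (kl_basis n w) y)" if "y \<noteq> inv w" for y
  proof (cases "y \<in> W n")
    case True
    then have "inv y \<noteq> w" using that W_inv_inv[OF True] by metis
    then show ?thesis using kl_basis_props(4)[OF w, of "inv y"] True by (simp add: flat_def)
  qed (simp add: flat_def)
  then show "kl_element n (inv w) (flat n (kl_basis n w))"
    using kl_basis_props(2,3)[OF w] W_inv[OF w] W_inv_inv[OF w]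
    by (simp add: kl_element_def hecke_bar_flat) (simp add: flat_def)
qed

lemma kl_mu_inv: "w \<in> W n \<Longrightarrow> z \<in> W n \<Longrightarrow> kl_mu n (inv z) (inv w) = kl_mu n z w"
  by (simp add: kl_mu_def kl_basis_inv) (simp add: flat_def W_inv)

lemma left_coeff_inv:
  assumes s: "s \<in> S n" and w: "w \<in> W n" and z: "z \<in> W n"
  shows "left_coeff n s (inv w) (inv z) = right_coeff n s w z"
proof -
  have eq: "inv z = inv w \<longleftrightarrow> z = w" using W_inv_inv[OF w] W_inv_inv[OF z] by metis
  have ws: "w \<circ> s \<in> W n" "z \<circ> s \<in> W n" using W_comp_S[OF s] w z by auto
  have eq2: "inv z = inv (w \<circ> s) \<longleftrightarrow> z = w \<circ> s" using W_inv_inv[OF ws(1)] W_inv_inv[OF z] by metis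
  show ?thesis unfolding left_coeff_def right_coeff_def S_comp_inv[OF s w] S_comp_inv[OF s z]
    len_inv[OF w] len_inv[OF z] len_inv[OF ws(1)] len_inv[OF ws(2)] eq eq2 kl_mu_inv[OF w z] ..
qed

lemma right_mult_kl_basis:
  assumes s: "s \<in> S n" and w: "w \<in> W n"
  shows "right_mult n s (kl_basis n w) = (\<lambda>x. \<Sum>z\<in>W n. right_coeff n s w z * kl_basis n z x)"
proof -
  have "right_mult n s (kl_basis n w) = flat n (hecke_gen_mult n s (kl_basis n (inv w)))"
    unfolding right_mult_flat[OF s] kl_basis_inv[OF w] ..
  also have "\<dots> = (\<lambda>x. \<Sum>z\<in>W n. left_coeff n s (inv w) z * flat n (kl_basis n z) x)"
    unfolding left_mult_kl_basis[OF s W_inv[OF w]] linear_op_sum[OF linear_op_flat finite_W] ..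
  also have "\<dots> = (\<lambda>x. \<Sum>z\<in>W n. left_coeff n s (inv w) (inv z) * flat n (kl_basis n (inv z)) x)"
    by (rule ext) (rule sum.reindex_bij_betw[OF bij_betw_W_inv, symmetric])
  also have "\<dots> = (\<lambda>x. \<Sum>z\<in>W n. right_coeff n s w z * kl_basis n z x)"
    by (intro ext sum.cong) (simp_all add: left_coeff_inv[OF s w] kl_basis_inv flat_flat kl_basis_props(1))
  finally show ?thesis .
qed

text \<open>Since \<open>C_w T_s = - q^-1 C_w\<close>, the coefficient at \<open>z\<close> gives
  \<open>C_w(z s) = - q^-1 C_w(z)\<close>. In degree zero the left side is known: it is 1 if
  \<open>z s = w\<close> and 0 otherwise.\<close>

lemma kl_mu_right_descent:
  assumes s: "s \<in> S n" and z: "z \<in> W n" and w: "w \<in> W n"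
    and "len n z < len n (z \<circ> s)" "len n (w \<circ> s) < len n w"
  shows "kl_mu n z w = (if z \<circ> s = w then - 1 else 0)"
proof -
  have "right_mult n s (kl_basis n w) z = - q_inv * kl_basis n w z"
  proof -
    have "(\<Sum>y\<in>W n. right_coeff n s w y * kl_basis n y z) = (\<Sum>y\<in>W n. if y = w then - q_inv * kl_basis n w z else 0)"
      using assms(5) by (intro sum.cong) (simp_all add: right_coeff_def)
    then show ?thesis using right_mult_kl_basis[OF s w] w by simp
  qed
  moreover have "right_mult n s (kl_basis n w) z = kl_basis n w (z \<circ> s)"
    using z assms(4) by (simp add: right_mult_def)
  ultimately have "Poly_Mapping.lookup (kl_basis n w (z \<circ> s)) 0 = - Poly_Mapping.lookup (kl_basis n w z) 1"
    by simp
  then show ?thesis unfolding kl_basis_props(7)[OF w] kl_mu_def by (auto split: if_splits)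
qed

lemma kl_occurs_iff:
  assumes s: "s \<in> S n" and w: "w \<in> W n" and x: "x \<in> W n"
  shows "kl_occurs n x (hecke_mult n (T s) (kl_basis n w)) \<longleftrightarrow> left_coeff n s w x \<noteq> 0"
proof -
  have e: "hecke_mult n (T s) (kl_basis n w) = (\<lambda>v. \<Sum>z\<in>W n. left_coeff n s w z * kl_basis n z v)"
    using hecke_mult_T_S[OF s kl_basis_props(1)[OF w]] left_mult_kl_basis[OF s w] by simp
  show ?thesis
  proof
    assume "kl_occurs n x (hecke_mult n (T s) (kl_basis n w))"
    then obtain a where a: "(\<lambda>v. \<Sum>z\<in>W n. left_coeff n s w z * kl_basis n z v) = (\<lambda>v. \<Sum>z\<in>W n. a z * kl_basis n z v)"
      "a x \<noteq> 0" unfolding kl_occurs_def e by blast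
    have "left_coeff n s w x = a x"
      by (rule kl_basis_coeff_unique[OF _ x]) (use fun_cong[OF a(1)] in simp)
    then show "left_coeff n s w x \<noteq> 0" using a(2) by simp
  next
    assume "left_coeff n s w x \<noteq> 0"
    then show "kl_occurs n x (hecke_mult n (T s) (kl_basis n w))" unfolding kl_occurs_def e by blast
  qed
qed

text \<open>Associativity \<open>T\<^sub>u (C\<^sub>y T\<^sub>t) = (T\<^sub>u C\<^sub>y) T\<^sub>t\<close> in terms of structure constants.\<close>

lemma left_right_coeff:
  assumes u: "u \<in> S n" and t: "t \<in> S n" and y: "y \<in> W n" and x: "x \<in> W n"
  shows "(\<Sum>z\<in>W n. right_coeff n t y z * left_coeff n u z x) =
    (\<Sum>z\<in>W n. left_coeff n u y z * right_coeff n t z x)"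
proof (rule kl_basis_coeff_unique[OF _ x])
  fix v assume "v \<in> W n"
  have "(\<Sum>x\<in>W n. (\<Sum>z\<in>W n. right_coeff n t y z * left_coeff n u z x) * kl_basis n x v) =
    (\<Sum>z\<in>W n. right_coeff n t y z * hecke_gen_mult n u (kl_basis n z) v)"
    by (simp add: left_mult_kl_basis[OF u] sum_distrib_left sum_distrib_right mult.assoc cong: sum.cong)
      (rule sum.swap)
  also have "\<dots> = hecke_gen_mult n u (right_mult n t (kl_basis n y)) v"
    unfolding right_mult_kl_basis[OF t y] linear_op_sum[OF linear_op_left_mult finite_W] ..
  also have "\<dots> = right_mult n t (hecke_gen_mult n u (kl_basis n y)) v"
    unfolding left_right_mult_commute[OF u t] ..
  also have "\<dots> = (\<Sum>z\<in>W n. left_coeff n u y z * right_mult n t (kl_basis n z) v)"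
    unfolding left_mult_kl_basis[OF u y] linear_op_sum[OF linear_op_right_mult finite_W] ..
  also have "\<dots> = (\<Sum>x\<in>W n. (\<Sum>z\<in>W n. left_coeff n u y z * right_coeff n t z x) * kl_basis n x v)"
    by (simp add: right_mult_kl_basis[OF t] sum_distrib_left sum_distrib_right mult.assoc cong: sum.cong)
      (rule sum.swap)
  finally show "(\<Sum>x\<in>W n. (\<Sum>z\<in>W n. right_coeff n t y z * left_coeff n u z x) * kl_basis n x v) =
    (\<Sum>x\<in>W n. (\<Sum>z\<in>W n. left_coeff n u y z * right_coeff n t z x) * kl_basis n x v)" .
qed

section \<open>Left cells\<close>

definition left_edge :: "nat \<Rightarrow> (nat \<Rightarrow> nat) \<Rightarrow> (nat \<Rightarrow> nat) \<Rightarrow> bool" where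
  "left_edge n x y \<longleftrightarrow> x \<in> W n \<and> y \<in> W n \<and> (\<exists>u\<in>S n. left_coeff n u y x \<noteq> 0)"

lemma left_cell_le_eq: "left_cell_le n = (left_edge n)\<^sup>*\<^sup>*"
proof -
  have "(\<lambda>x y. x \<in> W n \<and> y \<in> W n \<and> (\<exists>s\<in>S n. kl_occurs n x (hecke_mult n (T s) (kl_basis n y)))) = left_edge n"
    by (intro ext) (auto simp: left_edge_def kl_occurs_iff)
  then show ?thesis unfolding left_cell_le_def by simp
qed

definition right_desc :: "(nat \<Rightarrow> nat) \<Rightarrow> nat \<Rightarrow> bool" where
  "right_desc w j \<longleftrightarrow> w (j + 1) < w j"

lemma right_desc_iff: "w \<in> W n \<Longrightarrow> 1 \<le> j \<Longrightarrow> j < n \<Longrightarrow> len n (w \<circ> simple j) < len n w \<longleftrightarrow> right_desc w j"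
  unfolding right_desc_def by (rule len_comp_simple_less_iff)

lemma not_right_desc_iff:
  assumes "w \<in> W n" "1 \<le> j" "j < n" shows "len n w < len n (w \<circ> simple j) \<longleftrightarrow> \<not> right_desc w j"
  using len_comp_S[OF assms(1), of "simple j"] right_desc_iff[OF assms] assms(2,3) by (auto simp: simple_in_S)

lemma q_add_q_inv_nonzero: "q + q_inv \<noteq> 0"
proof
  assume "q + q_inv = 0"
  then have "Poly_Mapping.lookup (q + q_inv) 1 = 0" by simp
  then show False by (simp add: q_def q_inv_def lookup_add lookup_single)
qed

text \<open>Compare the two sides of \<open>left_right_coeff\<close> for \<open>t = s_j\<close>. If
  \<open>j\<close> is a descent of \<open>y\<close> but not of \<open>x\<close>, one side scales
  \<open>left_coeff n u y x\<close> by \<open>- q^-1\<close>; on the other side \<open>C_x\<close>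
  can arise only from \<open>C_x\<close> itself, with factor \<open>q\<close>. There are no zero
  divisors among Laurent polynomials, so the coefficient would vanish.\<close>

lemma right_desc_mono:
  assumes x: "x \<in> W n" and y: "y \<in> W n" and u: "u \<in> S n" and ne: "left_coeff n u y x \<noteq> 0"
    and j: "1 \<le> j" "j < n" and d: "right_desc y j"
  shows "right_desc x j"
proof (rule ccontr)
  assume nd: "\<not> right_desc x j"
  let ?t = "simple j"
  have t: "?t \<in> S n" using j by (simp add: simple_in_S)
  have dy: "len n (y \<circ> ?t) < len n y" and dx: "\<not> len n (x \<circ> ?t) < len n x"
    using right_desc_iff[OF y j] right_desc_iff[OF x j] d nd by auto
  have "(\<Sum>z\<in>W n. right_coeff n ?t y z * left_coeff n u z x) =
    (\<Sum>z\<in>W n. if z = y then - q_inv * left_coeff n u y x else 0)"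
    using dy by (intro sum.cong) (auto simp: right_coeff_def)
  moreover have "(\<Sum>z\<in>W n. left_coeff n u y z * right_coeff n ?t z x) =
    (\<Sum>z\<in>W n. if z = x then q * left_coeff n u y x else 0)"
    using dx by (intro sum.cong) (auto simp: right_coeff_def)
  ultimately have "q * left_coeff n u y x = - q_inv * left_coeff n u y x"
    using left_right_coeff[OF u t y x] x y by simp
  then have "(q + q_inv) * left_coeff n u y x = 0" by (simp add: distrib_right)
  then show False using ne q_add_q_inv_nonzero by simp
qed

text \<open>The right star operation for the pair \<open>s\<^sub>i\<close>, \<open>s\<^sub>i\<^sub>+\<^sub>1\<close>; on the word \<open>w(1) \<dots> w(n)\<close> it is an elementary Knuth
  move.\<close>

definition star_domain :: "nat \<Rightarrow> (nat \<Rightarrow> nat) \<Rightarrow> bool" where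
  "star_domain i w \<longleftrightarrow> right_desc w i \<and> \<not> right_desc w (i + 1)"

definition star :: "nat \<Rightarrow> (nat \<Rightarrow> nat) \<Rightarrow> nat \<Rightarrow> nat" where
  "star i w = (if w i < w (i + 2) then w \<circ> simple (i + 1) else w \<circ> simple i)"

lemma star_W: "w \<in> W n \<Longrightarrow> 1 \<le> i \<Longrightarrow> i + 2 \<le> n \<Longrightarrow> star i w \<in> W n"
  by (simp add: star_def W_comp simple_W)

lemma star_domain_order:
  assumes "w \<in> W n" "star_domain i w"
  shows "w (i + 1) < w i" "w (i + 1) < w (i + 2)" "w i \<noteq> w (i + 2)"
  using assms W_inj[OF assms(1), of "i + 1" "i + 2"] W_inj[OF assms(1), of i "i + 2"]
  by (auto simp: star_domain_def right_desc_def)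

lemma star_apply:
  "star i w i = (if w i < w (i + 2) then w i else w (i + 1))"
  "star i w (i + 1) = (if w i < w (i + 2) then w (i + 2) else w i)"
  "star i w (i + 2) = (if w i < w (i + 2) then w (i + 1) else w (i + 2))"
  by (simp_all add: star_def simple_apply)

lemma star_apply_other: "j < i \<or> i + 2 < j \<Longrightarrow> star i w j = w j"
  by (auto simp: star_def simple_apply)

lemma star_desc:
  assumes "w \<in> W n" "star_domain i w"
  shows "\<not> right_desc (star i w) i" "right_desc (star i w) (i + 1)"
  using star_domain_order[OF assms] star_apply[of i w] by (auto simp: right_desc_def)

text \<open>The case of the definition can be recovered from the result: the smallest of the three
  entries ends at position \<open>i + 2\<close> in the first case and at \<open>i\<close> in the
  second.\<close>

lemma star_inject:
  assumes x: "x \<in> W n" "star_domain i x" and y: "y \<in> W n" "star_domain i y" and eq: "star i x = star i y"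
  shows "x = y"
proof
  fix j
  note ox = star_domain_order[OF x] and oy = star_domain_order[OF y]
  have e: "star i x i = star i y i" "star i x (i+1) = star i y (i+1)" "star i x (i+2) = star i y (i+2)"
    "star i x j = star i y j" using eq by simp_all
  note e' = e(1-3)[unfolded star_apply]
  have lt: "x i < x (i + 2) \<longleftrightarrow> y i < y (i + 2)"
    using e' ox oy by (auto split: if_splits)
  consider "j = i" | "j = i + 1" | "j = i + 2" | "j < i \<or> i + 2 < j" by linarith
  then show "x j = y j"
  proof cases
    case 4 then show ?thesis using e(4) star_apply_other by metis
  qed (use e' lt in \<open>auto split: if_splits\<close>)
qed

text \<open>As \<open>i\<close> is a descent of \<open>y\<close> but not of \<open>z\<close>,
  \<open>kl_mu n z y\<close> is nonzero only for \<open>z = y s_i\<close>, where it is -1. So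
  \<open>z\<close> is \<open>y s_i\<close> or \<open>y s_{i+1}\<close>, both with coefficient 1, and
  the descents required of \<open>z\<close> admit only the one that is
  \<open>star i y\<close>.\<close>

lemma right_coeff_star:
  assumes i: "1 \<le> i" "i + 2 \<le> n" and y: "y \<in> W n" "star_domain i y"
    and z: "z \<in> W n" "right_desc z (i + 1)" "\<not> right_desc z i"
  shows "right_coeff n (simple (i + 1)) y z = (if z = star i y then 1 else 0)"
proof -
  let ?s = "simple i" and ?t = "simple (i + 1)"
  have s: "?s \<in> S n" and t: "?t \<in> S n" using i by (auto simp: simple_in_S)
  have dy: "len n (y \<circ> ?s) < len n y" "\<not> len n (y \<circ> ?t) < len n y"
    using right_desc_iff[of y n i] right_desc_iff[of y n "i+1"] y i by (auto simp: star_domain_def)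
  have dz: "len n z < len n (z \<circ> ?s)" "len n (z \<circ> ?t) < len n z"
    using not_right_desc_iff[of z n i] right_desc_iff[of z n "i+1"] z i by auto
  have zy: "z \<noteq> y" using y z by (auto simp: star_domain_def)
  have mu: "kl_mu n z y = (if z \<circ> ?s = y then - 1 else 0)"
    by (rule kl_mu_right_descent[OF s z(1) y(1) dz(1) dy(1)])
  have e: "z \<circ> ?s = y \<longleftrightarrow> z = y \<circ> ?s" by (rule comp_S_eq_iff[OF s])
  note o = star_domain_order[OF y]
  have "z \<noteq> y \<circ> ?s" if "y i < y (i + 2)"
  proof
    assume "z = y \<circ> ?s"
    then have "z (i + 1) = y i" "z (i + 2) = y (i + 2)" by (simp_all add: simple_apply)
    then show False using z(2) that by (simp add: right_desc_def)
  qed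
  moreover have "z \<noteq> y \<circ> ?t" if "\<not> y i < y (i + 2)"
  proof
    assume "z = y \<circ> ?t"
    then have "z i = y i" "z (i + 1) = y (i + 2)" by (simp_all add: simple_apply)
    then show False using z(3) that o by (simp add: right_desc_def)
  qed
  ultimately show ?thesis
    using zy dy(2) dz(2) unfolding right_coeff_def mu e star_def by simp
qed

text \<open>Modulo the span of the \<open>C\<^sub>z\<close> with both \<open>s\<^sub>i\<close>, \<open>s\<^sub>i\<^sub>+\<^sub>1\<close> right descents, right multiplication by
  \<open>T\<^sub>s\<^sub>i\<^sub>+\<^sub>1 - q\<close> maps \<open>C\<^sub>w\<close> to the basis element of \<^term>\<open>star i w\<close>, and it commutes with left
  multiplication.\<close>

lemma left_coeff_star:
  assumes i: "1 \<le> i" "i + 2 \<le> n" and u: "u \<in> S n"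
    and x: "x \<in> W n" "star_domain i x" and y: "y \<in> W n" "star_domain i y"
  shows "left_coeff n u (star i y) (star i x) = left_coeff n u y x"
proof -
  let ?t = "simple (i + 1)"
  let ?x = "star i x" and ?y = "star i y"
  have t: "?t \<in> S n" using i by (simp add: simple_in_S)
  have j: "1 \<le> i" "i < n" "1 \<le> i + 1" "i + 1 < n" using i by auto
  have xs: "?x \<in> W n" and ys: "?y \<in> W n" using star_W i x y by auto
  note dx = star_desc[OF x] and dy = star_desc[OF y]
  \<comment> \<open>At the coefficient of \<open>star i x\<close> both sums of
    \<open>left_right_coeff\<close> collapse to one term. By \<open>right_desc_mono\<close> a
    contributing \<open>z\<close> in this sum lacks the descent \<open>i\<close>, as
    \<open>star i x\<close> does; in the other sum it has the descent \<open>i\<close>, as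
    \<open>y\<close> does. The descent \<open>i + 1\<close> then decides whether
    \<open>right_coeff_star\<close> applies or the term vanishes directly.\<close>
  have "right_coeff n ?t y z * left_coeff n u z ?x = (if z = ?y then left_coeff n u ?y ?x else 0)"
    if z: "z \<in> W n" for z
  proof (cases "left_coeff n u z ?x = 0")
    case False
    then have nz: "\<not> right_desc z i" using right_desc_mono[OF xs z u False j(1,2)] dx by blast
    show ?thesis
    proof (cases "right_desc z (i + 1)")
      case True then show ?thesis using right_coeff_star[OF i y z True nz] by simp
    next
      case f: False
      have "\<not> len n (z \<circ> ?t) < len n z" using right_desc_iff[OF z j(3,4)] f by simp
      moreover have "\<not> len n (y \<circ> ?t) < len n y"
        using right_desc_iff[OF y(1) j(3,4)] y(2) by (simp add: star_domain_def)
      moreover have "z \<noteq> y" using nz y(2) by (auto simp: star_domain_def)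
      moreover have "z \<noteq> ?y" using f dy by auto
      ultimately show ?thesis by (simp add: right_coeff_def)
    qed
  qed auto
  moreover have "left_coeff n u y z * right_coeff n ?t z ?x = (if z = x then left_coeff n u y x else 0)"
    if z: "z \<in> W n" for z
  proof (cases "left_coeff n u y z = 0")
    case False
    then have dz: "right_desc z i"
      using right_desc_mono[OF z y(1) u False j(1,2)] y(2) by (simp add: star_domain_def)
    show ?thesis
    proof (cases "right_desc z (i + 1)")
      case True
      have "len n (z \<circ> ?t) < len n z" using right_desc_iff[OF z j(3,4)] True by simp
      moreover have "?x \<noteq> z" using dz dx by auto
      moreover have "z \<noteq> x" using True x(2) by (auto simp: star_domain_def)
      ultimately show ?thesis by (simp add: right_coeff_def)
    next
      case f: False
      then have sz: "star_domain i z" using dz by (simp add: star_domain_def)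
      have "?x = star i z \<longleftrightarrow> z = x" using star_inject[OF x z sz] by auto
      then show ?thesis using right_coeff_star[OF i z sz xs dx(2,1)] by simp
    qed
  qed auto
  ultimately show ?thesis using left_right_coeff[OF u t y(1) xs] x(1) ys by (simp cong: sum.cong)
qed

lemma left_cell_le_right_desc:
  assumes "left_cell_le n x y" "1 \<le> j" "j < n" "right_desc y j" shows "right_desc x j"
  using assms(1,4) unfolding left_cell_le_eq
proof (induction rule: converse_rtranclp_induct)
  case (step x z)
  then show ?case using right_desc_mono[of x n z _ j] assms(2,3) unfolding left_edge_def by blast
qed

definition cell_eq :: "nat \<Rightarrow> (nat \<Rightarrow> nat) \<Rightarrow> (nat \<Rightarrow> nat) \<Rightarrow> bool" where
  "cell_eq n x y \<longleftrightarrow> x \<in> W n \<and> y \<in> W n \<and> left_cell_le n x y \<and> left_cell_le n y x"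

lemma cell_eq_right_desc:
  "cell_eq n x y \<Longrightarrow> 1 \<le> j \<Longrightarrow> j < n \<Longrightarrow> right_desc x j \<longleftrightarrow> right_desc y j"
  using left_cell_le_right_desc unfolding cell_eq_def by blast

text \<open>Right descents can only be gained on the way from \<open>y\<close> to \<open>x\<close>.
  The two descent hypotheses at the ends therefore put the whole chain into the star domain, and
  \<open>left_coeff_star\<close> maps it edge by edge.\<close>

lemma left_cell_le_star:
  assumes le: "left_cell_le n x y" and i: "1 \<le> i" "i + 2 \<le> n"
    and dx: "\<not> right_desc x (i + 1)" and dy: "right_desc y i"
  shows "left_cell_le n (star i x) (star i y)"
  using le dx unfolding left_cell_le_eq
proof (induction rule: converse_rtranclp_induct)
  case (step x z)
  obtain u where u: "x \<in> W n" "z \<in> W n" "u \<in> S n" "left_coeff n u z x \<noteq> 0"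
    using step.hyps(1) unfolding left_edge_def by blast
  have j: "1 \<le> i" "i < n" "1 \<le> i + 1" "i + 1 < n" using i by auto
  have dz: "right_desc z i" using left_cell_le_right_desc[of n z y i] step.hyps(2) dy j
    unfolding left_cell_le_eq by blast
  have nz: "\<not> right_desc z (i + 1)" using right_desc_mono[OF u j(3,4)] step.prems by blast
  have sz: "star_domain i z" using dz nz by (simp add: star_domain_def)
  have sx: "star_domain i x" using right_desc_mono[OF u j(1,2) dz] step.prems by (simp add: star_domain_def)
  have "left_edge n (star i x) (star i z)"
    unfolding left_edge_def using left_coeff_star[OF i u(3) u(1) sx u(2) sz] u(3,4) star_W[OF u(1) i] star_W[OF u(2) i]
    by metis
  then show ?case using step.IH[OF nz] by (rule converse_rtranclp_into_rtranclp)
qed simp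

lemma cell_eq_star:
  assumes "cell_eq n x y" "1 \<le> i" "i + 2 \<le> n" "star_domain i x"
  shows "star_domain i y" "cell_eq n (star i x) (star i y)"
proof -
  show sy: "star_domain i y"
    using cell_eq_right_desc[OF assms(1), of i] cell_eq_right_desc[OF assms(1), of "i+1"] assms(2-4)
    by (simp add: star_domain_def)
  show "cell_eq n (star i x) (star i y)"
    using assms sy left_cell_le_star[of n x y i] left_cell_le_star[of n y x i] star_W
    by (auto simp: cell_eq_def star_domain_def)
qed

text \<open>With \<open>y = s_k x > x\<close>, \<open>C_y\<close> is the leading term of
  \<open>T_{s_k} C_x\<close>. Conversely \<open>C_x\<close> occurs in \<open>T_{s_l} C_y\<close>:
  \<open>s_l\<close> is a left descent of \<open>x\<close> and not of \<open>y\<close>, and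
  \<open>kl_mu n x y\<close> is nonzero because \<open>x\<close> and \<open>y\<close> differ by a
  simple reflection.\<close>

lemma cell_eq_dual_knuth:
  assumes x: "x \<in> W n" and k: "1 \<le> k" "k < n" and l: "1 \<le> l" "l < n" "l = k + 1 \<or> k = l + 1"
    and kx: "inv x k < inv x (k + 1)" and lx: "inv x (l + 1) < inv x l"
    and lsx: "inv x (simple k l) < inv x (simple k (l + 1))"
  shows "cell_eq n x (simple k \<circ> x)"
proof -
  let ?s = "simple k" and ?t = "simple l"
  let ?y = "?s \<circ> x"
  have s: "?s \<in> S n" and t: "?t \<in> S n" using k l by (auto simp: simple_in_S)
  have y: "?y \<in> W n" using S_comp_W[OF s] x by simp
  have sy: "?s \<circ> ?y = x" by simp
  have nx: "\<not> len n ?y < len n x" using len_simple_comp_less_iff[OF x k] kx by simp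
  then have up: "len n x < len n ?y" using len_S_comp[OF x s] by auto
  have xy: "?y \<noteq> x" using up by auto
  have "left_coeff n ?s x ?y = 1"
    using nx up xy unfolding left_coeff_def sy by simp
  then have 1: "left_edge n ?y x" unfolding left_edge_def using x y s by force
  have tx: "len n (?t \<circ> x) < len n x" using len_simple_comp_less_iff[OF x l(1,2)] lx by simp
  have ty: "\<not> len n (?t \<circ> ?y) < len n ?y"
    using len_simple_comp_less_iff[OF y l(1,2)] lsx inv_simple_comp[OF x k] by simp
  \<comment> \<open>After inversion the reflection \<open>?s\<close> acts from the right, as
    \<open>kl_mu_right_descent\<close> requires.\<close>
  have "kl_mu n x ?y = kl_mu n (inv x) (inv ?y)" using kl_mu_inv[OF y x] by simp
  also have "\<dots> = - 1"
  proof -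
    have e: "inv ?y = inv x \<circ> ?s" using W_inv_o[OF S_W[OF s] x] inv_S[OF s] by simp
    have "inv ?y \<circ> ?s = inv x" unfolding e by simp
    then have "len n (inv x) < len n (inv x \<circ> ?s)" "len n (inv ?y \<circ> ?s) < len n (inv ?y)"
      using up len_inv[OF x] len_inv[OF y] unfolding e[symmetric] by auto
    from kl_mu_right_descent[OF s W_inv[OF x] W_inv[OF y] this] show ?thesis unfolding e by simp
  qed
  finally have "left_coeff n ?t ?y x = 1" using tx ty xy
    unfolding left_coeff_def by simp
  then have 2: "left_edge n x ?y" unfolding left_edge_def using x y t by force
  show ?thesis unfolding cell_eq_def left_cell_le_eq using 1 2 x y by blast
qed

lemma union_of_left_cells_iff:
  assumes X: "X \<subseteq> W n"
  shows "(\<exists>\<C> \<subseteq> left_cells n. X = \<Union>\<C>) \<longleftrightarrow> (\<forall>x y. x \<in> X \<longrightarrow> cell_eq n x y \<longrightarrow> y \<in> X)"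
proof -
  let ?r = "{(x, y). x \<in> W n \<and> y \<in> W n \<and> left_cell_le n x y \<and> left_cell_le n y x}"
  have r: "(x, y) \<in> ?r \<longleftrightarrow> cell_eq n x y" for x y by (simp add: cell_eq_def)
  have tr: "cell_eq n x y \<Longrightarrow> cell_eq n y z \<Longrightarrow> cell_eq n x z" for x y z
    unfolding cell_eq_def left_cell_le_eq by (meson rtranclp_trans)
  have refl: "x \<in> W n \<Longrightarrow> cell_eq n x x" for x unfolding cell_eq_def left_cell_le_eq by simp
  have cells: "left_cells n = (\<lambda>x. {y. cell_eq n x y}) ` W n"
    unfolding left_cells_def quotient_def Image_singleton r by auto
  show ?thesis
  proof
    assume "\<exists>\<C> \<subseteq> left_cells n. X = \<Union>\<C>"
    then obtain \<C> where C: "\<C> \<subseteq> left_cells n" "X = \<Union>\<C>" by blast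
    show "\<forall>x y. x \<in> X \<longrightarrow> cell_eq n x y \<longrightarrow> y \<in> X"
    proof (intro allI impI)
      fix x y assume "x \<in> X" and xy: "cell_eq n x y"
      then obtain z where z: "{y. cell_eq n z y} \<in> \<C>" "cell_eq n z x" using C cells by auto
      then have "cell_eq n z y" using tr xy by blast
      then show "y \<in> X" using z(1) C(2) by blast
    qed
  next
    assume c: "\<forall>x y. x \<in> X \<longrightarrow> cell_eq n x y \<longrightarrow> y \<in> X"
    have "X = \<Union>((\<lambda>x. {y. cell_eq n x y}) ` X)"
    proof (intro equalityI subsetI)
      fix x assume "x \<in> X" then show "x \<in> \<Union>((\<lambda>x. {y. cell_eq n x y}) ` X)" using X refl by blast
    qed (use c in blast)
    moreover have "(\<lambda>x. {y. cell_eq n x y}) ` X \<subseteq> left_cells n" using X cells by blast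
    ultimately show "\<exists>\<C> \<subseteq> left_cells n. X = \<Union>\<C>" by blast
  qed
qed

text \<open>The two decreasing runs of the window are the columns of a rectangular two-column tableau. Star
  operations move the first entry \<open>b\<close> of the second run to the left through the first run. If the
  rows of the tableau increase, every move is a transposition of \<open>b\<close> with its left neighbour, and one
  arrives at a smaller rectangle; otherwise \<open>b\<close> gets stuck on its way.\<close>

lemma window_moves:
  assumes xy: "cell_eq n x y" and p: "1 \<le> p" "p + 2 * m \<le> n + 1" and m: "2 \<le> m"
    and dec: "\<And>k. k + 1 < m \<Longrightarrow> x (p + k + 1) < x (p + k)"
    and row: "x p < x (p + m)" and j: "j < m"
  shows "\<exists>x' y'. cell_eq n x' y' \<and>
    (\<forall>k\<le>j. x' (p + k) = x (p + k)) \<and> x' (p + j + 1) = x (p + m) \<and>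
    (\<forall>k. j < k \<and> k < m \<longrightarrow> x' (p + k + 1) = x (p + k)) \<and> (\<forall>r>p + m. x' r = x r) \<and>
    (\<forall>r>p + m. y' r = y r) \<and>
    ((\<forall>k\<le>j. y' (p + k) = y (p + k)) \<and> y' (p + j + 1) = y (p + m) \<and>
      (\<forall>k. j < k \<and> k < m \<longrightarrow> y' (p + k + 1) = y (p + k)) \<or>
     (\<exists>i. j + 2 \<le> i \<and> i \<le> m \<and> y' (p + i) = y (p + m)))"
  using j
\<comment> \<open>Backwards in \<open>j\<close>: for \<open>j = m - 1\<close> the entry is still in
  its place, and each step applies the star operation at \<open>p + j\<close>.\<close>
proof (induction "m - 1 - j" arbitrary: j)
  case 0
  then have "j = m - 1" by simp
  then show ?case using xy m by (intro exI[of _ x] exI[of _ y]) auto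
next
  case (Suc d)
  have "d = m - 1 - (j + 1)" "j + 1 < m" using Suc.hyps(2) by auto
  from Suc.hyps(1)[OF this] obtain x' y' where
    c: "cell_eq n x' y'" and x1: "\<And>k. k \<le> j + 1 \<Longrightarrow> x' (p + k) = x (p + k)"
    and x2: "x' (p + (j + 1) + 1) = x (p + m)"
    and x3: "\<And>k. j + 1 < k \<Longrightarrow> k < m \<Longrightarrow> x' (p + k + 1) = x (p + k)"
    and x4: "\<And>r. r > p + m \<Longrightarrow> x' r = x r" and y4: "\<And>r. r > p + m \<Longrightarrow> y' r = y r"
    and alt: "(\<forall>k\<le>j + 1. y' (p + k) = y (p + k)) \<and> y' (p + (j + 1) + 1) = y (p + m) \<and>
      (\<forall>k. j + 1 < k \<and> k < m \<longrightarrow> y' (p + k + 1) = y (p + k)) \<or>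
     (\<exists>i. (j + 1) + 2 \<le> i \<and> i \<le> m \<and> y' (p + i) = y (p + m))" by blast
  have jm: "j + 1 < m" by fact
  let ?i = "p + j"
  have i: "1 \<le> ?i" "?i + 2 \<le> n" using p jm by auto
  have "x (r + 1) < x r" if "p \<le> r" "r < p + m - 1" for r
    using dec[of "r - p"] that by simp
  then have le: "x (p + k) \<le> x p" if "k < m" for k
    using step_decreasing[of p "p + m - 1" x p "p + k"] that
    by (cases "k = 0") (auto intro: less_imp_le)
  \<comment> \<open>\<open>x p\<close> is the largest entry of the first run, so \<open>row\<close>
    makes the moving entry larger than everything it passes.\<close>
  have o: "x' (?i + 1) < x' ?i" "x' ?i < x' (?i + 2)"
    using x1[of j] x1[of "j+1"] x2 dec[of j] jm le[of j] row by (auto simp: add.assoc)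
  then have sx: "star_domain ?i x'" by (simp add: star_domain_def right_desc_def)
  note cs = cell_eq_star[OF c i sx]
  let ?x = "star ?i x'" and ?y = "star ?i y'"
  have sx_eq: "?x ?i = x' ?i" "?x (?i + 1) = x' (?i + 2)" "?x (?i + 2) = x' (?i + 1)"
    using o(2) unfolding star_apply by auto
  have X1: "?x (p + k) = x (p + k)" if "k \<le> j" for k
    using that x1[of k] sx_eq(1) star_apply_other[of "p + k" ?i x'] by (cases "k = j") auto
  have X2: "?x (p + j + 1) = x (p + m)" using sx_eq(2) x2 by (simp add: add.assoc)
  have X3: "?x (p + k + 1) = x (p + k)" if "j < k" "k < m" for k
    using that x3[of k] x1[of "j+1"] sx_eq(3) star_apply_other[of "p + k + 1" ?i x']
    by (cases "k = j + 1") (auto simp: add.assoc)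
  have X4: "?x r = x r" if "r > p + m" for r
    using that jm x4 star_apply_other[of r ?i x'] by auto
  have Y4: "?y r = y r" if "r > p + m" for r
    using that jm y4 star_apply_other[of r ?i y'] by auto
  have Y: "(\<forall>k\<le>j. ?y (p + k) = y (p + k)) \<and> ?y (p + j + 1) = y (p + m) \<and>
      (\<forall>k. j < k \<and> k < m \<longrightarrow> ?y (p + k + 1) = y (p + k)) \<or>
     (\<exists>i. j + 2 \<le> i \<and> i \<le> m \<and> ?y (p + i) = y (p + m))"
    using alt
  proof
    assume A: "(\<forall>k\<le>j + 1. y' (p + k) = y (p + k)) \<and> y' (p + (j + 1) + 1) = y (p + m) \<and>
      (\<forall>k. j + 1 < k \<and> k < m \<longrightarrow> y' (p + k + 1) = y (p + k))"
    show ?thesis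
    proof (cases "y' ?i < y' (?i + 2)")
      case True
      have e: "?y ?i = y' ?i" "?y (?i + 1) = y' (?i + 2)" "?y (?i + 2) = y' (?i + 1)"
        using True unfolding star_apply by auto
      have "?y (p + k) = y (p + k)" if "k \<le> j" for k
        using that A e(1) star_apply_other[of "p + k" ?i y'] by (cases "k = j") auto
      moreover have "?y (p + j + 1) = y (p + m)" using e(2) A by (simp add: add.assoc)
      moreover have "?y (p + k + 1) = y (p + k)" if "j < k" "k < m" for k
        using that A e(3) star_apply_other[of "p + k + 1" ?i y']
        by (cases "k = j + 1") (auto simp: add.assoc)
      ultimately show ?thesis by blast
    next
      case False
      have "?y (?i + 2) = y' (?i + 2)" using False unfolding star_apply by simp
      then have "?y (p + (j + 2)) = y (p + m)" using A by (simp add: add.assoc)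
      then show ?thesis using jm by (intro disjI2 exI[of _ "j + 2"]) auto
    qed
  next
    \<comment> \<open>A stuck entry stands to the right of position \<open>p + j + 2\<close>, where
      the present operation and all later ones end.\<close>
    assume "\<exists>i. (j + 1) + 2 \<le> i \<and> i \<le> m \<and> y' (p + i) = y (p + m)"
    then obtain i where i: "(j + 1) + 2 \<le> i" "i \<le> m" "y' (p + i) = y (p + m)" by blast
    then have "?y (p + i) = y (p + m)" using star_apply_other[of "p + i" ?i y'] by simp
    then show ?thesis using i by (intro disjI2 exI[of _ i]) auto
  qed
  show ?case
  proof (rule exI[of _ ?x], rule exI[of _ ?y], intro conjI allI impI, goal_cases)
    case 1 show ?case by (rule cs(2))
  next
    case (2 k) then show ?case by (rule X1)
  next
    case 3 show ?case by (rule X2)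
  next
    case (4 k) then show ?case by (intro X3) auto
  next
    case (5 r) then show ?case by (rule X4)
  next
    case (6 r) then show ?case by (rule Y4)
  next
    case 7 show ?case by (rule Y)
  qed
qed

text \<open>Induction on the number of rows. When the first entry of the second run has arrived next
  to \<open>x p\<close>, positions \<open>p\<close> and \<open>p + 1\<close> carry the first row as
  a right ascent, which is visible to the cell; the positions from \<open>p + 2\<close> on form a
  window with one row less.\<close>

lemma cell_eq_window:
  assumes "cell_eq n x y" "1 \<le> p" "p + 2 * m \<le> n + 1"
    and "\<And>k. k + 1 < m \<Longrightarrow> x (p + k + 1) < x (p + k)"
    and "\<And>k. k + 1 < m \<Longrightarrow> x (p + m + k + 1) < x (p + m + k)"
    and "\<And>k. k < m \<Longrightarrow> x (p + k) < x (p + m + k)" and "k < m"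
  shows "y (p + k) < y (p + m + k)"
  using assms
proof (induction m arbitrary: x y p k)
  case (Suc m')
  note xy = Suc.prems(1) and p = Suc.prems(2,3) and dec1 = Suc.prems(4) and dec2 = Suc.prems(5)
    and row = Suc.prems(6)
  let ?m = "Suc m'"
  have yW: "y \<in> W n" using xy by (simp add: cell_eq_def)
  show ?case
  proof (cases "m' = 0")
    case True
    have "\<not> right_desc y p" using cell_eq_right_desc[OF xy, of p] p row[of 0] True
      by (simp add: right_desc_def)
    moreover have "y p \<noteq> y (p + 1)" using W_inj[OF yW] by simp
    ultimately show ?thesis using True Suc.prems(7) by (simp add: right_desc_def)
  next
    case False
    have "\<exists>x' y'. cell_eq n x' y' \<and>
      (\<forall>k\<le>0. x' (p + k) = x (p + k)) \<and> x' (p + 0 + 1) = x (p + ?m) \<and>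
      (\<forall>k. 0 < k \<and> k < ?m \<longrightarrow> x' (p + k + 1) = x (p + k)) \<and> (\<forall>r>p + ?m. x' r = x r) \<and>
      (\<forall>r>p + ?m. y' r = y r) \<and>
      ((\<forall>k\<le>0. y' (p + k) = y (p + k)) \<and> y' (p + 0 + 1) = y (p + ?m) \<and>
        (\<forall>k. 0 < k \<and> k < ?m \<longrightarrow> y' (p + k + 1) = y (p + k)) \<or>
       (\<exists>i. 0 + 2 \<le> i \<and> i \<le> ?m \<and> y' (p + i) = y (p + ?m)))"
      by (rule window_moves[OF xy p]) (use False dec1 row[of 0] in auto)
    then obtain x' y' where c: "cell_eq n x' y'" and x1: "x' p = x p" and x2: "x' (p + 1) = x (p + ?m)"
      and x3: "\<And>k. 0 < k \<Longrightarrow> k < ?m \<Longrightarrow> x' (p + k + 1) = x (p + k)"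
      and x4: "\<And>r. r > p + ?m \<Longrightarrow> x' r = x r" and y4: "\<And>r. r > p + ?m \<Longrightarrow> y' r = y r"
      and alt: "y' p = y p \<and> y' (p + 1) = y (p + ?m) \<and> (\<forall>k. 0 < k \<and> k < ?m \<longrightarrow> y' (p + k + 1) = y (p + k)) \<or>
       (\<exists>i. 2 \<le> i \<and> i \<le> ?m \<and> y' (p + i) = y (p + ?m))" by (auto simp: numeral_2_eq_2)
    have x3': "x' (p + 2 + k) = x (p + k + 1)" if "k < m'" for k
      using x3[of "k + 1"] that by (simp add: add.assoc add.commute add.left_commute)
    have x4': "x' (p + 2 + m' + k) = x (p + ?m + k + 1)" for k
      using x4[of "p + 2 + m' + k"] by (simp add: add.assoc add.commute add.left_commute)
    have y4': "y' (p + 2 + m' + k) = y (p + ?m + k + 1)" for k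
      using y4[of "p + 2 + m' + k"] by (simp add: add.assoc add.commute add.left_commute)
    have IH: "y' (p + 2 + k) < y (p + ?m + k + 1)" if "k < m'" for k
    proof -
      have "y' (p + 2 + k) < y' (p + 2 + m' + k)"
      proof (rule Suc.IH[OF c])
        show "x' (p + 2 + k + 1) < x' (p + 2 + k)" if "k + 1 < m'" for k
          using x3'[of k] x3'[of "k + 1"] dec1[of "k + 1"] that by (simp add: add.assoc)
        show "x' (p + 2 + m' + k + 1) < x' (p + 2 + m' + k)" if "k + 1 < m'" for k
          using x4'[of k] x4'[of "k + 1"] dec2[of "k + 1"] that by (simp add: add.assoc)
        show "x' (p + 2 + k) < x' (p + 2 + m' + k)" if "k < m'" for k
          using x3'[of k] x4'[of k] row[of "k + 1"] that by (simp add: add.assoc)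
      qed (use p that in auto)
      then show ?thesis using y4' by simp
    qed
    show ?thesis using alt
    proof
      assume A: "y' p = y p \<and> y' (p + 1) = y (p + ?m) \<and> (\<forall>k. 0 < k \<and> k < ?m \<longrightarrow> y' (p + k + 1) = y (p + k))"
      show ?thesis
      proof (cases "k = 0")
        case True
        have "\<not> right_desc y' p" using cell_eq_right_desc[OF c, of p] p x1 x2 row[of 0]
          by (simp add: right_desc_def)
        moreover have "y p \<noteq> y (p + ?m)" using W_inj[OF yW] by simp
        ultimately show ?thesis using A True by (simp add: right_desc_def)
      next
        case False
        then obtain l where l: "k = l + 1" using not0_implies_Suc by auto
        have "y' (p + k + 1) = y (p + k)" using A False Suc.prems(7) by blast
        then show ?thesis using IH[of l] Suc.prems(7) l by (simp add: add.assoc)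
      qed
    next
      \<comment> \<open>The stuck entry \<open>y (p + ?m)\<close> would lie in the decreasing run of
        \<open>y'\<close> that starts at \<open>p + 2\<close>. Hence it is at most
        \<open>y' (p + 2)\<close>, which by induction is below \<open>y (p + ?m + 1)\<close>,
        although \<open>p + ?m\<close> is a descent of \<open>y\<close>.\<close>
      assume "\<exists>i. 2 \<le> i \<and> i \<le> ?m \<and> y' (p + i) = y (p + ?m)"
      then obtain i where i: "2 \<le> i" "i \<le> ?m" "y' (p + i) = y (p + ?m)" by blast
      have dec: "y' (r + 1) < y' r" if r: "p + 2 \<le> r" "r < p + ?m" for r
      proof -
        define l where "l = r - (p + 2)"
        have l: "r = p + 2 + l" "l + 1 < m'" using r by (auto simp: l_def)
        have "x' (r + 1) < x' r" using x3'[of l] x3'[of "l + 1"] dec1[of "l + 1"] l by (simp add: add.assoc)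
        then show ?thesis using cell_eq_right_desc[OF c, of r] r p by (simp add: right_desc_def)
      qed
      have "y' (p + i) \<le> y' (p + 2)"
        using step_decreasing[of "p + 2" "p + ?m" y' "p + 2" "p + i"] dec i(1,2)
        by (cases "i = 2") (auto intro: less_imp_le)
      moreover have "y (p + ?m + 1) < y (p + ?m)"
        using cell_eq_right_desc[OF xy, of "p + ?m"] dec2[of 0] p False by (simp add: right_desc_def)
      moreover have "y' (p + 2) < y (p + ?m + 1)" using IH[of 0] False by simp
      ultimately show ?thesis using i(3) by simp
    qed
  qed
qed simp

section \<open>Ranks\<close>

lemma rank_bij:
  assumes fin: "finite D"
    and irr: "\<And>c. c \<in> D \<Longrightarrow> \<not> R c c"
    and trans: "\<And>c d e. c \<in> D \<Longrightarrow> d \<in> D \<Longrightarrow> e \<in> D \<Longrightarrow> R c d \<Longrightarrow> R d e \<Longrightarrow> R c e"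
    and total: "\<And>c d. c \<in> D \<Longrightarrow> d \<in> D \<Longrightarrow> c \<noteq> d \<Longrightarrow> R c d \<or> R d c"
    and rk: "\<And>c. c \<in> D \<Longrightarrow> rk c = card {d \<in> D. R d c \<or> d = c}"
  shows "\<And>c d. c \<in> D \<Longrightarrow> d \<in> D \<Longrightarrow> rk c < rk d \<longleftrightarrow> R c d"
    and "bij_betw rk D {1..card D}"
proof -
  have mono: "rk c < rk d" if "c \<in> D" "d \<in> D" "R c d" for c d
  proof -
    have "{e \<in> D. R e c \<or> e = c} \<subseteq> {e \<in> D. R e d \<or> e = d}" using that trans by blast
    moreover have "d \<in> {e \<in> D. R e d \<or> e = d}" "d \<notin> {e \<in> D. R e c \<or> e = c}"
      using that trans irr by blast+
    ultimately have "{e \<in> D. R e c \<or> e = c} \<subset> {e \<in> D. R e d \<or> e = d}" by blast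
    then show ?thesis unfolding rk[OF that(1)] rk[OF that(2)] using fin by (intro psubset_card_mono) auto
  qed
  show iff: "rk c < rk d \<longleftrightarrow> R c d" if "c \<in> D" "d \<in> D" for c d
    using mono[OF that] mono[OF that(2,1)] total[OF that] by (metis less_asym less_irrefl)
  have inj: "inj_on rk D"
    by (rule inj_onI) (metis mono total less_irrefl)
  have sub: "rk ` D \<subseteq> {1..card D}"
  proof
    fix k assume "k \<in> rk ` D"
    then obtain c where c: "c \<in> D" "k = rk c" by blast
    have "card {d \<in> D. R d c \<or> d = c} \<le> card D" using fin by (intro card_mono) auto
    moreover have "card {d \<in> D. R d c \<or> d = c} > 0" using fin c by (auto simp: card_gt_0_iff)
    ultimately show "k \<in> {1..card D}" using rk[OF c(1)] c(2) by simp
  qed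
  have "rk ` D = {1..card D}"
    by (rule card_subset_eq[OF _ sub]) (simp_all add: card_image[OF inj])
  then show "bij_betw rk D {1..card D}" using inj by (simp add: bij_betw_def)
qed

lemma exists_sorting_perm:
  fixes key :: "nat \<Rightarrow> nat"
  assumes inj: "inj_on key {1..n}"
  shows "\<exists>z\<in>W n. \<forall>f\<in>{1..n}. \<forall>g\<in>{1..n}. z f < z g \<longleftrightarrow> key f < key g"
proof -
  define z where "z f = (if f \<in> {1..n} then card {g \<in> {1..n}. key g < key f \<or> g = f} else f)" for f
  have total: "key c < key d \<or> key d < key c" if "c \<in> {1..n}" "d \<in> {1..n}" "c \<noteq> d" for c d
    using inj_onD[OF inj _ that(1,2)] that(3) by linarith
  have rk: "z c = card {d \<in> {1..n}. key d < key c \<or> d = c}" if "c \<in> {1..n}" for c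
    using that by (simp only: z_def if_True)
  have irr: "\<not> key c < key c" for c by simp
  have tr: "key c < key d \<Longrightarrow> key d < key e \<Longrightarrow> key c < key e" for c d e by simp
  have z: "\<And>c d. c \<in> {1..n} \<Longrightarrow> d \<in> {1..n} \<Longrightarrow> z c < z d \<longleftrightarrow> key c < key d"
    by (rule rank_bij(1)[of "{1..n}" "\<lambda>c d. key c < key d" z, OF finite_atLeastAtMost irr tr total rk])
  have zb: "bij_betw z {1..n} {1..card {1..n}}"
    by (rule rank_bij(2)[of "{1..n}" "\<lambda>c d. key c < key d" z, OF finite_atLeastAtMost irr tr total rk])
  have "z permutes {1..n}"
  proof (rule inj_imp_permutes)
    show "inj_on z {1..n}" using zb by (rule bij_betw_imp_inj_on)
    show "z x \<in> {1..n}" if "x \<in> {1..n}" for x using bij_betwE[OF zb] that by simp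
    show "z i = i" if "i \<notin> {1..n}" for i using that by (simp only: z_def if_False)
  qed simp
  then have "z \<in> W n" by (simp add: W_def)
  then show ?thesis using z by blast
qed

section \<open>Blocks and weak order intervals\<close>

text \<open>Blocks are the maximal intervals of labels joined by \<open>J\<close>, numbered from 1;
  in the end they are the columns of the diagram.\<close>

definition block :: "(nat \<Rightarrow> nat) set \<Rightarrow> nat \<Rightarrow> nat" where
  "block J a = 1 + card {k. 1 \<le> k \<and> k < a \<and> simple k \<notin> J}"

lemma block_finite [simp]: "finite {k::nat. 1 \<le> k \<and> k < a \<and> P k}"
  by (rule finite_subset[of _ "{..<a}"]) auto

lemma block_mono: "a \<le> b \<Longrightarrow> block J a \<le> block J b"
  unfolding block_def by (simp, intro card_mono) auto

lemma block_Suc: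
  assumes "1 \<le> a" shows "block J (a + 1) = (if simple a \<in> J then block J a else block J a + 1)"
proof (cases "simple a \<in> J")
  case True
  then have "{k. 1 \<le> k \<and> k < a + 1 \<and> simple k \<notin> J} = {k. 1 \<le> k \<and> k < a \<and> simple k \<notin> J}"
    by (auto simp: less_Suc_eq)
  then show ?thesis using True by (simp add: block_def)
next
  case False
  then have "{k. 1 \<le> k \<and> k < a + 1 \<and> simple k \<notin> J} = insert a {k. 1 \<le> k \<and> k < a \<and> simple k \<notin> J}"
    using assms by (auto simp: less_Suc_eq)
  then show ?thesis using False by (simp add: block_def)
qed

lemma block_one [simp]: "block J 1 = 1" "block J (Suc 0) = 1"
  by (simp_all add: block_def)

lemma block_ge_1 [simp]: "1 \<le> block J a"
  by (simp add: block_def)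

lemma block_eq_iff_le:
  assumes "1 \<le> a" "a \<le> b" shows "block J a = block J b \<longleftrightarrow> same_block J a b"
  using assms(2)
proof (induction b rule: dec_induct)
  case (step b)
  have "same_block J a (Suc b) \<longleftrightarrow> same_block J a b \<and> simple b \<in> J"
    using step.hyps unfolding same_block_def by (auto simp: less_Suc_eq)
  then show ?case using step assms(1) block_Suc[of b J] block_mono[of a b J] by auto
qed simp

lemma block_eq_iff:
  assumes "1 \<le> a" "1 \<le> b" shows "block J a = block J b \<longleftrightarrow> same_block J a b"
  using block_eq_iff_le[of a b J] block_eq_iff_le[of b a J] same_block_sym[of J a b] assms
  by (cases "a \<le> b") auto

lemma block_surj:
  assumes "1 \<le> a" "a \<le> b" "block J a \<le> j" "j \<le> block J b"
  shows "\<exists>c. a \<le> c \<and> c \<le> b \<and> block J c = j"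
  using assms(2,4)
proof (induction b rule: dec_induct)
  case base then show ?case using assms(3) by auto
next
  case (step b)
  then show ?case using block_Suc[of b J] assms(1)
    by (cases "j \<le> block J b") (auto split: if_splits intro: exI[of _ "Suc b"])
qed

lemma longest_less_block:
  assumes J: "J \<subseteq> S n" and "a \<in> {1..n}" "b \<in> {1..n}"
  shows "longest n J a < longest n J b \<longleftrightarrow> block J a < block J b \<or> block J a = block J b \<and> b < a"
proof -
  have ne: "longest n J a = longest n J b \<longleftrightarrow> a = b" using W_inj[OF longest_W[OF J]] .
  consider "a < b" | "a = b" | "b < a" by linarith
  then show ?thesis
  proof cases
    case 1
    then show ?thesis using longest_less_iff[OF J _ 1] block_eq_iff[of a b J] block_mono[of a b J] ne assms(2,3) by auto
  next
    case 3
    then show ?thesis using longest_less_iff[OF J _ 3] block_eq_iff[of b a J] block_mono[of b a J] assms(2,3) by auto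
  qed simp
qed

definition weak_interval :: "nat \<Rightarrow> (nat \<Rightarrow> nat) set \<Rightarrow> (nat \<Rightarrow> nat) \<Rightarrow> (nat \<Rightarrow> nat) set" where
  "weak_interval n J w = {x \<in> W n. left_weak_le n (longest n J) x \<and> left_weak_le n x (w \<circ> longest n J)}"

lemma weak_interval_iff_inversions:
  assumes "J \<subseteq> S n" "w \<in> W n" "x \<in> W n"
  shows "x \<in> weak_interval n J w \<longleftrightarrow>
    block_inversions n J \<subseteq> inversions n x \<and> inversions n x \<subseteq> inversions n (w \<circ> longest n J)"
  using assms left_weak_le_iff[OF assms(3) longest_W[OF assms(1)]] longest_props(2)[OF assms(1)]
    left_weak_le_iff[OF W_comp[OF assms(2) longest_W[OF assms(1)]] assms(3)]
  by (simp add: weak_interval_def)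

definition increasing_on_blocks :: "nat \<Rightarrow> (nat \<Rightarrow> nat) set \<Rightarrow> (nat \<Rightarrow> nat) \<Rightarrow> bool" where
  "increasing_on_blocks n J w \<longleftrightarrow>
    (\<forall>a b. 1 \<le> a \<longrightarrow> a < b \<longrightarrow> b \<le> n \<longrightarrow> block J a = block J b \<longrightarrow> w a < w b)"

lemma block_inversions_subset_iff:
  assumes J: "J \<subseteq> S n"
  shows "block_inversions n J \<subseteq> inversions n x \<longleftrightarrow> increasing_on_blocks n J (x \<circ> longest n J)"
proof -
  let ?v = "longest n J"
  note v = longest_W[OF J]
  have 1: "x (?v a) < x (?v b)"
    if sub: "block_inversions n J \<subseteq> inversions n x" and ab: "1 \<le> a" "a < b" "b \<le> n" "block J a = block J b" for a b
  proof -
    have "?v b < ?v a" using longest_less_block[OF J, of b a] ab by auto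
    moreover have "same_block J (?v b) (?v a)"
      using parabolic_same_block[OF longest_props(1)[OF J] J] block_eq_iff[of a b J] ab
      by (meson less_imp_le order_trans same_block_sym same_block_trans)
    ultimately have "(?v b, ?v a) \<in> block_inversions n J"
      using W_in'[OF v, of a] W_in'[OF v, of b] ab by (auto simp: block_inversions_def)
    then show ?thesis using sub by (auto simp: inversions_def)
  qed
  have 2: "(i, j) \<in> inversions n x"
    if inc: "increasing_on_blocks n J (x \<circ> ?v)" and ij: "(i, j) \<in> block_inversions n J" for i j
  proof -
    have r: "1 \<le> i" "i < j" "j \<le> n" "same_block J i j" using ij by (auto simp: block_inversions_def)
    have "?v j < ?v i" using longest_less_iff[OF J r(1-3)] r(4) by simp
    moreover have "block J (?v j) = block J (?v i)"
      using parabolic_same_block[OF longest_props(1)[OF J] J] r W_in'[OF v, of i] W_in'[OF v, of j]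
        block_eq_iff[of "?v j" "?v i" J]
      by (meson less_imp_le order_trans same_block_sym same_block_trans)
    ultimately have "(x \<circ> ?v) (?v j) < (x \<circ> ?v) (?v i)"
      using inc W_in'[OF v, of i] W_in'[OF v, of j] r unfolding increasing_on_blocks_def by simp
    then show ?thesis using r J by (simp add: inversions_def)
  qed
  show ?thesis using 1 2 unfolding increasing_on_blocks_def by auto
qed

text \<open>\<open>longest n J\<close> reverses each block and keeps the order of labels from
  different blocks. Pairs inside a block are taken care of by the lower end of the interval and by
  \<open>inc\<close>; on the other pairs the two inclusions differ only by relabelling.\<close>

lemma weak_interval_iff:
  assumes J: "J \<subseteq> S n" and w: "w \<in> W n" and inc: "increasing_on_blocks n J w" and x: "x \<in> W n"
  shows "x \<in> weak_interval n J w \<longleftrightarrow> inversions n (x \<circ> longest n J) \<subseteq> inversions n w"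
proof -
  let ?v = "longest n J"
  let ?z = "x \<circ> ?v"
  note v = longest_W[OF J]
  note vv = longest_longest[OF J]
  have z: "?z \<in> W n" by (rule W_comp[OF x v])
  have blocks: "increasing_on_blocks n J ?z" if "inversions n ?z \<subseteq> inversions n w"
    unfolding increasing_on_blocks_def
  proof (intro allI impI)
    fix a b assume ab: "1 \<le> a" "a < b" "b \<le> n" "block J a = block J b"
    then have "w a < w b" using inc by (simp add: increasing_on_blocks_def)
    then have "(a, b) \<notin> inversions n ?z" using that by (auto simp: inversions_def)
    then show "?z a < ?z b" using ab W_inj[OF z, of a b] by (auto simp: inversions_def)
  qed
  have "inversions n x \<subseteq> inversions n (w \<circ> ?v) \<longleftrightarrow> inversions n ?z \<subseteq> inversions n w"
    if b: "increasing_on_blocks n J ?z"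
  proof
    assume sub: "inversions n x \<subseteq> inversions n (w \<circ> ?v)"
    show "inversions n ?z \<subseteq> inversions n w"
    proof
      fix p assume "p \<in> inversions n ?z"
      then obtain a c where ac: "p = (a, c)" "1 \<le> a" "a < c" "c \<le> n" "x (?v c) < x (?v a)"
        by (auto simp: inversions_def)
      have "block J a \<noteq> block J c" using b ac unfolding increasing_on_blocks_def by force
      then have "?v a < ?v c" using longest_less_block[OF J, of a c] block_mono[of a c J] ac by auto
      then have "(?v a, ?v c) \<in> inversions n x"
        using ac W_in'[OF v, of a] W_in'[OF v, of c] by (auto simp: inversions_def)
      then have "(?v a, ?v c) \<in> inversions n (w \<circ> ?v)" using sub by blast
      then show "p \<in> inversions n w" using ac by (simp add: inversions_def vv)
    qed
  next
    assume sub: "inversions n ?z \<subseteq> inversions n w"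
    show "inversions n x \<subseteq> inversions n (w \<circ> ?v)"
    proof
      fix p assume "p \<in> inversions n x"
      then obtain i j where ij: "p = (i, j)" "1 \<le> i" "i < j" "j \<le> n" "x j < x i" by (auto simp: inversions_def)
      have r: "1 \<le> ?v i" "?v i \<le> n" "1 \<le> ?v j" "?v j \<le> n" using W_in'[OF v, of i] W_in'[OF v, of j] ij by auto
      have "w (?v j) < w (?v i)"
      proof (cases "?v i < ?v j")
        case True
        then have "(?v i, ?v j) \<in> inversions n ?z" using ij r by (simp add: inversions_def vv)
        then show ?thesis using sub by (auto simp: inversions_def)
      next
        case False
        then have lt: "?v j < ?v i" using W_inj[OF v, of i j] ij by auto
        have "?v (?v i) < ?v (?v j)" using ij(3) vv by simp
        then have "block J (?v j) = block J (?v i)"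
          using longest_less_block[OF J, of "?v i" "?v j"] r lt block_mono[of "?v j" "?v i" J] by auto
        then show ?thesis using inc r lt unfolding increasing_on_blocks_def by simp
      qed
      then show "p \<in> inversions n (w \<circ> ?v)" using ij by (simp add: inversions_def)
    qed
  qed
  then show ?thesis
    unfolding weak_interval_iff_inversions[OF J w x] block_inversions_subset_iff[OF J] using blocks by blast
qed

lemma weak_interval_nonempty:
  assumes J: "J \<subseteq> S n" and w: "w \<in> W n" and ne: "weak_interval n J w \<noteq> {}"
  shows "increasing_on_blocks n J w"
proof -
  obtain x where "x \<in> weak_interval n J w" using ne by blast
  then have "block_inversions n J \<subseteq> inversions n (w \<circ> longest n J)"
    using weak_interval_iff_inversions[OF J w, of x] by (auto simp: weak_interval_def)
  then have "increasing_on_blocks n J (w \<circ> longest n J \<circ> longest n J)"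
    unfolding block_inversions_subset_iff[OF J] .
  then show ?thesis by (simp add: comp_assoc longest_comp_longest[OF J])
qed

text \<open>\<open>word_between J c a b\<close> says that in the word of \<open>z w\<^sub>J\<close> the entry \<open>z(c)\<close> stands between \<open>z(a)\<close> and
  \<open>z(b)\<close>.\<close>

definition word_between :: "(nat \<Rightarrow> nat) set \<Rightarrow> nat \<Rightarrow> nat \<Rightarrow> nat \<Rightarrow> bool" where
  "word_between J c a b \<longleftrightarrow> block J c = block J a \<and> c < a \<or>
     block J a < block J c \<and> block J c < block J b \<or> block J c = block J b \<and> b < c"

text \<open>In the word of \<open>x = z w_J\<close> the value \<open>z e\<close> stands at position
  \<open>longest n J e\<close>. So a value adjacent to the pair \<open>z a\<close>,
  \<open>z a + 1\<close> stands between the two, and exchanging the pair stays in the left cell. But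
  the exchange creates the inversion \<open>(a, b)\<close>, which \<open>w\<close> does not
  have.\<close>

lemma dual_knuth_closed:
  assumes J: "J \<subseteq> S n" and w: "w \<in> W n" and inc: "increasing_on_blocks n J w"
    and closed: "\<And>x y. x \<in> weak_interval n J w \<Longrightarrow> cell_eq n x y \<Longrightarrow> y \<in> weak_interval n J w"
    and z: "z \<in> W n" "inversions n z \<subseteq> inversions n w"
    and ab: "1 \<le> a" "a < b" "b \<le> n" "w a < w b" "block J a < block J b" "z b = z a + 1"
    and c: "1 \<le> c" "c \<le> n" "word_between J c a b" "z c + 1 = z a \<or> z c = z a + 2"
  shows False
proof -
  let ?v = "longest n J"
  let ?x = "z \<circ> ?v"
  note v = longest_W[OF J]
  have x: "?x \<in> W n" by (rule W_comp[OF z(1) v])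
  have xv: "?x \<circ> ?v = z" by (simp add: comp_assoc longest_comp_longest[OF J])
  have inv: "inv ?x (z e) = ?v e" for e
    using W_inv_o[OF z(1) v] inv_longest[OF J] W_inv_f[OF z(1)] by simp
  have xX: "?x \<in> weak_interval n J w" using weak_interval_iff[OF J w inc x] z(2) unfolding xv by simp
  let ?k = "z a"
  have k: "1 \<le> ?k" "?k < n" using W_in'[OF z(1), of a] W_in'[OF z(1), of b] ab by auto
  have r: "a \<in> {1..n}" "b \<in> {1..n}" "c \<in> {1..n}" using ab c by auto
  have wb: "block J a < block J c \<or> block J a = block J c \<and> c < a"
    "block J c < block J b \<or> block J c = block J b \<and> b < c"
    using c(3) ab(5) unfolding word_between_def by arith+
  have pos: "?v a < ?v c" "?v c < ?v b"
    unfolding longest_less_block[OF J r(1,3)] longest_less_block[OF J r(3,2)] by (rule wb)+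
  have "cell_eq n ?x (simple ?k \<circ> ?x)"
    using c(4)
  proof
    assume e: "z c + 1 = ?k"
    show ?thesis
    proof (rule cell_eq_dual_knuth[OF x k, where l = "z c"])
      show "1 \<le> z c" using W_in'[OF z(1), of c] c by auto
      show "z c < n" using e k by simp
      show "inv ?x ?k < inv ?x (?k + 1)" using inv[of a] inv[of b] ab(6) pos by simp
      show "inv ?x (z c + 1) < inv ?x (z c)" using inv[of a] inv[of c] e pos by simp
      have "simple ?k (z c) = z c" "simple ?k (z c + 1) = z b" using e ab(6) by (auto simp: simple_apply)
      then show "inv ?x (simple ?k (z c)) < inv ?x (simple ?k (z c + 1))" using inv pos by simp
    qed (use e in simp)
  next
    assume e: "z c = ?k + 2"
    show ?thesis
    proof (rule cell_eq_dual_knuth[OF x k, where l = "?k + 1"])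
      show "?k + 1 < n" using W_in'[OF z(1), of c] c e by auto
      show "inv ?x ?k < inv ?x (?k + 1)" using inv[of a] inv[of b] ab(6) pos by simp
      have e2: "?k + 1 + 1 = z c" using e by simp
      show "inv ?x (?k + 1 + 1) < inv ?x (?k + 1)" unfolding e2 using inv[of b] inv[of c] ab(6) pos by simp
      have "simple ?k (?k + 1) = z a" "simple ?k (?k + 1 + 1) = z c" using e by (auto simp: simple_apply)
      then show "inv ?x (simple ?k (?k + 1)) < inv ?x (simple ?k (?k + 1 + 1))" using inv pos by simp
    qed simp_all
  qed
  then have sx: "simple ?k \<circ> ?x \<in> weak_interval n J w" by (rule closed[OF xX])
  then have "inversions n (simple ?k \<circ> ?x \<circ> ?v) \<subseteq> inversions n w"
    using weak_interval_iff[OF J w inc, of "simple ?k \<circ> ?x"] by (auto simp: weak_interval_def)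
  moreover have "(a, b) \<in> inversions n (simple ?k \<circ> ?x \<circ> ?v)"
    using ab unfolding comp_assoc[of "simple ?k" ?x] xv by (simp add: inversions_def simple_apply)
  ultimately show False using ab by (auto simp: inversions_def)
qed

section \<open>The poset of a closed interval\<close>

text \<open>\<open>x \<in> weak_interval n J w\<close> means that \<open>x w\<^sub>J\<close> is a linear extension of the two-dimensional poset
  \<open>below\<close>. The last assumption is what remains of closure under left cells. It forces the covering
  relation of the poset to be that of a skew diagram whose columns are the blocks of \<open>J\<close>.\<close>

locale skew_poset =
  fixes n :: nat and w :: "nat \<Rightarrow> nat" and J :: "(nat \<Rightarrow> nat) set"
  assumes w: "w \<in> W n" and J: "J \<subseteq> S n" and inc: "increasing_on_blocks n J w"
    and closed: "\<And>z a b c. \<lbrakk>z \<in> W n; inversions n z \<subseteq> inversions n w; 1 \<le> a; a < b; b \<le> n; w a < w b;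
      block J a < block J b; z b = z a + 1; 1 \<le> c; c \<le> n; word_between J c a b;
      z c + 1 = z a \<or> z c = z a + 2\<rbrakk> \<Longrightarrow> False"
begin

definition below :: "nat \<Rightarrow> nat \<Rightarrow> bool" where
  "below a b \<longleftrightarrow> 1 \<le> a \<and> a < b \<and> b \<le> n \<and> w a < w b"

definition cover :: "nat \<Rightarrow> nat \<Rightarrow> bool" where
  "cover a b \<longleftrightarrow> below a b \<and> (\<forall>c. \<not> (below a c \<and> below c b))"

abbreviation col :: "nat \<Rightarrow> nat" where "col \<equiv> block J"

lemma below_trans: "below a b \<Longrightarrow> below b c \<Longrightarrow> below a c"
  by (auto simp: below_def)

lemma below_not_sym: "below a b \<Longrightarrow> \<not> below b a"
  by (auto simp: below_def)

lemma below_irrefl: "\<not> below a a"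
  by (auto simp: below_def)

lemma below_less: "below a b \<Longrightarrow> a < b" and below_range: "below a b \<Longrightarrow> 1 \<le> a \<and> b \<le> n"
  by (auto simp: below_def)

lemma below_col: "below a b \<Longrightarrow> col a \<le> col b"
  using block_mono[of a b J] by (auto simp: below_def)

lemma below_same_col: "1 \<le> a \<Longrightarrow> a < b \<Longrightarrow> b \<le> n \<Longrightarrow> col a = col b \<Longrightarrow> below a b"
  using inc by (auto simp: below_def increasing_on_blocks_def)

lemma cover_below: "cover a b \<Longrightarrow> below a b"
  by (simp add: cover_def)

lemma coverD: "cover a b \<Longrightarrow> below a c \<Longrightarrow> \<not> below c b"
  by (simp add: cover_def)

lemma exists_cover_left:
  assumes ck: "below c k" shows "\<exists>d. (d = c \<or> below c d) \<and> cover d k"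
proof -
  define A where "A = {f. (f = c \<or> below c f) \<and> below f k}"
  have fin: "finite A" by (rule finite_subset[of _ "{..n}"]) (auto simp: below_def A_def)
  have ne: "A \<noteq> {}" using ck by (auto simp: A_def)
  define d where "d = Max A"
  have d: "d = c \<or> below c d" "below d k" using Max_in[OF fin ne] by (auto simp: A_def d_def)
  have "\<not> below g k" if g: "below d g" for g
  proof
    assume gk: "below g k"
    have "below c g" using d(1) g below_trans by blast
    then have "g \<le> d" unfolding d_def using gk by (intro Max_ge[OF fin]) (simp add: A_def)
    then show False using below_less[OF g] by simp
  qed
  then show ?thesis using d unfolding cover_def by blast
qed

lemma exists_cover_right:
  assumes kc: "below k c" shows "\<exists>d. (d = c \<or> below d c) \<and> cover k d"
proof -
  define A where "A = {f. (f = c \<or> below f c) \<and> below k f}"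
  have fin: "finite A" by (rule finite_subset[of _ "{..n}"]) (auto simp: below_def A_def)
  have ne: "A \<noteq> {}" using kc by (auto simp: A_def)
  define d where "d = Min A"
  have d: "d = c \<or> below d c" "below k d" using Min_in[OF fin ne] by (auto simp: A_def d_def)
  have "\<not> below k g" if g: "below g d" for g
  proof
    assume kg: "below k g"
    have "below g c" using d(1) g below_trans by blast
    then have "d \<le> g" unfolding d_def using kg by (intro Min_le[OF fin]) (simp add: A_def)
    then show False using below_less[OF g] by simp
  qed
  then show ?thesis using d unfolding cover_def by blast
qed

text \<open>A convex triple can be made consecutive. \<open>w\<close> itself is a linear extension,
  so it may order the elements below the triple and the remaining ones. By convexity no element
  outside the triple is both above and below members of it.\<close>

lemma exists_linear_extension:
  assumes r: "e1 \<in> {1..n}" "e2 \<in> {1..n}" "e3 \<in> {1..n}" and d: "e1 \<noteq> e2" "e1 \<noteq> e3" "e2 \<noteq> e3"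
    and ord: "\<not> below e2 e1" "\<not> below e3 e1" "\<not> below e3 e2"
    and conv: "\<And>e e' f. e \<in> {e1, e2, e3} \<Longrightarrow> e' \<in> {e1, e2, e3} \<Longrightarrow> below e f \<Longrightarrow> below f e' \<Longrightarrow> f \<in> {e1, e2, e3}"
  shows "\<exists>z\<in>W n. inversions n z \<subseteq> inversions n w \<and> z e2 = z e1 + 1 \<and> z e3 = z e1 + 2"
proof -
  let ?E = "{e1, e2, e3}"
  let ?D = "\<lambda>f. \<exists>e\<in>?E. below f e"
  \<comment> \<open>the elements below one of the three come first, then the three, then everything else\<close>
  define key where "key f = (if f = e1 then n + 1 else if f = e2 then n + 2 else if f = e3 then n + 3
    else if ?D f then w f else n + 3 + w f)" for f
  have wr: "1 \<le> w f \<and> w f \<le> n" if "f \<in> {1..n}" for f using W_in'[OF w] that by auto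
  have k: "key e1 = n + 1" "key e2 = n + 2" "key e3 = n + 3" using d by (auto simp: key_def)
  have kD: "key f = w f" if "f \<notin> ?E" "?D f" for f using that by (simp add: key_def)
  have kR: "key f = n + 3 + w f" if "f \<notin> ?E" "\<not> ?D f" for f using that by (auto simp: key_def)
  have kE: "n + 1 \<le> key f \<and> key f \<le> n + 3" if "f \<in> ?E" for f using that k by auto
  have kc: "(f \<in> ?E \<and> n + 1 \<le> key f \<and> key f \<le> n + 3) \<or> (f \<notin> ?E \<and> key f = w f) \<or>
    (f \<notin> ?E \<and> key f = n + 3 + w f)" for f
    using kD kR kE by blast
  have inj: "inj_on key {1..n}"
  proof (rule inj_onI)
    fix f g assume fg: "f \<in> {1..n}" "g \<in> {1..n}" "key f = key g"
    have "(f \<in> ?E \<and> g \<in> ?E) \<or> w f = w g"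
      using kc[of f] kc[of g]
    proof (elim disjE conjE, goal_cases)
      case 1 then show ?case by blast
    qed (use fg(3) wr[OF fg(1)] wr[OF fg(2)] in linarith)+
    then show "f = g"
    proof
      assume "f \<in> ?E \<and> g \<in> ?E" then show ?thesis using fg(3) k by auto
    next
      assume "w f = w g" then show ?thesis using W_inj[OF w] by blast
    qed
  qed
  obtain z where z: "z \<in> W n" "\<And>f g. f \<in> {1..n} \<Longrightarrow> g \<in> {1..n} \<Longrightarrow> z f < z g \<longleftrightarrow> key f < key g"
    using exists_sorting_perm[OF inj] by blast
  have ext: "key f < key g" if b: "below f g" for f g
  proof -
    have fr: "f \<in> {1..n}" "g \<in> {1..n}" "w f < w g" using b by (auto simp: below_def)
    show ?thesis
    proof (cases "g \<in> ?E")
      case True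
      show ?thesis
      proof (cases "f \<in> ?E")
        case fE: True
        then show ?thesis using True b ord k below_irrefl by auto
      next
        case False
        then have "key f = w f" using kD True b by blast
        then show ?thesis using wr[OF fr(1)] kE[OF True] by linarith
      qed
    next
      case g: False
      show ?thesis
      proof (cases "?D g")
        case True
        then obtain e where e: "e \<in> ?E" "below g e" by blast
        then have "?D f" using b below_trans by blast
        moreover have "f \<notin> ?E" using conv[OF _ e(1) b e(2)] g by blast
        ultimately show ?thesis using kD[OF g True] kD[of f] fr by simp
      next
        case False
        have "key f \<le> n + 3 \<or> key f = n + 3 + w f"
          using kE[of f] kD[of f] kR[of f] wr[OF fr(1)] by (cases "f \<in> ?E"; cases "?D f") auto
        then show ?thesis using kR[OF g False] fr wr[OF fr(2)] by auto
      qed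
    qed
  qed
  have "inversions n z \<subseteq> inversions n w"
  proof
    fix p assume "p \<in> inversions n z"
    then obtain f g where p: "p = (f, g)" "1 \<le> f" "f < g" "g \<le> n" "z g < z f" by (auto simp: inversions_def)
    then have "key g < key f" using z(2)[of g f] by simp
    then have "\<not> below f g" using ext by fastforce
    then have "\<not> w f < w g" using p by (auto simp: below_def)
    then show "p \<in> inversions n w" using p W_inj[OF w, of f g] by (auto simp: inversions_def)
  qed
  moreover have next_value: "z e' = z e + 1" if e: "e \<in> {1..n}" "e' \<in> {1..n}" "key e' = key e + 1" for e e'
  proof (rule ccontr)
    assume ne: "z e' \<noteq> z e + 1"
    have "z e < z e'" using z(2)[OF e(1,2)] e(3) by simp
    then have l: "z e + 1 < z e'" using ne by simp
    define g where "g = inv z (z e + 1)"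
    have "z e + 1 \<in> {1..n}" using l W_in'[OF z(1), of e'] e by auto
    then have g: "g \<in> {1..n}" "z g = z e + 1"
      using W_in[OF W_inv[OF z(1)]] W_f_inv[OF z(1)] unfolding g_def by auto
    then have "key e < key g" "key g < key e'" using z(2)[OF e(1) g(1)] z(2)[OF g(1) e(2)] l by auto
    then show False using e(3) by simp
  qed
  have "z e2 = z e1 + 1" "z e3 = z e2 + 1" using next_value r k by auto
  ultimately show ?thesis using z(1) by auto
qed

text \<open>The hypotheses make the triple convex and allow the order \<open>c\<close>,
  \<open>a\<close>, \<open>b\<close>. In such an extension \<open>z c + 1 = z a\<close>, while
  \<open>z c\<close> stands between the consecutive values \<open>z a\<close> and
  \<open>z b\<close>: the excluded configuration.\<close>

lemma cover_not_before:
  assumes ab: "cover a b" "col a < col b" and c: "1 \<le> c" "c \<le> n" "word_between J c a b"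
    and nc: "\<not> below a c" "\<not> below b c" and conv: "\<And>f. below c f \<Longrightarrow> below f b \<Longrightarrow> f = a"
  shows False
proof -
  have r: "1 \<le> a" "a < b" "b \<le> n" "w a < w b" using cover_below[OF ab(1)] by (auto simp: below_def)
  have d: "c \<noteq> a" "c \<noteq> b" using c(3) ab(2) by (auto simp: word_between_def)
  have "\<exists>z\<in>W n. inversions n z \<subseteq> inversions n w \<and> z a = z c + 1 \<and> z b = z c + 2"
  proof (rule exists_linear_extension)
    show "c \<noteq> a" "c \<noteq> b" "a \<noteq> b" using d r by auto
    show "\<not> below b a" using r by (simp add: below_def)
    fix e e' f assume ef: "e \<in> {c, a, b}" "e' \<in> {c, a, b}" "below e f" "below f e'"
    show "f \<in> {c, a, b}"
    proof (rule ccontr)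
      assume nf: "f \<notin> {c, a, b}"
      have ab': "below a b" by (rule cover_below[OF ab(1)])
      have 1: "\<not> (below g f \<and> below f g)" for g using below_not_sym[of g f] by blast
      have 2: "\<not> (below c f \<and> below f a)" using conv[of f] below_trans[of f a b] ab' nf by blast
      have 3: "\<not> (below c f \<and> below f b)" using conv[of f] nf by blast
      have 4: "\<not> (below a f \<and> below f c)" using nc(1) below_trans[of a f c] by blast
      have 5: "\<not> (below b f \<and> below f c)" using nc(2) below_trans[of b f c] by blast
      have 6: "\<not> (below a f \<and> below f b)" using coverD[OF ab(1), of f] by blast
      have 7: "\<not> (below b f \<and> below f a)" using below_not_sym[OF ab'] below_trans[of b f a] by blast
      show False using ef 1[of a] 1[of b] 1[of c] 2 3 4 5 6 7
        by (elim insertE emptyE) simp_all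
    qed
  qed (use r c nc in auto)
  then obtain z where z: "z \<in> W n" "inversions n z \<subseteq> inversions n w" "z a = z c + 1" "z b = z c + 2" by blast
  show False using closed[OF z(1,2) r ab(2) _ c] z(3,4) by simp
qed

text \<open>The same with the order \<open>a\<close>, \<open>b\<close>, \<open>c\<close>, so that
  \<open>z c = z a + 2\<close>.\<close>

lemma cover_not_after:
  assumes ab: "cover a b" "col a < col b" and c: "1 \<le> c" "c \<le> n" "word_between J c a b"
    and nc: "\<not> below c a" "\<not> below c b" and conv: "\<And>f. below a f \<Longrightarrow> below f c \<Longrightarrow> f = b"
  shows False
proof -
  have r: "1 \<le> a" "a < b" "b \<le> n" "w a < w b" using cover_below[OF ab(1)] by (auto simp: below_def)
  have d: "c \<noteq> a" "c \<noteq> b" using c(3) ab(2) by (auto simp: word_between_def)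
  have "\<exists>z\<in>W n. inversions n z \<subseteq> inversions n w \<and> z b = z a + 1 \<and> z c = z a + 2"
  proof (rule exists_linear_extension)
    show "a \<noteq> c" "b \<noteq> c" "a \<noteq> b" using d r by auto
    show "\<not> below b a" using r by (simp add: below_def)
    fix e e' f assume ef: "e \<in> {a, b, c}" "e' \<in> {a, b, c}" "below e f" "below f e'"
    show "f \<in> {a, b, c}"
    proof (rule ccontr)
      assume nf: "f \<notin> {a, b, c}"
      have ab': "below a b" by (rule cover_below[OF ab(1)])
      have 1: "\<not> (below g f \<and> below f g)" for g using below_not_sym[of g f] by blast
      have 2: "\<not> (below b f \<and> below f c)" using conv[of f] below_trans[of a b f] ab' nf by blast
      have 3: "\<not> (below a f \<and> below f c)" using conv[of f] nf by blast
      have 4: "\<not> (below c f \<and> below f a)" using nc(1) below_trans[of c f a] by blast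
      have 5: "\<not> (below c f \<and> below f b)" using nc(2) below_trans[of c f b] by blast
      have 6: "\<not> (below a f \<and> below f b)" using coverD[OF ab(1), of f] by blast
      have 7: "\<not> (below b f \<and> below f a)" using below_not_sym[OF ab'] below_trans[of b f a] by blast
      show False using ef 1[of a] 1[of b] 1[of c] 2 3 4 5 6 7
        by (elim insertE emptyE) simp_all
    qed
  qed (use r c nc in auto)
  then obtain z where z: "z \<in> W n" "inversions n z \<subseteq> inversions n w" "z b = z a + 1" "z c = z a + 2" by blast
  show False using closed[OF z(1,2) r ab(2) z(3) c] z(4) by simp
qed

end

section \<open>Covers between columns\<close>

context skew_poset
begin

lemma col_less: "col a < col b \<Longrightarrow> a < b"
  using block_mono[of b a J] by (meson leD leI)

lemma col_between: "a \<le> c \<Longrightarrow> c \<le> b \<Longrightarrow> col a = col b \<Longrightarrow> col c = col a"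
  using block_mono[of a c J] block_mono[of c b J] by linarith

lemma below_extend_right:
  "below e k \<Longrightarrow> k \<le> b \<Longrightarrow> b \<le> n \<Longrightarrow> col k = col b \<Longrightarrow> below e b"
  using below_same_col[of k b] below_trans[of e k b] by (cases "k = b") (auto simp: below_def)

lemma below_extend_left:
  "below k e \<Longrightarrow> a \<le> k \<Longrightarrow> 1 \<le> a \<Longrightarrow> col k = col a \<Longrightarrow> below a e"
  using below_same_col[of a k] below_trans[of a k e] by (cases "k = a") (auto simp: below_def)

text \<open>Columns are read upwards, so \<open>a\<close> is read after \<open>a + 1\<close> and
  before \<open>b\<close>. If only \<open>a + 1\<close> lay between \<open>a\<close> and
  \<open>b\<close>, the chain \<open>a\<close>, \<open>a + 1\<close>, \<open>b\<close> would be
  convex, against \<open>cover_not_before\<close>.\<close>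

lemma exists_before:
  assumes c: "cover (a + 1) b" and a: "1 \<le> a" and col: "col (a + 1) = col a" "col a < col b"
  shows "\<exists>d. d \<noteq> a + 1 \<and> below a d \<and> below d b"
proof (rule ccontr)
  assume neg: "\<not> ?thesis"
  have b: "a + 1 < b" "b \<le> n" using cover_below[OF c] by (auto simp: below_def)
  show False
  proof (rule cover_not_before[OF c _ a])
    show "col (a + 1) < col b" using col by simp
    show "a \<le> n" using b by simp
    show "word_between J a (a + 1) b" using col by (simp add: word_between_def)
    show "\<not> below (a + 1) a" "\<not> below b a" using b by (auto simp: below_def)
    show "f = a + 1" if "below a f" "below f b" for f using neg that by blast
  qed
qed

lemma exists_after:
  assumes c: "cover a b" and b: "b + 1 \<le> n" and col: "col (b + 1) = col b" "col a < col b"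
  shows "\<exists>e. e \<noteq> b \<and> below a e \<and> below e (b + 1)"
proof (rule ccontr)
  assume neg: "\<not> ?thesis"
  have a: "1 \<le> a" "a < b" using cover_below[OF c] by (auto simp: below_def)
  show False
  proof (rule cover_not_after[OF c col(2) _ b])
    show "1 \<le> b + 1" by simp
    show "word_between J (b + 1) a b" using col by (simp add: word_between_def)
    show "\<not> below (b + 1) a" "\<not> below (b + 1) b" using a by (auto simp: below_def)
    show "f = b" if "below a f" "below f (b + 1)" for f using neg that by blast
  qed
qed

text \<open>If \<open>b\<close> covers an \<open>e\<close> from a column strictly between with
  \<open>w e < w a\<close>, then \<open>e\<close>, \<open>a\<close>, \<open>b\<close> contradict
  \<open>cover_not_before\<close>. From \<open>c\<close> such a lower cover is first found for the
  first element of the column of \<open>b\<close> that lies above \<open>c\<close>;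
  \<open>exists_after\<close> then passes it down the column until \<open>b\<close> is reached.
  \<open>Q\<close> records this property.\<close>

lemma cover_no_intermediate_left:
  assumes ab: "cover a b" and c: "col a < col c" "col c < col b" "w c < w a" shows False
proof -
  have r: "1 \<le> a" "a < b" "b \<le> n" "w a < w b" using cover_below[OF ab] by (auto simp: below_def)
  define Q where "Q k \<longleftrightarrow> (\<exists>e. col a < col e \<and> col e < col b \<and> w e < w a \<and> cover e k)" for k
  \<comment> \<open>The condition \<open>w e < w a\<close> is automatic: otherwise \<open>e\<close>
    would lie between \<open>a\<close> and \<open>b\<close>, contradicting the cover.\<close>
  have QI: "Q k" if e: "cover e k" "k \<le> b" "col k = col b" "col a < col e" "col e \<noteq> col b" for e k
  proof -
    have ek: "below e k" by (rule cover_below[OF e(1)])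
    have "col e < col b" using below_col[OF ek] e by simp
    moreover have "w e < w a"
    proof (rule ccontr)
      assume "\<not> w e < w a"
      moreover have "w e \<noteq> w a" using W_inj[OF w, of e a] e(4) by auto
      ultimately have "below a e" using r col_less[OF e(4)] below_range[OF ek] below_less[OF ek] by (auto simp: below_def)
      moreover have "below e b" using below_extend_right[OF ek e(2) r(3) e(3)] .
      ultimately show False using coverD[OF ab] by blast
    qed
    ultimately show ?thesis unfolding Q_def using e by blast
  qed
  have cb: "below c b" using r c col_less[OF c(1)] col_less[OF c(2)] by (auto simp: below_def)
  define k where "k = (LEAST k. col k = col b \<and> below c k)"
  have k: "col k = col b" "below c k" "k \<le> b"
    using LeastI[of "\<lambda>k. col k = col b \<and> below c k" b] Least_le[of "\<lambda>k. col k = col b \<and> below c k" b] cb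
    by (auto simp: k_def)
  have least: "k \<le> k'" if "col k' = col b" "below c k'" for k'
    unfolding k_def using that by (intro Least_le) simp
  obtain e where e: "e = c \<or> below c e" "cover e k" using exists_cover_left[OF k(2)] by blast
  have "col c \<le> col e" using e(1) below_col by auto
  moreover have "col e \<noteq> col b"
  proof
    assume "col e = col b"
    then have "below c e" using e(1) c(2) by auto
    then have "k \<le> e" using least \<open>col e = col b\<close> by blast
    then show False using below_less[OF cover_below[OF e(2)]] by simp
  qed
  ultimately have Qk: "Q k" using QI[OF e(2) k(3,1)] c(1) by simp
  have "Q j" if "k \<le> j" "j \<le> b" for j
    using that
  proof (induction j rule: dec_induct)
    case base show ?case by (rule Qk)
  next
    case (step j)
    have cj: "col j = col b" "col (j + 1) = col b"
      using col_between[of k j b] col_between[of k "j+1" b] step k(1) by auto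
    obtain e where e: "col a < col e" "col e < col b" "cover e j"
      using step unfolding Q_def by auto
    have "col (j + 1) = col j" "col e < col j" using cj e by auto
    then obtain f where f: "f \<noteq> j" "below e f" "below f (j + 1)"
      using exists_after[OF e(3)] step r by auto
    obtain g where g: "g = f \<or> below f g" "cover g (j + 1)" using exists_cover_left[OF f(3)] by blast
    have eg: "below e g" using g(1) f(2) below_trans by blast
    \<comment> \<open>In the column of \<open>b\<close> the element \<open>g\<close> would be above
      \<open>j\<close>, so \<open>e\<close> would not be covered by \<open>j\<close>; the case
      \<open>g = j\<close> is excluded by the choice of \<open>f\<close>.\<close>
    have "col g \<noteq> col b"
    proof
      assume gb: "col g = col b"
      have "g < j + 1" using below_less[OF cover_below[OF g(2)]] .
      moreover have "g \<noteq> j" using g(1) f(1,2) coverD[OF e(3)] by blast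
      ultimately have "g < j" by simp
      then have "below g j" using below_same_col[of g j] gb cj step r below_range[OF eg] below_less[OF eg] by auto
      then show False using coverD[OF e(3) eg] by blast
    qed
    moreover have "col a < col g" using below_col[OF eg] e(1) by simp
    ultimately have "Q (j + 1)" using QI[OF g(2)] step cj by simp
    then show ?case by simp
  qed
  then have "Q b" using k(3) by simp
  then obtain e where e: "col a < col e" "col e < col b" "w e < w a" "cover e b" unfolding Q_def by blast
  have eb: "1 \<le> e" "e < b" using cover_below[OF e(4)] by (auto simp: below_def)
  show False
  proof (rule cover_not_before[OF ab])
    show "col a < col b" using e by simp
    show "1 \<le> e" "e \<le> n" using eb r by auto
    show "word_between J e a b" using e by (simp add: word_between_def)
    show "\<not> below a e" "\<not> below b e" using e(3) eb by (auto simp: below_def)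
    show "f = a" if "below e f" "below f b" for f using coverD[OF e(4)] that by blast
  qed
qed

text \<open>The mirror image: an upper cover with value above \<open>w b\<close> is found at the
  last element of the column of \<open>a\<close> below \<open>c\<close>, and
  \<open>exists_before\<close> passes it up the column to \<open>a\<close>.\<close>

lemma cover_no_intermediate_right:
  assumes ab: "cover a b" and c: "col a < col c" "col c < col b" "w b < w c" shows False
proof -
  have r: "1 \<le> a" "a < b" "b \<le> n" "w a < w b" using cover_below[OF ab] by (auto simp: below_def)
  define Q where "Q k \<longleftrightarrow> (\<exists>e. col a < col e \<and> col e < col b \<and> w b < w e \<and> cover k e)" for k
  have QI: "Q k" if e: "cover k e" "a \<le> k" "col k = col a" "col e < col b" "col e \<noteq> col a" for e k
  proof -
    have ke: "below k e" by (rule cover_below[OF e(1)])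
    have "col a < col e" using below_col[OF ke] e by simp
    moreover have "w b < w e"
    proof (rule ccontr)
      assume "\<not> w b < w e"
      moreover have "w e \<noteq> w b" using W_inj[OF w, of e b] e(4) by auto
      ultimately have "below e b" using r col_less[OF e(4)] below_range[OF ke] below_less[OF ke] by (auto simp: below_def)
      moreover have "below a e" using below_extend_left[OF ke e(2) r(1) e(3)] .
      ultimately show False using coverD[OF ab] by blast
    qed
    ultimately show ?thesis unfolding Q_def using e by blast
  qed
  have ac: "below a c" using r c col_less[OF c(1)] col_less[OF c(2)] by (auto simp: below_def)
  define A where "A = {k. col k = col a \<and> below k c}"
  have fin: "finite A" by (rule finite_subset[of _ "{..n}"]) (auto simp: below_def A_def)
  have aA: "a \<in> A" using ac by (simp add: A_def)
  define k where "k = Max A"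
  have k: "col k = col a" "below k c" "a \<le> k"
    using Max_in[OF fin] Max_ge[OF fin aA] aA by (auto simp: k_def A_def)
  have greatest: "k' \<le> k" if "col k' = col a" "below k' c" for k'
    unfolding k_def using that by (intro Max_ge[OF fin]) (simp add: A_def)
  obtain e where e: "e = c \<or> below e c" "cover k e" using exists_cover_right[OF k(2)] by blast
  have "col e \<le> col c" using e(1) below_col by auto
  moreover have "col e \<noteq> col a"
  proof
    assume "col e = col a"
    then have "below e c" using e(1) c(1) by auto
    then have "e \<le> k" using greatest \<open>col e = col a\<close> by blast
    then show False using below_less[OF cover_below[OF e(2)]] by simp
  qed
  ultimately have Qk: "Q k" using QI[OF e(2) k(3,1)] c(2) by simp
  have "Q j" if "a \<le> j" "j \<le> k" for j
    using that(2,1)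
  proof (induction j rule: inc_induct)
    case base show ?case by (rule Qk)
  next
    case (step j)
    have cj: "col j = col a" "col (j + 1) = col a"
      using col_between[of a j k] col_between[of a "j+1" k] step k(1) by auto
    obtain e where e: "col a < col e" "col e < col b" "cover (j + 1) e"
      using step unfolding Q_def by auto
    have "col (j + 1) = col j" "col j < col e" using cj e by auto
    then obtain f where f: "f \<noteq> j + 1" "below j f" "below f e"
      using exists_before[OF e(3)] step r by auto
    obtain g where g: "g = f \<or> below g f" "cover j g" using exists_cover_right[OF f(2)] by blast
    have ge: "below g e" using g(1) f(3) below_trans by blast
    have "col g \<noteq> col a"
    proof
      assume gb: "col g = col a"
      have "j < g" using below_less[OF cover_below[OF g(2)]] .
      moreover have "g \<noteq> j + 1" using g(1) f(1,3) coverD[OF e(3)] by blast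
      ultimately have "j + 1 < g" by simp
      then have "below (j + 1) g" using below_same_col[of "j+1" g] gb cj below_range[OF ge] below_less[OF ge] by auto
      then show False using coverD[OF e(3)] ge by blast
    qed
    moreover have "col g < col b" using below_col[OF ge] e(2) by simp
    ultimately show ?case using QI[OF g(2)] step cj by simp
  qed
  then have "Q a" using k(3) by simp
  then obtain e where e: "col a < col e" "col e < col b" "w b < w e" "cover a e" unfolding Q_def by blast
  have ae: "a < e" "e \<le> n" using cover_below[OF e(4)] by (auto simp: below_def)
  show False
  proof (rule cover_not_after[OF ab])
    show "col a < col b" using e by simp
    show "1 \<le> e" "e \<le> n" using ae by auto
    show "word_between J e a b" using e by (simp add: word_between_def)
    show "\<not> below e a" "\<not> below e b" using e(3) ae by (auto simp: below_def)
    show "f = b" if "below a f" "below f e" for f using coverD[OF e(4)] that by blast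
  qed
qed

text \<open>An element of a skipped column has its value below \<open>w a\<close>, above
  \<open>w b\<close> or between the two; the last is impossible for a cover, the others are excluded
  by the two preceding lemmas.\<close>

lemma cover_col:
  assumes ab: "cover a b" shows "col b = col a \<or> col b = col a + 1"
proof (rule ccontr)
  assume "\<not> ?thesis"
  moreover have "col a \<le> col b" using below_col[OF cover_below[OF ab]] .
  ultimately have g: "col a + 1 < col b" by linarith
  have r: "1 \<le> a" "a < b" "b \<le> n" using cover_below[OF ab] by (auto simp: below_def)
  obtain c where c: "col c = col a + 1" "a \<le> c" "c \<le> b"
    using block_surj[of a b J "col a + 1"] r g by auto
  have m: "col a < col c" "col c < col b" using c g by auto
  have l: "a < c" "c < b" using col_less m by auto
  have "w c \<noteq> w a" "w c \<noteq> w b" using l W_inj[OF w] by auto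
  moreover have "\<not> (w a < w c \<and> w c < w b)"
    using coverD[OF ab, of c] l r by (auto simp: below_def)
  ultimately show False
    using cover_no_intermediate_left[OF ab m] cover_no_intermediate_right[OF ab m] by linarith
qed

text \<open>Covers between neighbouring columns run in parallel. \<open>exists_before\<close> gives
  an element of the column of \<open>b\<close> above \<open>a\<close>, hence a predecessor
  \<open>b'\<close> of \<open>b\<close> there. If \<open>b'\<close> did not cover \<open>a\<close>,
  the first element \<open>g\<close> of that column above \<open>a\<close> would come earlier, and
  \<open>exists_after\<close> for \<open>a\<close>, \<open>g\<close> would put \<open>a + 1\<close>
  below \<open>g + 1\<close>, hence strictly below an element under \<open>b\<close>, against the
  given cover.\<close>

lemma cover_up:
  assumes c: "cover (a + 1) b" and a: "1 \<le> a" and col: "col (a + 1) = col a" "col b = col a + 1"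
  shows "\<exists>b'. b = b' + 1 \<and> col b' = col b \<and> cover a b'"
proof -
  have b: "a + 1 < b" "b \<le> n" using cover_below[OF c] by (auto simp: below_def)
  obtain d where d: "d \<noteq> a + 1" "below a d" "below d b" using exists_before[OF c a col(1)] col(2) by auto
  have ad: "a + 1 < d" using below_less[OF d(2)] d(1) by simp
  have dn: "d \<le> n" using below_range[OF d(2)] by simp
  have "col d \<noteq> col a"
    using below_same_col[of "a+1" d] ad dn col(1) coverD[OF c, of d] d(3) by auto
  then have cd: "col d = col b" using below_col[OF d(2)] below_col[OF d(3)] col(2) by simp
  obtain b' where b': "b = b' + 1" using b by (metis add.commute less_imp_Suc_add plus_1_eq_Suc add_Suc_right)
  have db: "d \<le> b'" using below_less[OF d(3)] b' by simp
  have cb: "col b' = col b" using col_between[of d b' b] db b' cd by simp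
  have ab': "below a b'" using below_extend_right[OF d(2) db] b b' cb cd by simp
  have b'b: "below b' b" using below_same_col[of b' b] cb b' b by auto
  have no: "\<not> below (a + 1) h" if "h \<le> b'" "col h = col b" for h
    using below_extend_right[of "a+1" h b'] that b b' cb coverD[OF c _] b'b by auto
  have acol: "\<not> below h e" if "below a h" "col h = col a" "e \<le> b'" "col e = col b" for h e
    using below_extend_left[of h e "a+1"] that no[of e] below_less[OF that(1)] col(1) by auto
  have "\<not> below f b'" if f: "below a f" for f
  proof
    assume fb: "below f b'"
    have "col f \<noteq> col a" using acol[OF f _ _ cb] fb by blast
    then have cf: "col f = col b" using below_col[OF f] below_col[OF fb] cb col(2) by simp
    define g where "g = (LEAST g. col g = col b \<and> below a g)"
    have g: "col g = col b" "below a g" "g \<le> f"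
      using LeastI[of "\<lambda>g. col g = col b \<and> below a g" f] Least_le[of "\<lambda>g. col g = col b \<and> below a g" f] f cf
      by (auto simp: g_def)
    have least: "g \<le> k'" if "col k' = col b" "below a k'" for k'
      unfolding g_def using that by (intro Least_le) simp
    have gb: "g < b'" using g(3) below_less[OF fb] by simp
    have cg: "cover a g"
      unfolding cover_def
    proof (intro conjI allI notI)
      fix h assume h: "below a h \<and> below h g"
      then have "col h \<noteq> col a" using acol[of h g] g(1) gb by auto
      then have "col h = col b" using h below_col[of a h] below_col[of h g] g(1) col(2) by auto
      then have "g \<le> h" using least h by blast
      then show False using h below_less[of h g] by simp
    qed (rule g(2))
    have cg1: "col (g + 1) = col g" using col_between[of g "g+1" b'] gb g(1) cb by simp
    obtain e where e: "e \<noteq> g" "below a e" "below e (g + 1)"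
      using exists_after[OF cg _ cg1] gb b b' g(1) col(2) by auto
    have "col e \<noteq> col b" using least[of e] e below_less[OF e(3)] by auto
    then have "col e = col a" using below_col[OF e(2)] below_col[OF e(3)] cg1 g(1) col(2) by simp
    then show False using acol[OF e(2) _ _ _] e(3) gb cg1 g(1) by simp
  qed
  then have "cover a b'" unfolding cover_def using ab' by blast
  then show ?thesis using b' cb by blast
qed

text \<open>Dual to \<open>cover_up\<close>, with \<open>g\<close> the last element of the column of
  \<open>a\<close> below \<open>b + 1\<close> and with the roles of \<open>exists_before\<close> and
  \<open>exists_after\<close> exchanged.\<close>

lemma cover_down:
  assumes c: "cover a b" and b1: "b + 1 \<le> n" and col: "col (b + 1) = col b" "col b = col a + 1"
  shows "col (a + 1) = col a \<and> cover (a + 1) (b + 1)"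
proof -
  have a: "1 \<le> a" "a < b" "b \<le> n" using cover_below[OF c] by (auto simp: below_def)
  obtain d where d: "d \<noteq> b" "below a d" "below d (b + 1)" using exists_after[OF c b1 col(1)] col(2) by auto
  have db: "d < b" using below_less[OF d(3)] d(1) by simp
  have d1: "1 \<le> d" using below_range[OF d(3)] by simp
  have "col d \<noteq> col b"
    using below_same_col[of d b] db d1 a coverD[OF c d(2)] by auto
  then have cd: "col d = col a" using below_col[OF d(2)] below_col[OF d(3)] col by simp
  have ad: "a + 1 \<le> d" using below_less[OF d(2)] by simp
  have ca: "col (a + 1) = col a" using col_between[of a "a+1" d] ad cd by simp
  have ab': "below (a + 1) (b + 1)" using below_extend_left[OF d(3) ad] cd ca by simp
  have aa: "below a (a + 1)" using below_same_col[of a "a+1"] ca a by auto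
  have no: "\<not> below h b" if "a + 1 \<le> h" "col h = col a" for h
    using below_extend_left[of h b "a+1"] that ca coverD[OF c aa] by auto
  have bcol: "\<not> below e h" if "below h (b + 1)" "col h = col b" "a + 1 \<le> e" "col e = col a" for h e
    using below_extend_right[of e h b] that no[of e] below_less[OF that(1)] a by auto
  have "\<not> below f (b + 1)" if f: "below (a + 1) f" for f
  proof
    assume fb: "below f (b + 1)"
    have "col f \<noteq> col b" using bcol[OF fb _ _ ca] f by blast
    then have cf: "col f = col a" using below_col[OF f] below_col[OF fb] ca col by simp
    define A where "A = {k. col k = col a \<and> below k (b + 1)}"
    have fin: "finite A" by (rule finite_subset[of _ "{..n}"]) (auto simp: below_def A_def)
    have fA: "f \<in> A" using fb cf by (simp add: A_def)
    define g where "g = Max A"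
    have g: "col g = col a" "below g (b + 1)" "f \<le> g"
      using Max_in[OF fin] Max_ge[OF fin fA] fA by (auto simp: g_def A_def)
    have greatest: "k' \<le> g" if "col k' = col a" "below k' (b + 1)" for k'
      unfolding g_def using that by (intro Max_ge[OF fin]) (simp add: A_def)
    have ga: "a + 1 < g" using g(3) below_less[OF f] by simp
    have cg: "cover g (b + 1)"
      unfolding cover_def
    proof (intro conjI allI notI)
      fix h assume h: "below g h \<and> below h (b + 1)"
      then have "col h \<noteq> col b" using bcol[of h g] g(1) ga by auto
      then have "col h = col a" using h below_col[of g h] below_col[of h "b+1"] g(1) col by auto
      then have "h \<le> g" using greatest h by blast
      then show False using h below_less[of g h] by simp
    qed (rule g(2))
    obtain g' where g': "g = g' + 1" using ga by (metis add.commute less_imp_Suc_add plus_1_eq_Suc add_Suc_right)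
    have g'a: "a + 1 \<le> g'" using ga g' by simp
    have cg1: "col g' = col a" using col_between[of a g' g] g'a g' g(1) by simp
    obtain e where e: "e \<noteq> g' + 1" "below g' e" "below e (b + 1)"
      using exists_before[of g' "b+1"] cg g' g'a cg1 g(1) col by auto
    have "col e \<noteq> col a" using greatest[of e] e below_less[OF e(2)] g' by auto
    then have "col e = col b" using below_col[OF e(2)] below_col[OF e(3)] cg1 col by simp
    then show False using bcol[OF e(3) _ g'a cg1] e(2) by blast
  qed
  then have "cover (a + 1) (b + 1)" unfolding cover_def using ab' by blast
  then show ?thesis using ca by blast
qed

lemma cover_shift:
  assumes "cover a b" "col b = col a + 1" "b + k \<le> n" "col (b + k) = col b"
  shows "col (a + k) = col a \<and> cover (a + k) (b + k)"
  using assms(3,4)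
proof (induction k)
  case 0 then show ?case using assms by simp
next
  case (Suc k)
  have "col (b + k) = col b" using col_between[of b "b + k" "b + Suc k"] Suc.prems by simp
  then show ?case using Suc cover_down[of "a + k" "b + k"] assms(2) by simp
qed

lemma cover_unique: "cover a b \<Longrightarrow> cover a b' \<Longrightarrow> col b = col b' \<Longrightarrow> b = b'"
  using below_same_col[of b b'] below_same_col[of b' b] coverD[of a b b'] coverD[of a b' b]
    cover_below[of a b] cover_below[of a b'] by (metis below_def linorder_neqE_nat order.strict_trans1 order_less_imp_le)

end

section \<open>Row coordinates of the labels\<close>

context skew_poset
begin

definition top_label :: "nat \<Rightarrow> nat" where
  "top_label j = Min {a \<in> {1..n}. col a = j}"

definition bottom_label :: "nat \<Rightarrow> nat" where
  "bottom_label j = Max {a \<in> {1..n}. col a = j}"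

lemma col_le: "a \<le> n \<Longrightarrow> col a \<le> col n"
  by (rule block_mono)

lemma column_nonempty:
  assumes "1 \<le> j" "j \<le> col n" "1 \<le> n" shows "{a \<in> {1..n}. col a = j} \<noteq> {}"
  using block_surj[of 1 n J j] assms by auto

lemma top_label:
  assumes "1 \<le> j" "j \<le> col n" "1 \<le> n"
  shows "1 \<le> top_label j" "top_label j \<le> n" "col (top_label j) = j"
  using Min_in[OF _ column_nonempty[OF assms]] by (auto simp: top_label_def)

lemma bottom_label:
  assumes "1 \<le> j" "j \<le> col n" "1 \<le> n"
  shows "1 \<le> bottom_label j" "bottom_label j \<le> n" "col (bottom_label j) = j"
  using Max_in[OF _ column_nonempty[OF assms]] by (auto simp: bottom_label_def)

lemma top_label_le: "1 \<le> a \<Longrightarrow> a \<le> n \<Longrightarrow> col a = j \<Longrightarrow> top_label j \<le> a"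
  unfolding top_label_def by (intro Min_le) auto

lemma bottom_label_ge: "1 \<le> a \<Longrightarrow> a \<le> n \<Longrightarrow> col a = j \<Longrightarrow> a \<le> bottom_label j"
  unfolding bottom_label_def by (intro Max_ge) auto

lemma col_eq_iff:
  assumes "1 \<le> j" "j \<le> col n" "1 \<le> n"
  shows "1 \<le> a \<and> a \<le> n \<and> col a = j \<longleftrightarrow> top_label j \<le> a \<and> a \<le> bottom_label j"
proof
  assume "top_label j \<le> a \<and> a \<le> bottom_label j"
  then show "1 \<le> a \<and> a \<le> n \<and> col a = j"
    using col_between[of "top_label j" a "bottom_label j"] top_label[OF assms] bottom_label[OF assms] by auto
qed (auto intro: top_label_le bottom_label_ge)

definition linked :: "nat \<Rightarrow> nat \<Rightarrow> bool" where
  "linked j b \<longleftrightarrow> cover (top_label j) b \<and> col b = j + 1"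

text \<open>Column \<open>j\<close> starts \<open>col_shift j\<close> rows below column \<open>j + 1\<close>; when no cover joins the two columns, column
  \<open>j\<close> starts just below the end of column \<open>j + 1\<close>.\<close>

definition col_shift :: "nat \<Rightarrow> nat" where
  "col_shift j = (if \<exists>b. linked j b then (THE b. linked j b) - top_label (j + 1)
     else bottom_label (j + 1) - top_label (j + 1) + 1)"

definition col_top :: "nat \<Rightarrow> nat" where
  "col_top j = 1 + (\<Sum>i\<in>{j..<col n}. col_shift i)"

definition row :: "nat \<Rightarrow> nat" where
  "row a = col_top (col a) + (a - top_label (col a))"

lemma col_shift_linked: assumes "linked j b" shows "col_shift j = b - top_label (j + 1)"
proof -
  have "(THE b. linked j b) = b"
    by (rule the_equality[where P = "linked j", OF assms]) (use assms cover_unique in \<open>auto simp: linked_def\<close>)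
  then show ?thesis using assms by (auto simp: col_shift_def)
qed

lemma col_top_step: assumes "j < col n" shows "col_top j = col_top (j + 1) + col_shift j"
proof -
  have "{j..<col n} = insert j {j + 1..<col n}" using assms by auto
  then show ?thesis by (simp add: col_top_def)
qed

lemma col_top_antimono: "j \<le> j' \<Longrightarrow> col_top j' \<le> col_top j"
  unfolding col_top_def by (simp, intro sum_mono2) auto

text \<open>Climb with \<open>cover_up\<close> to the top of the column: if any cover joins two
  neighbouring columns, the top of the left one is linked, and all covers have the same offset from
  this link.\<close>

lemma cover_top:
  assumes "cover a b" "col b = col a + 1"
  shows "\<exists>b0. linked (col a) b0 \<and> b = b0 + (a - top_label (col a))"
  using assms
proof (induction "a - top_label (col a)" arbitrary: a b)
  case 0
  have "1 \<le> a" "a \<le> n" using cover_below[OF 0(2)] by (auto simp: below_def)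
  then have "top_label (col a) = a" using 0(1) top_label_le[of a "col a"] by simp
  then show ?case using 0 by (auto simp: linked_def)
next
  case (Suc d)
  have a: "1 \<le> a" "a \<le> n" using cover_below[OF Suc(3)] by (auto simp: below_def)
  have j: "1 \<le> col a" "col a \<le> col n" "1 \<le> n" using a col_le block_ge_1[of J a] by auto
  note f = top_label[OF j]
  have fa: "top_label (col a) < a" using Suc(2) by simp
  define a' where "a' = a - 1"
  have a': "a = a' + 1" "top_label (col a) \<le> a'" using fa by (auto simp: a'_def)
  have ca: "col a' = col a" using col_between[of "top_label (col a)" a' a] a' f by simp
  obtain b' where b': "b = b' + 1" "col b' = col b" "cover a' b'"
    using cover_up[of a' b] Suc(3,4) a' ca f(1) by auto
  have "d = a' - top_label (col a')" using Suc(2) a' ca by simp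
  from Suc(1)[OF this b'(3)] obtain b0 where "linked (col a') b0" "b' = b0 + (a' - top_label (col a'))"
    using b' Suc(4) ca by auto
  then show ?case using b' a' ca by (intro exI[of _ b0]) auto
qed

lemma cover_row: assumes "cover a b" "col b = col a + 1" shows "row a = row b"
proof -
  have r: "1 \<le> a" "a \<le> n" "1 \<le> b" "b \<le> n" using cover_below[OF assms(1)] by (auto simp: below_def)
  obtain b0 where b0: "linked (col a) b0" "b = b0 + (a - top_label (col a))" using cover_top[OF assms] by blast
  have b01: "1 \<le> b0" "b0 \<le> n" using cover_below[of "top_label (col a)" b0] b0(1) by (auto simp: below_def linked_def)
  have l: "top_label (col b) \<le> b0" using top_label_le[OF b01, of "col b"] b0(1) assms(2) by (simp add: linked_def)
  have "col a < col n" using col_le[OF r(4)] assms(2) by simp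
  then have "col_top (col a) = col_top (col b) + (b0 - top_label (col b))"
    using col_top_step[of "col a"] col_shift_linked[OF b0(1)] assms(2) by simp
  moreover have "b - top_label (col b) = (b0 - top_label (col b)) + (a - top_label (col a))"
    using b0(2) l by linarith
  ultimately show ?thesis unfolding row_def by linarith
qed

lemma linked_cover:
  assumes "linked j b0" "1 \<le> j" "b0 + k \<le> n" "col (b0 + k) = j + 1"
  shows "col (top_label j + k) = j \<and> cover (top_label j + k) (b0 + k)"
proof -
  have c: "cover (top_label j) b0" "col b0 = j + 1" using assms(1) by (auto simp: linked_def)
  have r: "1 \<le> b0" "b0 \<le> n" using cover_below[OF c(1)] by (auto simp: below_def)
  have "col (top_label j) = j" using top_label(3)[OF assms(2)] col_le[OF r(2)] c(2) r by simp
  then show ?thesis using cover_shift[OF c(1), of k] assms(3,4) c(2) by simp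
qed

text \<open>Columns without a link share no row, by the choice of \<open>col_shift\<close>. For
  linked columns, go down in parallel from the link to the row in question.\<close>

lemma row_cover:
  assumes ab: "1 \<le> a" "a \<le> n" "1 \<le> b" "b \<le> n" and col: "col b = col a + 1" and eq: "row a = row b"
  shows "cover a b"
proof -
  have n: "1 \<le> n" using ab by simp
  have lt: "col a < col n" using col_le[OF ab(4)] col by simp
  have ta: "top_label (col a) \<le> a" "top_label (col b) \<le> b" using top_label_le ab by auto
  have e: "col_shift (col a) + (a - top_label (col a)) = b - top_label (col b)"
    using eq col_top_step[OF lt] col unfolding row_def by simp
  have "\<exists>b0. linked (col a) b0"
  proof (rule ccontr)
    assume "\<not> ?thesis"
    then have "col_shift (col a) = bottom_label (col b) - top_label (col b) + 1"
      using col by (simp add: col_shift_def)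
    moreover have "b \<le> bottom_label (col b)" using bottom_label_ge ab by auto
    ultimately show False using e ta by linarith
  qed
  then obtain b0 where b0: "linked (col a) b0" by blast
  have b01: "1 \<le> b0" "b0 \<le> n" using cover_below[of "top_label (col a)" b0] b0 by (auto simp: below_def linked_def)
  have l: "top_label (col b) \<le> b0" using top_label_le[OF b01, of "col b"] b0 col by (simp add: linked_def)
  have b: "b = b0 + (a - top_label (col a))" using e col_shift_linked[OF b0] l ta col by simp
  have "cover (top_label (col a) + (a - top_label (col a))) (b0 + (a - top_label (col a)))"
    using linked_cover[OF b0 block_ge_1, of "a - top_label (col a)"] ab(4) col b by simp
  then show ?thesis using b ta by simp
qed

definition col_bottom :: "nat \<Rightarrow> nat" where
  "col_bottom j = row (bottom_label j)"

lemma row_bounds: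
  assumes "1 \<le> a" "a \<le> n" shows "col_top (col a) \<le> row a" "row a \<le> col_bottom (col a)"
proof -
  have j: "1 \<le> col a" "col a \<le> col n" "1 \<le> n" using assms col_le block_ge_1[of J a] by auto
  show "col_top (col a) \<le> row a" by (simp add: row_def)
  show "row a \<le> col_bottom (col a)"
    using bottom_label[OF j] bottom_label_ge[OF assms refl] by (simp add: col_bottom_def row_def)
qed

lemma row_surj:
  assumes j: "1 \<le> j" "j \<le> col n" "1 \<le> n" and i: "col_top j \<le> i" "i \<le> col_bottom j"
  shows "\<exists>a. 1 \<le> a \<and> a \<le> n \<and> col a = j \<and> row a = i"
proof -
  note t = top_label[OF j] and b = bottom_label[OF j]
  let ?a = "top_label j + (i - col_top j)"
  have "?a \<le> bottom_label j"
    using i top_label_le[OF b] b(3) t(3) by (simp add: col_bottom_def row_def)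
  then have "1 \<le> ?a \<and> ?a \<le> n \<and> col ?a = j" using col_eq_iff[OF j, of ?a] by simp
  moreover from this have "row ?a = i" using i(1) by (simp add: row_def)
  ultimately show ?thesis by blast
qed

text \<open>A link is carried down to the last element of the right column, whose row then also
  meets the left column. Without a link the left column lies entirely below the right one.\<close>

lemma col_bottom_step:
  assumes j: "1 \<le> j" "j < col n" "1 \<le> n" shows "col_bottom (j + 1) \<le> col_bottom j"
proof -
  have j1: "1 \<le> j" "j \<le> col n" "1 \<le> n" and j2: "1 \<le> j + 1" "j + 1 \<le> col n" "1 \<le> n" using j by auto
  note t1 = top_label[OF j1] and b1 = bottom_label[OF j1] and t2 = top_label[OF j2] and b2 = bottom_label[OF j2]
  show ?thesis
  proof (cases "\<exists>b0. linked j b0")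
    case False
    then have "col_bottom (j + 1) < col_top j"
      using col_top_step[OF j(2)] b2 by (simp add: col_shift_def col_bottom_def row_def)
    also have "\<dots> \<le> col_bottom j" using b1 by (simp add: col_bottom_def row_def)
    finally show ?thesis by simp
  next
    case True
    then obtain b0 where b0: "linked j b0" by blast
    have b01: "1 \<le> b0" "b0 \<le> n" "col b0 = j + 1"
      using cover_below[of "top_label j" b0] b0 by (auto simp: below_def linked_def)
    let ?k = "bottom_label (j + 1) - b0"
    have e: "b0 + ?k = bottom_label (j + 1)" using bottom_label_ge[OF b01] by simp
    have c: "col (top_label j + ?k) = j" "cover (top_label j + ?k) (bottom_label (j + 1))"
      using linked_cover[OF b0 j(1), of ?k] e b2 by auto
    have "col_bottom (j + 1) = row (top_label j + ?k)"
      using cover_row[OF c(2)] b2(3) c(1) by (simp add: col_bottom_def)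
    also have "\<dots> \<le> col_bottom j"
      using row_bounds(2)[of "top_label j + ?k"] cover_below[OF c(2)] c(1) by (auto simp: below_def)
    finally show ?thesis .
  qed
qed

lemma col_bottom_antimono:
  assumes "1 \<le> j" "j \<le> j'" "j' \<le> col n" "1 \<le> n" shows "col_bottom j' \<le> col_bottom j"
  using assms(2,3)
proof (induction j' rule: dec_induct)
  case (step k)
  then show ?case using col_bottom_step[of k] assms(1,4) by simp
qed simp

lemma row_same_col:
  assumes "1 \<le> a" "a < b" "b \<le> n" "col a = col b" shows "row a < row b"
  using top_label_le[of a "col a"] assms by (simp add: row_def)

lemma below_row: "below a b \<Longrightarrow> row a \<le> row b"
proof (induction "b - a" arbitrary: a b rule: less_induct)
  case less
  note ab = less.prems
  show ?case
  proof (cases "cover a b")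
    case True
    then show ?thesis using cover_col[OF True] cover_row[OF True] row_same_col[of a b] ab
      by (auto simp: below_def)
  next
    case False
    then obtain c where c: "below a c" "below c b" using ab unfolding cover_def by blast
    then have "a < c" "c < b" using below_less by auto
    then have "c - a < b - a" "b - c < b - a" by auto
    then show ?thesis using less.hyps[OF _ c(1)] less.hyps[OF _ c(2)] by simp
  qed
qed

text \<open>Walk to the right along the row of \<open>a\<close>. Tops and bottoms of columns weakly
  ascend towards the right, so each column up to that of \<open>b\<close> meets this row, and
  neighbours in it are covers by \<open>row_cover\<close>.\<close>

lemma row_below:
  assumes "1 \<le> a" "a \<le> n" "1 \<le> b" "b \<le> n" "col a < col b" "row a \<le> row b" shows "below a b"
  using assms
proof (induction "col b - col a" arbitrary: a)
  case (Suc d)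
  have n: "1 \<le> n" using Suc.prems by simp
  let ?j = "col a + 1"
  have j: "1 \<le> ?j" "?j \<le> col n" "1 \<le> n" using Suc.prems col_le[of b] by auto
  have "col_top ?j \<le> row a" using col_top_antimono[of "col a" ?j] row_bounds(1)[of a] Suc.prems by simp
  moreover have "row a \<le> col_bottom ?j"
    using row_bounds(2)[of b] col_bottom_antimono[of ?j "col b"] col_le[of b] Suc.prems n by auto
  ultimately obtain c where c: "1 \<le> c" "c \<le> n" "col c = ?j" "row c = row a" using row_surj[OF j] by blast
  have ac: "below a c" using row_cover[of a c] c Suc.prems cover_below by auto
  show ?case
  proof (cases "col c = col b")
    case True
    have "c \<le> b" using row_same_col[of b c] c Suc.prems True by (metis leD leI)
    then show ?thesis using below_extend_right[OF ac] Suc.prems True by simp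
  next
    case False
    then have "below c b" using Suc.hyps(1)[of c] Suc.hyps(2) Suc.prems c by simp
    then show ?thesis using ac below_trans by blast
  qed
qed simp

text \<open>The labels follow the column reading order (\<open>label_less_iff\<close>), the values
  of \<open>w\<close> the row reading order; so \<open>w\<close> is the passage from
  \<open>tau_col\<close> to \<open>tau_row\<close>.\<close>

lemma w_less_iff:
  assumes a: "1 \<le> a" "a \<le> n" and b: "1 \<le> b" "b \<le> n"
  shows "w a < w b \<longleftrightarrow> row a < row b \<or> row a = row b \<and> col a < col b"
proof -
  have *: "w c < w d \<longleftrightarrow> row c < row d \<or> row c = row d \<and> col c < col d"
    if cd: "1 \<le> c" "c < d" "d \<le> n" for c d
  proof (cases "col c = col d")
    case True
    then show ?thesis using row_same_col[OF cd] below_same_col[OF cd] by (auto simp: below_def)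
  next
    case False
    then have "col c < col d" using block_mono[of c d J] cd by simp
    moreover have "w c < w d \<longleftrightarrow> below c d" using cd by (auto simp: below_def)
    ultimately show ?thesis using below_row[of c d] row_below[of c d] cd by auto
  qed
  consider "a < b" | "a = b" | "b < a" by linarith
  then show ?thesis
  proof cases
    case 3
    have ne: "w a \<noteq> w b" using 3 W_inj[OF w, of a b] by simp
    have "\<not> (row a = row b \<and> col a = col b)" using row_same_col[of b a] 3 a b by fastforce
    then show ?thesis using *[of b a] 3 a b ne by auto
  qed (use * a b in auto)
qed

lemma label_less_iff:
  assumes a: "1 \<le> a" "a \<le> n" and b: "1 \<le> b" "b \<le> n"
  shows "a < b \<longleftrightarrow> col a < col b \<or> col a = col b \<and> row a < row b"
proof -
  consider "a < b" | "a = b" | "b < a" by linarith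
  then show ?thesis
  proof cases
    case 1 then show ?thesis using block_mono[of a b J] row_same_col[of a b] a b by auto
  next
    case 3 then show ?thesis using block_mono[of b a J] row_same_col[of b a] a b by fastforce
  qed simp
qed

end

section \<open>Skew diagrams\<close>

lemma diagram_Sigma: "diagram la = Sigma {1..length la} (\<lambda>i. {1..part la i})"
  by (auto simp: diagram_def part_def split: if_splits)

lemma finite_diagram [simp]: "finite (diagram la)"
  unfolding diagram_Sigma by simp

lemma card_diagram: "card (diagram la) = sum_list la"
proof -
  have "card (diagram la) = (\<Sum>i\<in>{1..length la}. part la i)" unfolding diagram_Sigma by simp
  also have "\<dots> = (\<Sum>k<length la. part la (Suc k))" by (simp add: sum.atLeast1_atMost_eq)
  also have "\<dots> = (\<Sum>i<length la. la ! i)" by (intro sum.cong) (auto simp: part_def)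
  also have "\<dots> = sum_list la" by (simp add: sum_list_sum_nth atLeast0LessThan)
  finally show ?thesis .
qed

lemma diagram_subset: "(\<And>i. 1 \<le> i \<Longrightarrow> part mu i \<le> part la i) \<Longrightarrow> diagram mu \<subseteq> diagram la"
  by (auto simp: diagram_def) (meson One_nat_def le_trans)

lemma card_skew_diagram:
  assumes "\<And>i. 1 \<le> i \<Longrightarrow> part mu i \<le> part la i"
  shows "sum_list la = sum_list mu + card (skew_diagram la mu)"
proof -
  note s = diagram_subset[of mu la, OF assms]
  have "card (skew_diagram la mu) = card (diagram la) - card (diagram mu)"
    unfolding skew_diagram_def using s by (intro card_Diff_subset) auto
  moreover have "card (diagram mu) \<le> card (diagram la)" using s by (intro card_mono) auto
  ultimately show ?thesis by (simp add: card_diagram)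
qed

lemma initial_segment_card:
  assumes A: "A \<subseteq> {1..m}" and down: "\<And>i j. j \<in> A \<Longrightarrow> 1 \<le> i \<Longrightarrow> i \<le> j \<Longrightarrow> i \<in> A"
  shows "1 \<le> j \<and> j \<le> card A \<longleftrightarrow> j \<in> A"
proof -
  have fin: "finite A" using A by (rule finite_subset) simp
  show ?thesis
  proof (cases "A = {}")
    case False
    have "A = {1..Max A}"
    proof (intro equalityI subsetI)
      fix i assume "i \<in> A" then show "i \<in> {1..Max A}" using A Max_ge[OF fin] by auto
    next
      fix i assume "i \<in> {1..Max A}" then show "i \<in> A" using down[OF Max_in[OF fin False]] by simp
    qed
    then obtain k where "A = {1..k}" ..
    then show ?thesis by auto
  qed simp
qed

lemma part_map_upt: "part (map f [1..<b + 1]) i = (if 1 \<le> i \<and> i \<le> b then f i else 0)"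
  by (auto simp: part_def nth_upt simp del: upt_Suc)

lemma is_partition_map_upt:
  assumes "\<And>i j. 1 \<le> i \<Longrightarrow> i \<le> j \<Longrightarrow> j \<le> b \<Longrightarrow> f j \<le> f i" "\<And>i. 1 \<le> i \<Longrightarrow> i \<le> b \<Longrightarrow> 0 < f i"
  shows "is_partition (map f [1..<b + 1])"
  unfolding is_partition_def
proof
  show "sorted_wrt (\<ge>) (map f [1..<b + 1])"
    unfolding sorted_wrt_iff_nth_less using assms(1) by (auto simp: nth_upt simp del: upt_Suc)
  show "0 \<notin> set (map f [1..<b + 1])" using assms(2) by fastforce
qed

text \<open>Conjugation of the column data: row \<open>i\<close> of \<open>la\<close> counts the
  columns that reach down to row \<open>i\<close> or beyond, row \<open>i\<close> of
  \<open>mu\<close> those that have not begun yet. Monotonicity of \<open>top\<close> and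
  \<open>bot\<close> makes both sets of columns initial segments.\<close>

lemma exists_skew_partition:
  fixes top bot :: "nat \<Rightarrow> nat"
  assumes m: "1 \<le> m"
    and pos: "\<And>j. 1 \<le> j \<Longrightarrow> j \<le> m \<Longrightarrow> 1 \<le> top j"
    and le: "\<And>j. 1 \<le> j \<Longrightarrow> j \<le> m \<Longrightarrow> top j \<le> bot j"
    and topa: "\<And>j j'. 1 \<le> j \<Longrightarrow> j \<le> j' \<Longrightarrow> j' \<le> m \<Longrightarrow> top j' \<le> top j"
    and bota: "\<And>j j'. 1 \<le> j \<Longrightarrow> j \<le> j' \<Longrightarrow> j' \<le> m \<Longrightarrow> bot j' \<le> bot j"
  shows "\<exists>la mu. skew_partition (card (skew_diagram la mu)) la mu \<and>
    skew_diagram la mu = {(i, j). 1 \<le> j \<and> j \<le> m \<and> top j \<le> i \<and> i \<le> bot j}"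
proof -
  define A where "A i = {j \<in> {1..m}. i \<le> bot j}" for i
  define B where "B i = {j \<in> {1..m}. i < top j}" for i
  \<comment> \<open>The first column has the largest \<open>bot\<close> and \<open>top\<close>, so
    the counts vanish beyond \<open>bot 1\<close> and \<open>top 1 - 1\<close>; cutting there leaves
    positive parts only.\<close>
  define la where "la = map (\<lambda>i. card (A i)) [1..<bot 1 + 1]"
  define mu where "mu = map (\<lambda>i. card (B i)) [1..<(top 1 - 1) + 1]"
  have A0: "A i = {}" if "\<not> i \<le> bot 1" for i
    using that bota[of 1] by (force simp: A_def)
  have B0: "B i = {}" if "\<not> i \<le> top 1 - 1" for i
    using that topa[of 1] by (force simp: B_def)
  have pla: "part la i = card (A i)" if "1 \<le> i" for i
    unfolding la_def part_map_upt using that A0[of i] by auto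
  have pmu: "part mu i = card (B i)" if "1 \<le> i" for i
    unfolding mu_def part_map_upt using that B0[of i] by auto
  have jA: "1 \<le> j \<and> j \<le> card (A i) \<longleftrightarrow> j \<in> A i" for i j
  proof (rule initial_segment_card)
    show "A i \<subseteq> {1..m}" by (auto simp: A_def)
    show "k \<in> A i" if "l \<in> A i" "1 \<le> k" "k \<le> l" for k l
      using that bota[of k l] by (auto simp: A_def)
  qed
  have jB: "1 \<le> j \<and> j \<le> card (B i) \<longleftrightarrow> j \<in> B i" for i j
  proof (rule initial_segment_card)
    show "B i \<subseteq> {1..m}" by (auto simp: B_def)
    show "k \<in> B i" if "l \<in> B i" "1 \<le> k" "k \<le> l" for k l
      using that topa[of k l] by (auto simp: B_def)
  qed
  have fin: "finite (A i)" "finite (B i)" for i by (auto simp: A_def B_def)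
  have "is_partition la" unfolding la_def
  proof (rule is_partition_map_upt)
    show "card (A j) \<le> card (A i)" if "i \<le> j" for i j
      using that fin by (intro card_mono) (auto simp: A_def)
    show "0 < card (A i)" if "1 \<le> i" "i \<le> bot 1" for i
      using that m fin by (auto simp: card_gt_0_iff A_def)
  qed
  moreover have "is_partition mu" unfolding mu_def
  proof (rule is_partition_map_upt)
    show "card (B j) \<le> card (B i)" if "i \<le> j" for i j
      using that fin by (intro card_mono) (auto simp: B_def)
    show "0 < card (B i)" if "1 \<le> i" "i \<le> top 1 - 1" for i
      using that m fin by (auto simp: card_gt_0_iff B_def intro!: exI[of _ 1])
  qed
  moreover have sub: "part mu i \<le> part la i" if "1 \<le> i" for i
  proof -
    have "j \<in> A i" if "j \<in> B i" for j using that le[of j] by (auto simp: A_def B_def)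
    then show ?thesis unfolding pla[OF that] pmu[OF that] using fin by (intro card_mono) auto
  qed
  ultimately have "skew_partition (card (skew_diagram la mu)) la mu"
    unfolding skew_partition_def using card_skew_diagram[of mu la] by blast
  moreover have "skew_diagram la mu = {(i, j). 1 \<le> j \<and> j \<le> m \<and> top j \<le> i \<and> i \<le> bot j}"
  proof -
    have "(i, j) \<in> skew_diagram la mu \<longleftrightarrow> 1 \<le> i \<and> j \<in> A i \<and> j \<notin> B i" for i j
      using jA[of j i] jB[of j i] pla[of i] pmu[of i]
      by (auto simp: skew_diagram_def diagram_def)
    moreover have "1 \<le> i \<and> j \<in> A i \<and> j \<notin> B i \<longleftrightarrow> 1 \<le> j \<and> j \<le> m \<and> top j \<le> i \<and> i \<le> bot j" for i j
      using pos[of j] by (auto simp: A_def B_def)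
    ultimately show ?thesis by auto
  qed
  ultimately show ?thesis by blast
qed

lemma part_antimono:
  assumes "is_partition la" "1 \<le> i" "i \<le> i'" shows "part la i' \<le> part la i"
proof (cases "i' \<le> length la")
  case True
  then show ?thesis using assms sorted_wrt_nth_less[of "(\<ge>)" la "i - 1" "i' - 1"]
    by (cases "i = i'") (auto simp: part_def is_partition_def)
qed (simp add: part_def)

section \<open>Tableaux of a skew shape\<close>

locale skew_shape =
  fixes n :: nat and la mu :: "nat list"
  assumes skew: "skew_partition n la mu"
begin

abbreviation D :: "(nat \<times> nat) set" where "D \<equiv> skew_diagram la mu"
abbreviation tc :: "nat \<times> nat \<Rightarrow> nat" where "tc \<equiv> tau_col la mu"
abbreviation tr :: "nat \<times> nat \<Rightarrow> nat" where "tr \<equiv> tau_row la mu"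
abbreviation w :: "nat \<Rightarrow> nat" where "w \<equiv> perm n la mu tr"
abbreviation J :: "(nat \<Rightarrow> nat) set" where "J \<equiv> J_skew n la mu"

lemma finite_D [simp]: "finite D"
  by (simp add: skew_diagram_def)

lemma card_D: "card D = n"
  using skew card_skew_diagram[of mu la] by (simp add: skew_partition_def)

lemma D_iff: "(i, j) \<in> D \<longleftrightarrow> 1 \<le> i \<and> 1 \<le> j \<and> part mu i < j \<and> j \<le> part la i"
  by (auto simp: skew_diagram_def diagram_def)

text \<open>Parts decrease with the row, so being outside \<open>mu\<close> is inherited to the
  lower right and being inside \<open>la\<close> to the upper left.\<close>

lemma D_rectangle:
  assumes "(i, j) \<in> D" "(i', j') \<in> D" "i \<le> a" "a \<le> i'" "j \<le> b" "b \<le> j'" shows "(a, b) \<in> D"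
proof -
  have "is_partition la" "is_partition mu" using skew by (auto simp: skew_partition_def)
  then have "part mu a \<le> part mu i" "part la i' \<le> part la a"
    using part_antimono assms unfolding D_iff by (meson le_trans)+
  then show ?thesis using assms unfolding D_iff by linarith
qed

lemma tc_rank:
  "p \<in> D \<Longrightarrow> q' \<in> D \<Longrightarrow> tc p < tc q' \<longleftrightarrow> snd p < snd q' \<or> snd p = snd q' \<and> fst p < fst q'"
  "bij_betw tc D {1..n}"
proof -
  let ?R = "\<lambda>p q'. snd p < snd q' \<or> snd p = snd q' \<and> fst p < (fst q' :: nat)"
  have rk: "tc p = card {d \<in> D. ?R d p \<or> d = p}" if "p \<in> D" for p
    using that unfolding tau_col_def by (auto simp: split_beta prod_eq_iff intro!: arg_cong[where f = card])
  note r = rank_bij[of D ?R tc, OF finite_D _ _ _ rk]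
  show "p \<in> D \<Longrightarrow> q' \<in> D \<Longrightarrow> tc p < tc q' \<longleftrightarrow> ?R p q'"
    by (rule r(1)) (auto simp: prod_eq_iff)
  show "bij_betw tc D {1..n}"
    unfolding card_D[symmetric] by (rule r(2)) (auto simp: prod_eq_iff)
qed

lemma tr_rank:
  "p \<in> D \<Longrightarrow> q' \<in> D \<Longrightarrow> tr p < tr q' \<longleftrightarrow> fst p < fst q' \<or> fst p = fst q' \<and> snd p < snd q'"
  "bij_betw tr D {1..n}"
proof -
  let ?R = "\<lambda>p q'. fst p < fst q' \<or> fst p = fst q' \<and> snd p < (snd q' :: nat)"
  have rk: "tr p = card {d \<in> D. ?R d p \<or> d = p}" if "p \<in> D" for p
    using that unfolding tau_row_def by (auto simp: split_beta prod_eq_iff intro!: arg_cong[where f = card])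
  note r = rank_bij[of D ?R tr, OF finite_D _ _ _ rk]
  show "p \<in> D \<Longrightarrow> q' \<in> D \<Longrightarrow> tr p < tr q' \<longleftrightarrow> ?R p q'"
    by (rule r(1)) (auto simp: prod_eq_iff)
  show "bij_betw tr D {1..n}"
    unfolding card_D[symmetric] by (rule r(2)) (auto simp: prod_eq_iff)
qed

definition cell :: "nat \<Rightarrow> nat \<times> nat" where
  "cell a = inv_into D tc a"

lemma tc_range: "p \<in> D \<Longrightarrow> 1 \<le> tc p \<and> tc p \<le> n"
  using bij_betwE[OF tc_rank(2)] by auto

lemma cell: "1 \<le> a \<Longrightarrow> a \<le> n \<Longrightarrow> cell a \<in> D" "1 \<le> a \<Longrightarrow> a \<le> n \<Longrightarrow> tc (cell a) = a"
  "p \<in> D \<Longrightarrow> cell (tc p) = p"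
  using tc_rank(2) unfolding cell_def bij_betw_def
  by (auto intro: inv_into_into f_inv_into_f inv_into_f_f)

lemma perm_eqI:
  assumes u: "u \<in> W n" "\<And>p. p \<in> D \<Longrightarrow> u (tc p) = tr p" shows "w = u"
  unfolding perm_def
proof (rule the_equality)
  have "tr p = undefined" if "p \<notin> D" for p using that by (cases p) (simp add: tau_row_def)
  then have "compose D u tc = tr" using u(2) by (auto simp: compose_def fun_eq_iff)
  then show "u \<in> W n \<and> tab_act la mu u tc = tr" using u(1) by (simp add: tab_act_def)
  fix u' assume u': "u' \<in> W n \<and> tab_act la mu u' tc = tr"
  show "u' = u"
  proof (rule W_eqI[of _ n])
    fix a assume a: "1 \<le> a" "a \<le> n"
    have "u' (tc (cell a)) = tr (cell a)"
      using u' cell(1)[OF a] by (auto simp: tab_act_def compose_def dest: fun_cong[where x = "cell a"])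
    then show "u' a = u a" using u(2)[OF cell(1)[OF a]] cell(2)[OF a] by simp
  qed (use u u' in auto)
qed

lemma w_props: "w \<in> W n" "\<And>p. p \<in> D \<Longrightarrow> w (tc p) = tr p"
proof -
  define u where "u a = (if a \<in> {1..n} then tr (cell a) else a)" for a
  have "u permutes {1..n}"
  proof (rule inj_imp_permutes)
    show "inj_on u {1..n}"
    proof (rule inj_onI)
      fix a b assume ab: "a \<in> {1..n}" "b \<in> {1..n}" "u a = u b"
      have "tc (cell a) = a" "tc (cell b) = b" using cell(2)[of a] cell(2)[of b] ab(1,2) by simp_all
      moreover from ab have "cell a = cell b"
        using inj_onD[OF bij_betw_imp_inj_on[OF tr_rank(2)], of "cell a" "cell b"] cell(1) by (simp add: u_def)
      ultimately show "a = b" by metis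
    qed
    show "u a \<in> {1..n}" if "a \<in> {1..n}" for a
      using that bij_betwE[OF tr_rank(2)] cell(1)[of a] unfolding u_def by simp
    show "u a = a" if "a \<notin> {1..n}" for a using that unfolding u_def by (rule if_not_P)
  qed simp
  then have 1: "u \<in> W n" by (simp add: W_def)
  have 2: "u (tc p) = tr p" if "p \<in> D" for p using tc_range[OF that] cell(3)[OF that] by (simp add: u_def)
  have "w = u" by (rule perm_eqI[OF 1 2])
  then show "w \<in> W n" "\<And>p. p \<in> D \<Longrightarrow> w (tc p) = tr p" using 1 2 by auto
qed

lemma J_S: "J \<subseteq> S n"
  by (auto simp: J_skew_def simple_in_S)

lemma simple_in_J:
  assumes "1 \<le> a" "a < n" shows "simple a \<in> J \<longleftrightarrow> snd (cell a) = snd (cell (a + 1))"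
proof
  assume "simple a \<in> J"
  then obtain i i' j where c: "(i, j) \<in> D" "(i', j) \<in> D" "tc (i, j) = a" "tc (i', j) = a + 1"
    unfolding J_skew_def by (auto simp: simple_eq_iff)
  then show "snd (cell a) = snd (cell (a + 1))" using cell(3)[OF c(1)] cell(3)[OF c(2)] by simp
next
  assume e: "snd (cell a) = snd (cell (a + 1))"
  obtain i j where c: "cell a = (i, j)" by (cases "cell a")
  moreover from this obtain i' where c': "cell (a + 1) = (i', j)" using e by (cases "cell (a + 1)") auto
  ultimately have "(i, j) \<in> D \<and> (i', j) \<in> D \<and> tc (i, j) = a \<and> tc (i', j) = a + 1"
    using cell(1,2)[of a] cell(1,2)[of "a + 1"] assms by simp
  then show "simple a \<in> J" unfolding J_skew_def using assms by blast
qed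

lemma block_le_iff:
  assumes "1 \<le> a" "a \<le> b" "b \<le> n" shows "block J a = block J b \<longleftrightarrow> snd (cell a) = snd (cell b)"
  using assms(2,3)
proof (induction b rule: dec_induct)
  case (step b)
  have b: "1 \<le> b" "b < n" using step assms(1) by auto
  have mono: "snd (cell c) \<le> snd (cell d)" if "1 \<le> c" "c \<le> d" "d \<le> n" for c d
    using that tc_rank(1)[OF cell(1)[of c] cell(1)[of d]] cell(2)[of c] cell(2)[of d] by (cases "c = d") auto
  have "block J a \<le> block J b" "snd (cell a) \<le> snd (cell b)" "snd (cell b) \<le> snd (cell (b + 1))"
    using block_mono[of a b J] mono[of a b] mono[of b "b + 1"] step b assms(1) by auto
  then show ?case using step.IH step.prems block_Suc[of b J] simple_in_J[OF b] b by auto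
qed simp

lemma block_cell:
  assumes "p \<in> D" "q' \<in> D" shows "block J (tc p) = block J (tc q') \<longleftrightarrow> snd p = snd q'"
proof (cases "tc p \<le> tc q'")
  case True
  then show ?thesis using block_le_iff[of "tc p" "tc q'"] tc_range assms cell(3) by simp
next
  case False
  then show ?thesis using block_le_iff[of "tc q'" "tc p"] tc_range assms cell(3) by auto
qed

lemma increasing_w: "increasing_on_blocks n J w"
  unfolding increasing_on_blocks_def
proof (intro allI impI)
  fix a b assume ab: "1 \<le> a" "a < b" "b \<le> n" "block J a = block J b"
  have c: "cell a \<in> D" "cell b \<in> D" "tc (cell a) = a" "tc (cell b) = b" using cell ab by auto
  have "snd (cell a) = snd (cell b)" using block_cell[OF c(1,2)] c(3,4) ab(4) by simp
  then have "fst (cell a) < fst (cell b)" using tc_rank(1)[OF c(1,2)] c(3,4) ab by simp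
  then have "tr (cell a) < tr (cell b)" using tr_rank(1)[OF c(1,2)] by simp
  then show "w a < w b" using w_props(2)[OF c(1)] w_props(2)[OF c(2)] c(3,4) by simp
qed

lemma inversions_subset_iff:
  assumes z: "z \<in> W n"
  shows "inversions n z \<subseteq> inversions n w \<longleftrightarrow>
    (\<forall>p\<in>D. \<forall>q'\<in>D. fst p \<le> fst q' \<and> snd p \<le> snd q' \<and> p \<noteq> q' \<longrightarrow> z (tc p) < z (tc q'))"
proof -
  have "inversions n z \<subseteq> inversions n w \<longleftrightarrow>
    (\<forall>a b. 1 \<le> a \<and> a < b \<and> b \<le> n \<and> w a < w b \<longrightarrow> z a < z b)"
  proof
    assume sub: "inversions n z \<subseteq> inversions n w"
    show "\<forall>a b. 1 \<le> a \<and> a < b \<and> b \<le> n \<and> w a < w b \<longrightarrow> z a < z b"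
    proof (intro allI impI)
      fix a b assume ab: "1 \<le> a \<and> a < b \<and> b \<le> n \<and> w a < w b"
      then have "(a, b) \<notin> inversions n z" using sub by (auto simp: inversions_def)
      moreover have "z a \<noteq> z b" using W_inj[OF z, of a b] ab by simp
      ultimately show "z a < z b" using ab by (simp add: inversions_def)
    qed
  next
    assume h: "\<forall>a b. 1 \<le> a \<and> a < b \<and> b \<le> n \<and> w a < w b \<longrightarrow> z a < z b"
    show "inversions n z \<subseteq> inversions n w"
    proof
      fix p assume "p \<in> inversions n z"
      then obtain a b where ab: "p = (a, b)" "1 \<le> a" "a < b" "b \<le> n" "z b < z a" by (auto simp: inversions_def)
      then have "\<not> w a < w b" using h less_asym by blast
      moreover have "w a \<noteq> w b" using W_inj[OF w_props(1), of a b] ab by simp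
      ultimately show "p \<in> inversions n w" using ab by (simp add: inversions_def)
    qed
  qed
  also have "\<dots> \<longleftrightarrow> (\<forall>p\<in>D. \<forall>q'\<in>D. tc p < tc q' \<and> w (tc p) < w (tc q') \<longrightarrow> z (tc p) < z (tc q'))"
  proof (intro iffI ballI allI impI)
    fix a b assume h: "\<forall>p\<in>D. \<forall>q'\<in>D. tc p < tc q' \<and> w (tc p) < w (tc q') \<longrightarrow> z (tc p) < z (tc q')"
      and ab: "1 \<le> a \<and> a < b \<and> b \<le> n \<and> w a < w b"
    show "z a < z b" using h[rule_format, of "cell a" "cell b"] cell(1,2)[of a] cell(1,2)[of b] ab by simp
  next
    fix p q' assume "\<forall>a b. 1 \<le> a \<and> a < b \<and> b \<le> n \<and> w a < w b \<longrightarrow> z a < z b"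
      "p \<in> D" "q' \<in> D" "tc p < tc q' \<and> w (tc p) < w (tc q')"
    then show "z (tc p) < z (tc q')" using tc_range by blast
  qed
  also have "\<dots> \<longleftrightarrow> (\<forall>p\<in>D. \<forall>q'\<in>D. fst p \<le> fst q' \<and> snd p \<le> snd q' \<and> p \<noteq> q' \<longrightarrow> z (tc p) < z (tc q'))"
  proof -
    \<comment> \<open>\<open>tc\<close> and \<open>tr\<close> are lexicographic with opposite
      priorities; together they give the componentwise order.\<close>
    have "tc p < tc q' \<and> w (tc p) < w (tc q') \<longleftrightarrow> fst p \<le> fst q' \<and> snd p \<le> snd q' \<and> p \<noteq> q'"
      if "p \<in> D" "q' \<in> D" for p q'
      using tc_rank(1)[OF that] tr_rank(1)[OF that] w_props(2) that by (auto simp: prod_eq_iff)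
    then show ?thesis by blast
  qed
  finally show ?thesis .
qed

lemma standard_iff_rows_columns:
  assumes z: "z \<in> W n"
  shows "tab_act la mu z tc \<in> std n la mu \<longleftrightarrow>
    (\<forall>i j j'. (i, j) \<in> D \<and> (i, j') \<in> D \<and> j < j' \<longrightarrow> z (tc (i, j)) < z (tc (i, j'))) \<and>
    (\<forall>i i' j. (i, j) \<in> D \<and> (i', j) \<in> D \<and> i < i' \<longrightarrow> z (tc (i, j)) < z (tc (i', j)))"
proof -
  let ?t = "tab_act la mu z tc"
  have t: "?t p = z (tc p)" if "p \<in> D" for p using that by (simp add: tab_act_def compose_def)
  have "bij_betw z {1..n} {1..n}" using permutes_imp_bij[OF W_permutes[OF z]] .
  from bij_betw_trans[OF tc_rank(2) this] have "bij_betw ?t D {1..n}"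
    by (rule bij_betw_cong[THEN iffD1, rotated]) (simp add: t)
  then have "?t \<in> tableaux n la mu" by (simp add: tableaux_def tab_act_def compose_def)
  then show ?thesis unfolding std_def using t by auto
qed

text \<open>A componentwise comparison is factored through the corner in the row of the first cell
  and the column of the second, which belongs to the diagram by \<open>D_rectangle\<close>.\<close>

lemma standard_iff:
  assumes z: "z \<in> W n" shows "tab_act la mu z tc \<in> std n la mu \<longleftrightarrow> inversions n z \<subseteq> inversions n w"
  unfolding inversions_subset_iff[OF z] standard_iff_rows_columns[OF z]
proof
  assume std: "(\<forall>i j j'. (i, j) \<in> D \<and> (i, j') \<in> D \<and> j < j' \<longrightarrow> z (tc (i, j)) < z (tc (i, j'))) \<and>
    (\<forall>i i' j. (i, j) \<in> D \<and> (i', j) \<in> D \<and> i < i' \<longrightarrow> z (tc (i, j)) < z (tc (i', j)))"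
  show "\<forall>p\<in>D. \<forall>q'\<in>D. fst p \<le> fst q' \<and> snd p \<le> snd q' \<and> p \<noteq> q' \<longrightarrow> z (tc p) < z (tc q')"
  proof (intro ballI impI)
    fix p q' assume pq: "p \<in> D" "q' \<in> D" and le: "fst p \<le> fst q' \<and> snd p \<le> snd q' \<and> p \<noteq> q'"
    obtain i j i' j' where e: "p = (i, j)" "q' = (i', j')" by (cases p; cases q') auto
    have r: "(i, j') \<in> D" using D_rectangle[of i j i' j' i j'] pq le e by simp
    have "z (tc (i, j)) \<le> z (tc (i, j'))" using std r pq le e by (cases "j = j'") (auto intro: less_imp_le)
    moreover have "z (tc (i, j')) \<le> z (tc (i', j'))" using std r pq le e by (cases "i = i'") (auto intro: less_imp_le)
    moreover have "z (tc p) \<noteq> z (tc q')"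
      using W_inj[OF z] inj_onD[OF bij_betw_imp_inj_on[OF tc_rank(2)]] pq le by metis
    ultimately show "z (tc p) < z (tc q')" using e by simp
  qed
next
  assume "\<forall>p\<in>D. \<forall>q'\<in>D. fst p \<le> fst q' \<and> snd p \<le> snd q' \<and> p \<noteq> q' \<longrightarrow> z (tc p) < z (tc q')"
  then show "(\<forall>i j j'. (i, j) \<in> D \<and> (i, j') \<in> D \<and> j < j' \<longrightarrow> z (tc (i, j)) < z (tc (i, j'))) \<and>
    (\<forall>i i' j. (i, j) \<in> D \<and> (i', j) \<in> D \<and> i < i' \<longrightarrow> z (tc (i, j)) < z (tc (i', j)))"
    by force
qed

lemma weak_interval_standard:
  assumes x: "x \<in> W n"
  shows "x \<in> weak_interval n J w \<longleftrightarrow> tab_act la mu (x \<circ> longest n J) tc \<in> std n la mu"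
  unfolding weak_interval_iff[OF J_S w_props(1) increasing_w x]
  using standard_iff[OF W_comp[OF x longest_W[OF J_S]]] by simp

lemma longest_in_weak_interval: "longest n J \<in> weak_interval n J w"
  unfolding weak_interval_iff[OF J_S w_props(1) increasing_w longest_W[OF J_S]] longest_comp_longest[OF J_S] by simp

end

lemma bij_increasing_fixes:
  fixes f :: "nat \<Rightarrow> nat"
  assumes bij: "bij_betw f {1..n} {1..n}"
    and mono: "\<And>a b. 1 \<le> a \<Longrightarrow> a < b \<Longrightarrow> b \<le> n \<Longrightarrow> f a < f b"
    and a: "1 \<le> a" "a \<le> n"
  shows "f a = a"
proof -
  define u where "u b = (if b \<in> {1..n} then f b else b)" for b
  have "u permutes {1..n}"
  proof (rule inj_imp_permutes)
    show "inj_on u {1..n}"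
      using bij_betw_imp_inj_on[OF bij] by (subst inj_on_cong[of _ u f]) (auto simp: u_def)
    show "u b \<in> {1..n}" if "b \<in> {1..n}" for b using bij_betwE[OF bij] that unfolding u_def by simp
    show "u b = b" if "b \<notin> {1..n}" for b using that unfolding u_def by (rule if_not_P)
  qed simp
  then have "u \<in> W n" by (simp add: W_def)
  then have u: "u = id" by (rule increasing_id) (use mono in \<open>auto simp: u_def\<close>)
  have "f a = u a" using a by (simp add: u_def)
  then show ?thesis unfolding u by simp
qed

section \<open>Closure of the standard tableaux under left cells\<close>

context skew_shape
begin

text \<open>The place in the word of \<open>x\<close> of the entry that the tableau of
  \<open>x w_J\<close> has at \<open>p\<close>: columns from left to right, each read from bottom to
  top.\<close>

abbreviation pos :: "nat \<times> nat \<Rightarrow> nat" where "pos p \<equiv> longest n J (tc p)"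

lemma pos_less:
  assumes "p \<in> D" "r \<in> D"
  shows "pos p < pos r \<longleftrightarrow> snd p < snd r \<or> snd p = snd r \<and> fst r < fst p"
proof -
  have i: "tc p \<in> {1..n}" "tc r \<in> {1..n}" using tc_range assms by auto
  have "block J (tc p) < block J (tc r) \<longleftrightarrow> snd p < snd r"
    using block_cell[OF assms] block_mono[of "tc p" "tc r" J] block_mono[of "tc r" "tc p" J]
      tc_rank(1)[OF assms] tc_rank(1)[OF assms(2,1)]
    by (metis le_neq_implies_less less_imp_le linorder_neqE_nat not_less order_less_irrefl)
  then show ?thesis unfolding longest_less_block[OF J_S i]
    using block_cell[OF assms] tc_rank(1)[OF assms(2,1)] by auto
qed

lemma pos_range: "p \<in> D \<Longrightarrow> 1 \<le> pos p \<and> pos p \<le> n"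
  using W_in'[OF longest_W[OF J_S], of "tc p"] tc_range[of p] by simp

lemma pos_next:
  assumes p: "p \<in> D" and r: "r \<in> D" and less: "pos p < pos r"
    and none: "\<And>d. d \<in> D \<Longrightarrow> pos p < pos d \<Longrightarrow> pos d < pos r \<Longrightarrow> False"
  shows "pos r = pos p + 1"
proof (rule ccontr)
  assume "pos r \<noteq> pos p + 1"
  then have l: "pos p + 1 < pos r" using less by simp
  define a where "a = longest n J (pos p + 1)"
  have "1 \<le> a" "a \<le> n"
    using W_in'[OF longest_W[OF J_S], of "pos p + 1"] l pos_range[OF r] by (auto simp: a_def)
  then have "cell a \<in> D" "tc (cell a) = a" using cell by auto
  moreover have "longest n J a = pos p + 1" unfolding a_def by (rule longest_longest[OF J_S])
  ultimately show False using none[of "cell a"] l by simp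
qed

lemma pos_down:
  assumes "(i + 1, j) \<in> D" "(i, j) \<in> D" shows "pos (i, j) = pos (i + 1, j) + 1"
proof (rule pos_next[OF assms])
  show "pos (i + 1, j) < pos (i, j)" using pos_less[OF assms] by simp
  show False if "d \<in> D" "pos (i + 1, j) < pos d" "pos d < pos (i, j)" for d
    using that pos_less[OF assms(1), of d] pos_less[OF _ assms(2), of d] by auto
qed

lemma pos_column:
  assumes "(i, j) \<in> D" "(i + k, j) \<in> D" shows "pos (i, j) = pos (i + k, j) + k"
  using assms
proof (induction k)
  case (Suc k)
  have "(i + k, j) \<in> D" by (rule D_rectangle[OF Suc.prems]) auto
  then show ?case using Suc pos_down[of "i + k" j] by simp
qed simp

text \<open>The rows \<open>i0, \<dots>, i1\<close> of the proof are those in which both columns have a cell. In the word these cells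
  form a window as in \<open>cell_eq_window\<close>, read from bottom to top and column by column.\<close>

lemma row_condition_cell_eq:
  assumes x: "\<And>p r. p \<in> D \<Longrightarrow> r \<in> D \<Longrightarrow> fst p \<le> fst r \<Longrightarrow> snd p \<le> snd r \<Longrightarrow> p \<noteq> r \<Longrightarrow> x (pos p) < x (pos r)"
    and xy: "cell_eq n x y" and ij: "(i, j) \<in> D" "(i, j + 1) \<in> D"
  shows "y (pos (i, j)) < y (pos (i, j + 1))"
proof -
  define A where "A = {i. (i, j) \<in> D}"
  define B where "B = {i. (i, j + 1) \<in> D}"
  have "A \<subseteq> fst ` D" "B \<subseteq> fst ` D" by (force simp: A_def B_def)+
  then have fin: "finite A" "finite B" using finite_D by (meson finite_imageI finite_subset)+
  have iAB: "i \<in> A" "i \<in> B" using ij by (auto simp: A_def B_def)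
  define i0 where "i0 = Min A"
  define i1 where "i1 = Max B"
  have i0: "(i0, j) \<in> D" "i0 \<le> i" "\<And>k. (k, j) \<in> D \<Longrightarrow> i0 \<le> k"
    using Min_in[OF fin(1)] Min_le[OF fin(1)] iAB by (auto simp: A_def i0_def)
  have i1: "(i1, j + 1) \<in> D" "i \<le> i1" "\<And>k. (k, j + 1) \<in> D \<Longrightarrow> k \<le> i1"
    using Max_in[OF fin(2)] Max_ge[OF fin(2)] iAB by (auto simp: B_def i1_def)
  have rect: "(k, j) \<in> D \<and> (k, j + 1) \<in> D" if "i0 \<le> k" "k \<le> i1" for k
    using D_rectangle[OF i0(1) i1(1), of k j] D_rectangle[OF i0(1) i1(1), of k "j + 1"] that by simp
  define m where "m = i1 - i0 + 1"
  have i01: "i0 \<le> i1" using i0(2) i1(2) by simp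
  let ?p = "pos (i1, j)"
  \<comment> \<open>\<open>(i0, j)\<close> is the top cell of its column and is read last there;
    \<open>(i1, j + 1)\<close> is the bottom cell of the next column and is read first. So the cells
    of the common rows occupy one contiguous stretch of the word.\<close>
  have jump: "pos (i1, j + 1) = pos (i0, j) + 1"
  proof (rule pos_next[OF i0(1) i1(1)])
    show "pos (i0, j) < pos (i1, j + 1)" using pos_less[OF i0(1) i1(1)] by simp
    show False if d: "d \<in> D" "pos (i0, j) < pos d" "pos d < pos (i1, j + 1)" for d
    proof -
      obtain a b where ab: "d = (a, b)" by (cases d)
      have "j < b \<or> j = b \<and> a < i0" "b < j + 1 \<or> b = j + 1 \<and> i1 < a"
        using d(2,3) pos_less[OF i0(1) d(1)] pos_less[OF d(1) i1(1)] ab by auto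
      then show False using i0(3)[of a] i1(3)[of a] d(1) ab by auto
    qed
  qed
  have left: "pos (i1 - k, j) = ?p + k" if "k < m" for k
    using pos_column[of "i1 - k" j k] rect[of "i1 - k"] rect[of i1] that i01 by (simp add: m_def)
  have right: "pos (i1 - k, j + 1) = ?p + m + k" if "k < m" for k
  proof -
    have "pos (i1 - k, j + 1) = pos (i1, j + 1) + k"
      using pos_column[of "i1 - k" "j + 1" k] rect[of "i1 - k"] rect[of i1] that i01 by (simp add: m_def)
    moreover have "pos (i0, j) = ?p + (m - 1)" using left[of "m - 1"] i01 by (simp add: m_def)
    ultimately show ?thesis using jump by (simp add: m_def)
  qed
  have "y (?p + (i1 - i)) < y (?p + m + (i1 - i))"
  proof (rule cell_eq_window[OF xy])
    show "1 \<le> ?p" using pos_range rect[of i1] i01 by simp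
    have "pos (i0, j + 1) = ?p + m + (m - 1)" using right[of "m - 1"] i01 by (simp add: m_def)
    then show "?p + 2 * m \<le> n + 1" using pos_range[of "(i0, j + 1)"] rect[of i0] i01 by (simp add: m_def)
    show "x (?p + k + 1) < x (?p + k)" if "k + 1 < m" for k
      using x[of "(i1 - (k + 1), j)" "(i1 - k, j)"] left[of k] left[of "k + 1"]
        rect[of "i1 - k"] rect[of "i1 - (k + 1)"] that i01 by (simp add: m_def)
    show "x (?p + m + k + 1) < x (?p + m + k)" if "k + 1 < m" for k
      using x[of "(i1 - (k + 1), j + 1)" "(i1 - k, j + 1)"] right[of k] right[of "k + 1"]
        rect[of "i1 - k"] rect[of "i1 - (k + 1)"] that i01 by (simp add: m_def)
    show "x (?p + k) < x (?p + m + k)" if "k < m" for k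
      using x[of "(i1 - k, j)" "(i1 - k, j + 1)"] left[of k] right[of k] rect[of "i1 - k"] that i01
      by (simp add: m_def)
    show "i1 - i < m" using i0(2) i01 by (simp add: m_def)
  qed
  moreover have "i1 - i < m" "i1 - (i1 - i) = i" using i0(2) i1(2) by (auto simp: m_def)
  ultimately show ?thesis using left[of "i1 - i"] right[of "i1 - i"] by simp
qed

text \<open>The column conditions are right descents, which a left cell shares. Row conditions for
  adjacent cells come from \<open>row_condition_cell_eq\<close>; the others follow along the row,
  whose intermediate cells belong to the diagram.\<close>

lemma weak_interval_closed:
  assumes x: "x \<in> weak_interval n J w" and xy: "cell_eq n x y"
  shows "y \<in> weak_interval n J w"
proof -
  let ?v = "longest n J"
  have xW: "x \<in> W n" and yW: "y \<in> W n" using xy by (auto simp: cell_eq_def)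
  note v = longest_W[OF J_S]
  have "inversions n (x \<circ> ?v) \<subseteq> inversions n w"
    using weak_interval_iff[OF J_S w_props(1) increasing_w xW] x by simp
  then have X: "x (pos p) < x (pos r)" if "p \<in> D" "r \<in> D" "fst p \<le> fst r" "snd p \<le> snd r" "p \<noteq> r" for p r
    using inversions_subset_iff[OF W_comp[OF xW v]] that by simp
  have "block_inversions n J \<subseteq> inversions n x"
    using weak_interval_iff_inversions[OF J_S w_props(1) xW] x by simp
  then have desc: "y (k + 1) < y k" if "1 \<le> k" "k < n" "simple k \<in> J" for k
  proof -
    have "same_block J k (k + 1)" using that by (auto simp: same_block_def le_less_Suc_eq)
    then have "(k, k + 1) \<in> block_inversions n J" using that by (simp add: block_inversions_def)
    then have "right_desc x k" using \<open>block_inversions n J \<subseteq> inversions n x\<close>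
      by (auto simp: inversions_def right_desc_def)
    then show ?thesis using cell_eq_right_desc[OF xy that(1,2)] by (simp add: right_desc_def)
  qed
  have "block_inversions n J \<subseteq> inversions n y"
  proof
    fix p assume "p \<in> block_inversions n J"
    then obtain a b where ab: "p = (a, b)" "1 \<le> a" "a < b" "b \<le> n" "same_block J a b"
      by (auto simp: block_inversions_def)
    have "y b < y a"
      by (rule step_decreasing[of a b]) (use ab desc in \<open>auto simp: same_block_def\<close>)
    then show "p \<in> inversions n y" using ab by (simp add: inversions_def)
  qed
  then have inc: "increasing_on_blocks n J (y \<circ> ?v)" unfolding block_inversions_subset_iff[OF J_S] .
  have col: "y (pos p) < y (pos r)" if "p \<in> D" "r \<in> D" "snd p = snd r" "fst p < fst r" for p r
    using inc block_cell[OF that(1,2)] tc_rank(1)[OF that(1,2)] tc_range that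
    unfolding increasing_on_blocks_def by simp
  have row: "y (pos (i, j)) < y (pos (i, j'))" if "(i, j) \<in> D" "(i, j') \<in> D" "j < j'" for i j j'
    using that(3,2)
  proof (induction j' rule: less_induct)
    case (less k)
    define l where "l = k - 1"
    have l: "k = l + 1" "j \<le> l" using less.prems by (auto simp: l_def)
    have lD: "(i, l) \<in> D" by (rule D_rectangle[OF that(1) less.prems(2)]) (use l in auto)
    have "y (pos (i, l)) < y (pos (i, k))"
      using row_condition_cell_eq[OF X xy lD] less.prems(2) l(1) by simp
    moreover have "y (pos (i, j)) \<le> y (pos (i, l))"
      using less.IH[of l] l lD by (cases "j = l") auto
    ultimately show ?case by simp
  qed
  have "tab_act la mu (y \<circ> ?v) tc \<in> std n la mu"
    unfolding standard_iff_rows_columns[OF W_comp[OF yW v]] using row col by auto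
  then show ?thesis using weak_interval_standard[OF yW] by simp
qed

end

text \<open>The label \<open>a\<close> is put into the cell \<open>(row a, col a)\<close>. On these
  cells \<open>tau_col\<close> is increasing in the label and \<open>tau_row\<close> in the value of
  \<open>w\<close>. An increasing bijection of \<open>{1..n}\<close> to itself is the identity, so
  both tableaux carry exactly these numbers.\<close>

lemma (in skew_poset) exists_skew_shape:
  assumes n: "1 \<le> n"
  shows "\<exists>la mu. skew_partition n la mu \<and> w = perm n la mu (tau_row la mu) \<and> J = J_skew n la mu"
proof -
  have bt: "col_top j \<le> col_bottom j" if "1 \<le> j" "j \<le> col n" for j
    using bottom_label[OF that n] by (simp add: col_bottom_def row_def)
  obtain la mu where sk: "skew_partition (card (skew_diagram la mu)) la mu"
    and D: "skew_diagram la mu = {(i, j). 1 \<le> j \<and> j \<le> col n \<and> col_top j \<le> i \<and> i \<le> col_bottom j}"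
    using exists_skew_partition[of "col n" col_top col_bottom, OF block_ge_1 _ bt col_top_antimono
        col_bottom_antimono[OF _ _ _ n]] by (auto simp: col_top_def)
  let ?c = "\<lambda>a. (row a, col a)"
  have bij: "bij_betw ?c {1..n} (skew_diagram la mu)"
  proof (rule bij_betw_imageI)
    show "inj_on ?c {1..n}"
    proof (rule inj_onI)
      fix a b assume ab: "a \<in> {1..n}" "b \<in> {1..n}" "?c a = ?c b"
      then have "\<not> a < b" "\<not> b < a" using label_less_iff[of a b] label_less_iff[of b a] by auto
      then show "a = b" by simp
    qed
    show "?c ` {1..n} = skew_diagram la mu"
    proof (intro equalityI subsetI)
      fix p assume "p \<in> ?c ` {1..n}"
      then obtain a where "p = ?c a" "1 \<le> a" "a \<le> n" by auto
      then show "p \<in> skew_diagram la mu" unfolding D using row_bounds[of a] col_le[of a] block_ge_1[of J a] by auto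
    next
      fix p assume "p \<in> skew_diagram la mu"
      then obtain i j where "p = (i, j)" "1 \<le> j" "j \<le> col n" "col_top j \<le> i" "i \<le> col_bottom j"
        unfolding D by auto
      then show "p \<in> ?c ` {1..n}" using row_surj[of j i] n by auto
    qed
  qed
  have "card (skew_diagram la mu) = n" using bij_betw_same_card[OF bij] by simp
  then have skn: "skew_partition n la mu" using sk by simp
  interpret sk: skew_shape n la mu by unfold_locales (rule skn)
  have cD: "?c a \<in> sk.D" if "1 \<le> a" "a \<le> n" for a using bij_betwE[OF bij] that by auto
  have tc: "sk.tc (?c a) = a" if "1 \<le> a" "a \<le> n" for a
  proof (rule bij_increasing_fixes[of "\<lambda>a. sk.tc (?c a)", OF _ _ that])
    show "bij_betw (\<lambda>a. sk.tc (?c a)) {1..n} {1..n}"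
      using bij_betw_trans[OF bij sk.tc_rank(2)] by (simp add: comp_def)
    show "sk.tc (?c a) < sk.tc (?c b)" if "1 \<le> a" "a < b" "b \<le> n" for a b
      using sk.tc_rank(1)[OF cD cD, of a b] label_less_iff[of a b] that by auto
  qed
  have tr: "sk.tr (?c a) = w a" if a: "1 \<le> a" "a \<le> n" for a
  proof -
    note iw = W_inv[OF w]
    have "sk.tr (?c (inv w b)) = b" if b: "1 \<le> b" "b \<le> n" for b
    proof (rule bij_increasing_fixes[of "\<lambda>a. sk.tr (?c (inv w a))", OF _ _ b])
      show "bij_betw (\<lambda>a. sk.tr (?c (inv w a))) {1..n} {1..n}"
        using bij_betw_trans[OF bij_betw_trans[OF permutes_imp_bij[OF W_permutes[OF iw]] bij] sk.tr_rank(2)]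
        by (simp add: comp_def)
      show "sk.tr (?c (inv w a)) < sk.tr (?c (inv w b))" if ab: "1 \<le> a" "a < b" "b \<le> n" for a b
      proof -
        have r: "1 \<le> inv w a" "inv w a \<le> n" "1 \<le> inv w b" "inv w b \<le> n"
          using W_in'[OF iw, of a] W_in'[OF iw, of b] ab by auto
        have "w (inv w a) < w (inv w b)" using W_f_inv[OF w] ab by simp
        then show ?thesis using sk.tr_rank(1)[OF cD[OF r(1,2)] cD[OF r(3,4)]] w_less_iff[OF r] by simp
      qed
    qed
    from this[of "w a"] show ?thesis using W_in'[OF w a] W_inv_f[OF w, of a] by simp
  qed
  have "perm n la mu (tau_row la mu) = w"
  proof (rule sk.perm_eqI[OF w])
    fix p assume "p \<in> sk.D"
    then have "p \<in> ?c ` {1..n}" unfolding bij_betw_imp_surj_on[OF bij] .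
    then obtain a where "p = ?c a" "1 \<le> a" "a \<le> n" by auto
    then show "w (sk.tc p) = sk.tr p" using tc tr by simp
  qed
  moreover have "J = J_skew n la mu"
  proof -
    have cell: "sk.cell a = ?c a" if "1 \<le> a" "a \<le> n" for a
      using sk.cell(3)[OF cD[OF that]] tc[OF that] by simp
    have "simple k \<in> J \<longleftrightarrow> simple k \<in> J_skew n la mu" if "1 \<le> k" "k < n" for k
      using sk.simple_in_J[OF that] cell[of k] cell[of "k + 1"] block_Suc[of k J] that by auto
    then show ?thesis using J sk.J_S unfolding S_def by blast
  qed
  ultimately show ?thesis using skn by blast
qed

theorem corollary4p17:
  fixes n :: nat and w :: "nat \<Rightarrow> nat" and J :: "(nat \<Rightarrow> nat) set"
  assumes "n > 0" and "w \<in> W n" and "J \<subseteq> S n"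
  shows "({x \<in> W n. left_weak_le n (longest n J) x \<and> left_weak_le n x (w \<circ> longest n J)} \<noteq> {} \<and>
          (\<exists>\<C> \<subseteq> left_cells n.
             {x \<in> W n. left_weak_le n (longest n J) x \<and> left_weak_le n x (w \<circ> longest n J)} = \<Union>\<C>)
         \<longleftrightarrow>
          (\<exists>la mu. skew_partition n la mu \<and> w = perm n la mu (tau_row la mu) \<and> J = J_skew n la mu))
       \<and> (\<forall>la mu. skew_partition n la mu \<and> w = perm n la mu (tau_row la mu) \<and> J = J_skew n la mu
            \<longrightarrow> (\<forall>x \<in> W n.
                  left_weak_le n (longest n J) x \<and> left_weak_le n x (w \<circ> longest n J)
                  \<longleftrightarrow> tab_act la mu (x \<circ> longest n J) (tau_col la mu) \<in> std n la mu))"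
proof -
  let ?X = "weak_interval n J w"
  have X: "{x \<in> W n. left_weak_le n (longest n J) x \<and> left_weak_le n x (w \<circ> longest n J)} = ?X"
    by (simp add: weak_interval_def)
  have XW: "?X \<subseteq> W n" by (auto simp: weak_interval_def)
  have "\<exists>la mu. skew_partition n la mu \<and> w = perm n la mu (tau_row la mu) \<and> J = J_skew n la mu"
    if ne: "?X \<noteq> {}" and cells: "\<exists>\<C> \<subseteq> left_cells n. ?X = \<Union>\<C>"
  proof -
    have closed: "y \<in> ?X" if "x \<in> ?X" "cell_eq n x y" for x y
      using cells that unfolding union_of_left_cells_iff[OF XW] by blast
    note inc = weak_interval_nonempty[OF assms(3,2) ne]
    interpret skew_poset n w J
    proof
      show "w \<in> W n" "J \<subseteq> S n" "increasing_on_blocks n J w" using assms inc by auto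
    qed (rule dual_knuth_closed[OF assms(3,2) inc closed])
    show ?thesis using exists_skew_shape assms(1) by simp
  qed
  moreover have "?X \<noteq> {} \<and> (\<exists>\<C> \<subseteq> left_cells n. ?X = \<Union>\<C>)"
    if sk: "skew_partition n la mu" "w = perm n la mu (tau_row la mu)" "J = J_skew n la mu" for la mu
  proof -
    interpret skew_shape n la mu by unfold_locales (rule sk(1))
    show ?thesis unfolding union_of_left_cells_iff[OF XW]
      using longest_in_weak_interval weak_interval_closed unfolding sk(2,3) by blast
  qed
  moreover have "left_weak_le n (longest n J) x \<and> left_weak_le n x (w \<circ> longest n J) \<longleftrightarrow>
      tab_act la mu (x \<circ> longest n J) (tau_col la mu) \<in> std n la mu"
    if sk: "skew_partition n la mu" "w = perm n la mu (tau_row la mu)" "J = J_skew n la mu" and x: "x \<in> W n"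
    for la mu x
  proof -
    interpret skew_shape n la mu by unfold_locales (rule sk(1))
    have "x \<in> ?X \<longleftrightarrow> tab_act la mu (x \<circ> longest n J) (tau_col la mu) \<in> std n la mu"
      using weak_interval_standard[OF x] unfolding sk(2,3) .
    then show ?thesis using x by (simp add: weak_interval_def)
  qed
  ultimately show ?thesis unfolding X by blast
qed

end
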